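(* Let $k\ge 2$ and $m\ge 2$ be integers, let $a_1,a_2\in\mathbb{R}$ and $0\le l\le 1$. In the hierarchical normal model described in the context, take the prior $\pi(\boldsymbol\beta)=1$ for $\boldsymbol\beta\in\mathbb{R}^k$, and suppose that there are constants $C_1,C_2>0$ such that for all $k\times k$ orthonormal $\mathbf{H}$ and all $\mathbf{D}=\mathrm{diag}(d_1,\dots,d_k)$ with $d_1>d_2>\cdots>d_k>0$, $$\frac{C_1[\prod_{i<j}(d_i-d_j)]^l}{|\mathbf{I}+\mathbf{D}|^{a_2-a_1}|\mathbf{D}|^{a_1}}\le \pi(\mathbf{H},\mathbf{D})\le \frac{C_2[\prod_{i<j}(d_i-d_j)]^l}{|\mathbf{I}+\mathbf{D}|^{a_2-a_1}|\mathbf{D}|^{a_1}}.$$ Then the posterior distribution exists if and only if $a_1<1$ and $a_2>\frac{3-m}{2}+(k-1)l$.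
   Context: Model: $p=mk$, and $\mathbf{X}=(\mathbf{X}_1,\dots,\mathbf{X}_m)\in\mathbb{R}^p$ with $\mathbf{X}_i\in\mathbb{R}^k$. Independently for $i=1,\dots,m$, $\mathbf{X}_i\mid\boldsymbol\theta_i\sim N_k(\boldsymbol\theta_i,\mathbf{I})$ and $\boldsymbol\theta_i\mid\boldsymbol\beta,\mathbf{V}\sim N_k(\boldsymbol\beta,\mathbf{V})$, where $\boldsymbol\beta\in\mathbb{R}^k$ and $\mathbf{V}$ is a $k\times k$ positive-definite matrix; $\boldsymbol\theta=(\boldsymbol\theta_1,\dots,\boldsymbol\theta_m)$. The hyperprior is a (possibly improper) density $\pi(\boldsymbol\beta)\pi(\mathbf{V})$. Change of variables: write $\mathbf{V}=\mathbf{H}^t\mathbf{D}\mathbf{H}$ with $\mathbf{H}$ orthonormal and $\mathbf{D}=\mathrm{diag}(d_1,\dots,d_k)$, $d_1>\cdots>d_k>0$ the eigenvalues of $\mathbf{V}$. The prior on $\mathbf{V}$ is rewritten as $\pi(\mathbf{V})\,d\mathbf{V}=\pi(\mathbf{H},\mathbf{D})I_{[d_1>\cdots>d_k]}\,d\mathbf{D}\,d\mathbf{H}$, where $d\mathbf{V}=\prod_{i\le j}dV_{ij}$, $d\mathbf{D}=\prod_i dd_i$, $d\mathbf{H}$ is the invariant Haar measure on orthonormal matrices, and $\pi(\mathbf{H},\mathbf{D})=\pi(\mathbf{H}^t\mathbf{D}\mathbf{H})\prod_{i<j}(d_i-d_j)$. $|\cdot|$ of a matrix is its determinant. The marginal density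 is $m(\mathbf{x})=\iiint f(\mathbf{x}|\boldsymbol\theta)\pi(\boldsymbol\theta|\boldsymbol\beta,\mathbf{V})\pi(\boldsymbol\beta)\pi(\mathbf{V})\,d\mathbf{V}\,d\boldsymbol\beta\,d\boldsymbol\theta$, where $f(\mathbf{x}|\boldsymbol\theta)$ and $\pi(\boldsymbol\theta|\boldsymbol\beta,\mathbf{V})$ are the normal densities of the model. The posterior distribution (given $\mathbf{X}=\mathbf{x}$, for a given $\mathbf{x}\in\mathbb{R}^p$) is said to exist (be proper) if $0<m(\mathbf{x})<\infty$. *)

theory Defs
  imports "HOL-Analysis.Analysis"
begin

definition diag_mat :: "real^'k \<Rightarrow> real^'k^'k" where
  "diag_mat d = (\<chi> i j. if i = j then d $ i else 0)"

definition pos_def :: "real^'k^'k \<Rightarrow> bool" where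
  "pos_def V \<longleftrightarrow> transpose V = V \<and> (\<forall>x. x \<noteq> 0 \<longrightarrow> x \<bullet> (V *v x) > 0)"

text \<open>The density at \<open>x\<close> of the normal law with mean \<open>\<mu>\<close> and covariance matrix \<open>\<Sigma>\<close>;
  meaningful for positive-definite \<open>\<Sigma>\<close>.\<close>

definition mvn_density :: "real^'k \<Rightarrow> real^'k^'k \<Rightarrow> real^'k \<Rightarrow> real" where
  "mvn_density \<mu> \<Sigma> x =
     exp (- (1/2) * ((x - \<mu>) \<bullet> (matrix_inv \<Sigma> *v (x - \<mu>)))) / sqrt ((2 * pi) ^ CARD('k) * det \<Sigma>)"

text \<open>The order on the index type of the coordinates of \<open>\<real>\<^sup>k\<close> is needed for the products over
  \<open>i < j\<close> and for the ordering of the eigenvalues. On finite types \<open>wellorder\<close> is the same as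
  \<open>linorder\<close>; it is the class that the change-of-variables theorems of HOL-Analysis ask for.

  The measure \<open>dV = \<Prod>\<^bsub>i\<le>j\<^esub> dV\<^bsub>ij\<^esub>\<close> lives on the symmetric matrices, which are Lebesgue-null in
  the space of all matrices. It is the image of Lebesgue measure on the entries with \<open>i \<le> j\<close>.\<close>

definition sym_matrix_of ::
  "('k::{finite,wellorder} \<times> 'k \<Rightarrow> real) \<Rightarrow> real^'k::{finite,wellorder}^'k::{finite,wellorder}" where
  "sym_matrix_of v = (\<chi> i j. v (min i j, max i j))"

definition sym_lborel :: "(real^'k::{finite,wellorder}^'k::{finite,wellorder}) measure" where
  "sym_lborel = distr (\<Pi>\<^sub>M p\<in>{(i, j). i \<le> j}. lborel) borel sym_matrix_of"

lemma measurable_sym_matrix_of: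
  "(sym_matrix_of :: _ \<Rightarrow> real^'k::{finite,wellorder}^'k::{finite,wellorder})
     \<in> borel_measurable (\<Pi>\<^sub>M p\<in>{(i, j). i \<le> j}. lborel)"
proof -
  have "(\<lambda>v. sym_matrix_of v \<bullet> axis i (axis j 1))
      \<in> borel_measurable (\<Pi>\<^sub>M p\<in>{(i, j). i \<le> j}. lborel)" for i j :: 'k
  proof -
    have "(\<lambda>v. v (min i j, max i j)) \<in> measurable (\<Pi>\<^sub>M p\<in>{(i, j). i \<le> j}. lborel) (lborel :: real measure)"
      by (rule measurable_component_singleton) (auto simp: min_def max_def)
    then show ?thesis
      by (simp add: sym_matrix_of_def inner_axis)
  qed
  then show ?thesis
    by (subst borel_measurable_euclidean_space) (auto simp: Basis_vec_def)
qed

text \<open>An observation \<open>x \<in> \<real>\<^sup>p\<close>, \<open>p = m k\<close>, is given by its \<open>m\<close> blocks \<open>x $ i \<in> \<real>\<^sup>k\<close>, and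
  likewise \<open>\<theta>\<close>.\<close>

definition sampling_density :: "real^'k^'m \<Rightarrow> real^'k^'m \<Rightarrow> real" where
  "sampling_density \<theta> x = (\<Prod>i\<in>UNIV. mvn_density (\<theta> $ i) (mat 1) (x $ i))"

definition theta_density :: "real^'k \<Rightarrow> real^'k^'k \<Rightarrow> real^'k^'m \<Rightarrow> real" where
  "theta_density \<beta> V \<theta> = (\<Prod>i\<in>UNIV. mvn_density \<beta> V (\<theta> $ i))"

definition marginal_density ::
  "(real^'k::{finite,wellorder} \<Rightarrow> real) \<Rightarrow> (real^'k::{finite,wellorder}^'k::{finite,wellorder} \<Rightarrow> real)
    \<Rightarrow> real^'k::{finite,wellorder}^'m \<Rightarrow> ennreal" where
  "marginal_density prior\<^sub>\<beta> prior\<^sub>V x =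
     (\<integral>\<^sup>+ \<theta>. \<integral>\<^sup>+ \<beta>. \<integral>\<^sup>+ V.
        ennreal (sampling_density \<theta> x * theta_density \<beta> V \<theta> * prior\<^sub>\<beta> \<beta> * prior\<^sub>V V)
          * indicator {V. pos_def V} V
      \<partial>sym_lborel \<partial>lborel \<partial>lborel)"

definition posterior_exists ::
  "(real^'k::{finite,wellorder} \<Rightarrow> real) \<Rightarrow> (real^'k::{finite,wellorder}^'k::{finite,wellorder} \<Rightarrow> real)
    \<Rightarrow> real^'k::{finite,wellorder}^'m \<Rightarrow> bool" where
  "posterior_exists prior\<^sub>\<beta> prior\<^sub>V x \<longleftrightarrow>
     0 < marginal_density prior\<^sub>\<beta> prior\<^sub>V x \<and> marginal_density prior\<^sub>\<beta> prior\<^sub>V x < \<infinity>"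

text \<open>A possibly improper prior density on the positive-definite matrices; its values elsewhere
  are irrelevant.\<close>

definition prior_density :: "(real^'k^'k \<Rightarrow> real) \<Rightarrow> bool" where
  "prior_density prior\<^sub>V \<longleftrightarrow>
     prior\<^sub>V \<in> borel_measurable (restrict_space borel {V. pos_def V}) \<and>
     (\<forall>V. pos_def V \<longrightarrow> 0 \<le> prior\<^sub>V V)"

definition vandermonde :: "real^'k::{finite,wellorder} \<Rightarrow> real" where
  "vandermonde d = (\<Prod>(i, j)\<in>{(i, j). i < j}. d $ i - d $ j)"

text \<open>The prior in the coordinates \<open>V = H\<^sup>t D H\<close>, \<open>D = diag(d)\<close>.\<close>

definition prior_HD ::
  "(real^'k::{finite,wellorder}^'k::{finite,wellorder} \<Rightarrow> real)
    \<Rightarrow> real^'k::{finite,wellorder}^'k::{finite,wellorder} \<Rightarrow> real^'k::{finite,wellorder} \<Rightarrow> real" where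
  "prior_HD prior\<^sub>V H d = prior\<^sub>V (transpose H ** diag_mat d ** H) * vandermonde d"

definition ordered_spectrum :: "real^'k::{finite,wellorder} \<Rightarrow> bool" where
  "ordered_spectrum d \<longleftrightarrow> (\<forall>i j. i < j \<longrightarrow> d $ j < d $ i) \<and> (\<forall>i. 0 < d $ i)"

definition prior_bound :: "real \<Rightarrow> real \<Rightarrow> real \<Rightarrow> real^'k::{finite,wellorder} \<Rightarrow> real" where
  "prior_bound a\<^sub>1 a\<^sub>2 l d =
     vandermonde d powr l /
       (det (mat 1 + diag_mat d) powr (a\<^sub>2 - a\<^sub>1) * det (diag_mat d) powr a\<^sub>1)"

end

theory Submission
  imports Defs "HOL-Probability.Distributions"
begin

text \<open>Integrating out \<open>\<theta>\<close> and \<open>\<beta>\<close> leaves, up to constants that depend on \<open>x\<close>, the weight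
  \<open>|I + V|\<close> to the power \<open>-(m-1)/2\<close> against the prior on \<open>V\<close>, because the remaining exponential factor is bounded
  away from \<open>0\<close>. Only the finiteness of this integral matters, so the spectral coordinates
  \<open>V = H\<^sup>t D H\<close> are needed only up to constants. By compactness finitely many translates \<open>C(A) Q\<close> of
  a small patch of Cayley transforms \<open>C(A)\<close> cover the orthogonal group. On each patch the map
  \<open>(A, D) \<mapsto> (C(A) Q)\<^sup>t D C(A) Q\<close> is injective on ordered spectra, and its Jacobian is
  \<open>\<Prod>(d\<^sub>i - d\<^sub>j)\<close> up to bounded factors. Matrices with repeated eigenvalues lie in the image of finitely
  many hyperplanes under differentiable maps and are therefore negligible.

  In the remaining integral over the ordered spectra, the critical regimes are that the smallest
  eigenvalue tends to \<open>0\<close> alone, which gives \<open>a\<^sub>1 < 1\<close>, and that the largest one tends to infinity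
  alone, where it appears in \<open>k - 1\<close> differences; this gives the condition on \<open>a\<^sub>2\<close>.\<close>

section \<open>Lebesgue measure on vectors and change of variables\<close>

text \<open>No measure on the orthogonal group is ever constructed. A pair (A, D) with A skew and D
  diagonal has as many free entries as a symmetric matrix, so the parametrization maps one Euclidean
  space to itself, and two-sided bounds on its Jacobian are all that is asked of it. Its Vandermonde
  factor is not an extra term in the final integral: \<open>prior_HD\<close> already contains it, so
  the hypothesis applies directly to Jacobian times prior.

  The patches are used asymmetrically. For divergence and positivity a single patch is enough; for
  finiteness a finite cover is taken, and overlaps only increase an upper bound. Each patch is a box
  of Cayley parameters times all ordered spectra, so the parameters contribute just a volume.

  For the eigenvalues, bounding every gap d_i - d_j by 1 + d_i is generous except at the largest
  eigenvalue, but it turns the integral into a product of equal one-dimensional ones. Their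
  convergence conditions are the ones that the two critical regimes force, so several eigenvalues
  vanishing or diverging together need no separate study.\<close>

lemma prod_Basis_vec:
  fixes f :: "'a::euclidean_space^'n \<Rightarrow> 'b::comm_monoid_mult"
  shows "(\<Prod>b\<in>Basis. f b) = (\<Prod>i\<in>UNIV. \<Prod>b\<in>Basis. f (axis i b))"
proof -
  have "(\<Prod>i\<in>UNIV. \<Prod>b\<in>Basis. f (axis i b)) = (\<Prod>(i, b)\<in>UNIV \<times> Basis. f (axis i b))"
    by (simp add: prod.cartesian_product)
  also have "\<dots> = (\<Prod>b\<in>Basis. f b)"
    by (rule prod.reindex_cong[where l="\<lambda>(i, b). axis i b", symmetric])
      (auto simp: inj_on_def axis_eq_axis Basis_vec_def)
  finally show ?thesis ..
qed

lemma measurable_vec_nth_PiM: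
  fixes h :: "'n::finite \<Rightarrow> 'i"
  assumes h: "range h \<subseteq> I"
  shows "(\<lambda>f. \<chi> i. f (h i)) \<in> (\<Pi>\<^sub>M i\<in>I. lborel) \<rightarrow>\<^sub>M (borel :: ('a::euclidean_space^'n) measure)"
proof (subst borel_measurable_euclidean_space, safe)
  fix b :: "'a^'n" assume "b \<in> Basis"
  then obtain i c where b: "b = axis i c" by (auto simp: Basis_vec_def)
  have "(\<lambda>f. f (h i)) \<in> (\<Pi>\<^sub>M i\<in>I. lborel) \<rightarrow>\<^sub>M (lborel :: 'a measure)"
    using h by (intro measurable_component_singleton) auto
  then show "(\<lambda>f. (\<chi> i. f (h i)) \<bullet> b) \<in> borel_measurable (\<Pi>\<^sub>M i\<in>I. (lborel :: 'a measure))"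
    by (simp add: b inner_axis)
qed

text \<open>The bijection \<open>h\<close> leaves the index set of the product free, so that one
  statement covers three cases: reindexing by the identity, the pairs i <= j behind
  \<open>sym_lborel\<close>, and the diagonal slots that carry the eigenvalues.\<close>

lemma distr_PiM_lborel_vec:
  fixes h :: "'n::finite \<Rightarrow> 'i"
  assumes h: "bij_betw h UNIV I"
  shows "distr (\<Pi>\<^sub>M i\<in>I. lborel) borel (\<lambda>f. \<chi> i. f (h i)) = (lborel :: ('a::euclidean_space^'n) measure)"
proof (rule lborel_eqI[symmetric])
  have hI: "h i \<in> I" for i using h by (auto simp: bij_betw_def)
  have fin: "finite I" using h by (simp add: bij_betw_finite[symmetric])
  interpret product_sigma_finite "\<lambda>i::'i. lborel :: 'a measure" ..
  have [measurable]: "(\<lambda>f. \<chi> i. f (h i)) \<in> (\<Pi>\<^sub>M i\<in>I. lborel) \<rightarrow>\<^sub>M (borel :: ('a^'n) measure)"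
    using hI by (intro measurable_vec_nth_PiM) auto
  fix l u :: "'a^'n" assume le: "\<And>b. b \<in> Basis \<Longrightarrow> l \<bullet> b \<le> u \<bullet> b"
  have le': "l $ i \<bullet> b \<le> u $ i \<bullet> b" if "b \<in> Basis" for i b
    using le[of "axis i b"] that by (auto simp: Basis_vec_def inner_axis)
  define g where "g = inv_into UNIV h"
  have gh: "g (h i) = i" for i using h by (simp add: g_def bij_betw_def)
  have hg: "i \<in> I \<Longrightarrow> h (g i) = i" for i using h by (simp add: g_def bij_betw_def f_inv_into_f)
  have "emeasure (distr (\<Pi>\<^sub>M i\<in>I. lborel) borel (\<lambda>f. \<chi> i. f (h i))) (box l u) =
    emeasure (\<Pi>\<^sub>M i\<in>I. lborel) ((\<lambda>f. \<chi> i. f (h i)) -` box l u \<inter> space (\<Pi>\<^sub>M i\<in>I. lborel))"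
    by (rule emeasure_distr) auto
  also have "(\<lambda>f. \<chi> i. f (h i)) -` box l u \<inter> space (\<Pi>\<^sub>M i\<in>I. lborel) =
      (\<Pi>\<^sub>E i\<in>I. box (l $ g i) (u $ g i))"
    (is "?A = ?B")
  proof -
    have "(\<chi> i. f (h i)) \<in> box l u \<longleftrightarrow> (\<forall>i. f (h i) \<in> box (l $ i) (u $ i))" for f
      by (auto simp: mem_box Basis_vec_def inner_axis)
    moreover have "(\<forall>i. f (h i) \<in> box (l $ i) (u $ i)) \<longleftrightarrow> (\<forall>i\<in>I. f i \<in> box (l $ g i) (u $ g i))" for f
    proof safe
      fix i assume "\<forall>i. f (h i) \<in> box (l $ i) (u $ i)" "i \<in> I"
      then show "f i \<in> box (l $ g i) (u $ g i)" using hg[of i] by (metis (no_types))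
    next
      fix i assume "\<forall>i\<in>I. f i \<in> box (l $ g i) (u $ g i)"
      then show "f (h i) \<in> box (l $ i) (u $ i)" using hI[of i] by (auto simp: gh dest!: bspec)
    qed
    ultimately show ?thesis by (auto simp: space_PiM PiE_iff)
  qed
  also have "emeasure (\<Pi>\<^sub>M i\<in>I. lborel) \<dots> = (\<Prod>i\<in>I. emeasure lborel (box (l $ g i) (u $ g i)))"
    by (rule emeasure_PiM) (auto simp: fin)
  also have "\<dots> = (\<Prod>i\<in>UNIV. emeasure lborel (box (l $ i) (u $ i)))"
    using prod.reindex_bij_betw[OF h, of "\<lambda>i. emeasure lborel (box (l $ g i) (u $ g i))"]
      by (simp add: gh)
  also have "\<dots> = (\<Prod>i\<in>UNIV. ennreal (\<Prod>b\<in>Basis. (u $ i - l $ i) \<bullet> b))"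
    by (intro prod.cong refl emeasure_lborel_box le')
  also have "\<dots> = ennreal (\<Prod>i\<in>UNIV. \<Prod>b\<in>Basis. (u $ i - l $ i) \<bullet> b)"
    using le' by (intro prod_ennreal prod_nonneg) (auto simp: inner_diff_left)
  also have "\<dots> = ennreal (\<Prod>b\<in>Basis. (u - l) \<bullet> b)"
    by (simp add: prod_Basis_vec inner_axis)
  finally show "emeasure (distr (\<Pi>\<^sub>M i\<in>I. lborel) borel (\<lambda>f. \<chi> i. f (h i))) (box l u) =
      (\<Prod>b\<in>Basis. (u - l) \<bullet> b)"
    by simp
qed simp

lemma measurable_vec_nth_lborel [measurable]: "(\<lambda>x::'a::euclidean_space^'n. x $ i) \<in> borel_measurable borel"
  by (intro borel_measurable_continuous_onI continuous_intros)

lemma nn_integral_lborel_vec_prod: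
  fixes f :: "'n::finite \<Rightarrow> 'a::euclidean_space \<Rightarrow> ennreal"
  assumes [measurable]: "\<And>i. f i \<in> borel_measurable borel"
  shows "(\<integral>\<^sup>+ x. (\<Prod>i\<in>UNIV. f i (x $ i)) \<partial>lborel) = (\<Prod>i\<in>UNIV. \<integral>\<^sup>+ t. f i t \<partial>lborel)"
proof -
  interpret product_sigma_finite "\<lambda>i::'n. lborel :: 'a measure" ..
  have "(\<integral>\<^sup>+ x. (\<Prod>i\<in>UNIV. f i (x $ i)) \<partial>lborel) =
    (\<integral>\<^sup>+ x. (\<Prod>i\<in>UNIV. f i (x $ i)) \<partial>distr (\<Pi>\<^sub>M i\<in>(UNIV::'n set). lborel) borel (\<lambda>f. \<chi> i. f (id i)))"
    by (subst distr_PiM_lborel_vec) (auto simp: bij_betw_def)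
  also have "\<dots> = (\<integral>\<^sup>+ x. (\<Prod>i\<in>UNIV. f i (x i)) \<partial>(\<Pi>\<^sub>M i\<in>(UNIV::'n set). lborel))"
    by (subst nn_integral_distr) (auto intro!: measurable_vec_nth_PiM)
  also have "\<dots> = (\<Prod>i\<in>UNIV. \<integral>\<^sup>+ t. f i t \<partial>lborel)"
    by (rule product_nn_integral_prod) auto
  finally show ?thesis .
qed

section \<open>Change of variables for nonnegative integrals\<close>

lemma nn_integral_lebesgue_on:
  fixes h :: "'a::euclidean_space \<Rightarrow> real"
  assumes S: "S \<in> sets lebesgue" and h: "h \<in> borel_measurable (lebesgue_on S)"
      and nonneg: "\<And>x. x \<in> S \<Longrightarrow> 0 \<le> h x"
  shows absolutely_integrable_on_iff_nn_integral:
      "h absolutely_integrable_on S \<longleftrightarrow> (\<integral>\<^sup>+ x. ennreal (h x) * indicator S x \<partial>lebesgue) < \<infinity>"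
    and nn_integral_eq_integral_on:
      "h absolutely_integrable_on S \<Longrightarrow> (\<integral>\<^sup>+ x. ennreal (h x) * indicator S x \<partial>lebesgue) =
          ennreal (integral S h)"
proof -
  have eq: "(\<integral>\<^sup>+ x. ennreal (h x) * indicator S x \<partial>lebesgue) =
      (\<integral>\<^sup>+ x. ennreal (indicator S x *\<^sub>R h x) \<partial>lebesgue)"
    by (intro nn_integral_cong) (simp add: indicator_def)
  have meas: "(\<lambda>x. indicator S x *\<^sub>R h x) \<in> borel_measurable lebesgue"
    using h S by (simp add: borel_measurable_restrict_space_iff)
  have nn: "0 \<le> indicator S x *\<^sub>R h x" for x using nonneg by (simp add: indicator_def)
  show "h absolutely_integrable_on S \<longleftrightarrow> (\<integral>\<^sup>+ x. ennreal (h x) * indicator S x \<partial>lebesgue) < \<infinity>"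
    unfolding eq set_integrable_def integrable_iff_bounded using meas nn by simp
  assume ai: "h absolutely_integrable_on S"
  then have "(\<integral>\<^sup>+ x. ennreal (indicator S x *\<^sub>R h x) \<partial>lebesgue) =
      ennreal (LINT x|lebesgue. indicator S x *\<^sub>R h x)"
    unfolding set_integrable_def using nn by (intro nn_integral_eq_integral) auto
  also have "(LINT x|lebesgue. indicator S x *\<^sub>R h x) = integral S h"
    using set_lebesgue_integral_eq_integral(2)[OF ai] by (simp add: set_lebesgue_integral_def)
  finally show "(\<integral>\<^sup>+ x. ennreal (h x) * indicator S x \<partial>lebesgue) = ennreal (integral S h)"
    unfolding eq .
qed

text \<open>Integrability cannot be presupposed, since finiteness is what is to be decided. It
  transfers in both directions, so if one side diverges, both are infinite.\<close>

lemma nn_integral_change_of_variables: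
  fixes f :: "real^'m::{finite,wellorder} \<Rightarrow> real"
      and g :: "real^'m::{finite,wellorder} \<Rightarrow> real^'m::{finite,wellorder}"
  assumes S: "S \<in> sets lebesgue"
    and der: "\<And>x. x \<in> S \<Longrightarrow> (g has_derivative g' x) (at x within S)"
    and inj: "inj_on g S" and f: "f \<in> borel_measurable borel" and nonneg: "\<And>x. 0 \<le> f x"
  shows "(\<integral>\<^sup>+ x. ennreal (\<bar>det (matrix (g' x))\<bar> * f (g x)) * indicator S x \<partial>lebesgue) =
    (\<integral>\<^sup>+ y. ennreal (f y) * indicator (g ` S) y \<partial>lebesgue)"
proof -
  let ?h = "\<lambda>x. \<bar>det (matrix (g' x))\<bar> * f (g x)"
  \<comment> \<open>\<open>has_absolute_integral_change_of_variables\<close> speaks of vector-valued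
    functions; \<open>real^1\<close> carries the scalar \<open>f\<close>.\<close>
  let ?e = "axis 1 1 :: real^1"
  have diff: "g differentiable_on S"
    using der by (auto simp: differentiable_on_def differentiable_def)
  have gS: "g ` S \<in> sets lebesgue"
    by (rule differentiable_image_in_sets_lebesgue[OF S order_refl diff])
  have "g \<in> borel_measurable (lebesgue_on S)"
    by (intro continuous_imp_measurable_on_sets_lebesgue differentiable_imp_continuous_on diff S)
  then have "(\<lambda>x. f (g x)) \<in> borel_measurable (lebesgue_on S)"
    using f by (rule measurable_compose)
  then have h: "?h \<in> borel_measurable (lebesgue_on S)"
    using borel_measurable_det_Jacobian[OF S der] by (intro borel_measurable_times borel_measurable_abs)
  have "f \<in> borel_measurable lebesgue"
    using f by (simp add: measurable_completion)
  then have f': "f \<in> borel_measurable (lebesgue_on (g ` S))"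
    by (rule measurable_restrict_space1)
  have B: "(Basis :: (real^1) set) = {?e}"
    by (auto simp: Basis_vec_def UNIV_1)
  have ai: "(\<lambda>x. u x *\<^sub>R ?e) absolutely_integrable_on T \<longleftrightarrow> u absolutely_integrable_on T"
      for u :: "real^'m::{finite,wellorder} \<Rightarrow> real" and T
    by (subst absolutely_integrable_componentwise_iff) (simp add: B inner_axis)
  have int: "integral T (\<lambda>x. u x *\<^sub>R ?e) = integral T u *\<^sub>R ?e" if "u absolutely_integrable_on T"
      for u :: "real^'m::{finite,wellorder} \<Rightarrow> real" and T
    using that by (simp add: integral_linear[of u T "\<lambda>x. x *\<^sub>R ?e", unfolded o_def]
        set_lebesgue_integral_eq_integral(1) bounded_linear_scaleR_left)
  \<comment> \<open>With \<open>b\<close> arbitrary this yields two things at once: transfer of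
    integrability and, taking for \<open>b\<close> the value of one integral, equality of the
    two.\<close>
  have cov: "?h absolutely_integrable_on S \<and> integral S ?h = b \<longleftrightarrow> f absolutely_integrable_on (g ` S) \<and>
      integral (g ` S) f = b" for b
  proof -
    have "(\<lambda>x. ?h x *\<^sub>R ?e) absolutely_integrable_on S \<and> integral S (\<lambda>x. ?h x *\<^sub>R ?e) = b *\<^sub>R ?e \<longleftrightarrow>
      (\<lambda>x. f x *\<^sub>R ?e) absolutely_integrable_on (g ` S) \<and> integral (g ` S) (\<lambda>x. f x *\<^sub>R ?e) = b *\<^sub>R ?e"
      using has_absolute_integral_change_of_variables[OF S der inj, of "\<lambda>y. f y *\<^sub>R ?e" "b *\<^sub>R ?e"]
        by simp
    then show ?thesis unfolding ai using int[of S ?h] int[of "g ` S" f] by auto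
  qed
  show ?thesis
  proof (cases "f absolutely_integrable_on (g ` S)")
    case True
    then have "?h absolutely_integrable_on S" "integral S ?h = integral (g ` S) f" using cov by blast+
    then show ?thesis
      using nn_integral_eq_integral_on[OF S h] nn_integral_eq_integral_on[OF gS f' _ True] nonneg by simp
  next
    case False
    then have "\<not> ?h absolutely_integrable_on S" using cov by blast
    then show ?thesis
      using False absolutely_integrable_on_iff_nn_integral[OF S h] absolutely_integrable_on_iff_nn_integral[OF gS f'] nonneg
      by (simp add: not_less top_unique)
  qed
qed

text \<open>This permits rotating each block of \<theta>, and \<beta>, into an eigenbasis of
  V.\<close>

lemma nn_integral_orthogonal_image:
  fixes H :: "real^'n::{finite,wellorder}^'n::{finite,wellorder}"
  assumes H: "orthogonal_matrix H" and [measurable]: "f \<in> borel_measurable borel"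
  shows "(\<integral>\<^sup>+ x. f (H *v x) \<partial>lborel) = (\<integral>\<^sup>+ x. f x \<partial>lborel)"
proof -
  have lin: "linear ((*v) H)" by simp
  have o: "orthogonal_transformation ((*v) H)"
    using H by (simp add: orthogonal_transformation_matrix)
  have m [measurable]: "(*v) H \<in> borel_measurable borel"
    by (intro borel_measurable_continuous_onI linear_continuous_on linear_conv_bounded_linear[THEN iffD1] lin)
  have "lborel = distr lborel borel ((*v) H)"
  proof (rule measure_eqI)
    fix A assume "A \<in> sets (lborel :: (real^'n::{finite,wellorder}) measure)"
    then have A: "A \<in> sets borel" by simp
    obtain H' where H': "orthogonal_matrix H'" "H ** H' = mat 1" "H' ** H = mat 1"
      using H by (metis orthogonal_matrix_def orthogonal_matrix_transpose)
    have "emeasure (distr lborel borel ((*v) H)) A = emeasure lborel ((*v) H -` A)"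
      using A by (subst emeasure_distr) auto
    also have "\<dots> = (\<integral>\<^sup>+ x. ennreal (indicator A (H *v x)) * indicator UNIV x \<partial>lebesgue)"
    proof -
      have "(*v) H -` A \<in> sets lborel" using measurable_sets[OF m A] by simp
      then have "emeasure lborel ((*v) H -` A) = emeasure lebesgue ((*v) H -` A)" by simp
      also have "\<dots> = (\<integral>\<^sup>+ x. indicator ((*v) H -` A) x \<partial>lebesgue)"
        using \<open>(*v) H -` A \<in> sets lborel\<close> by (intro nn_integral_indicator[symmetric]) auto
      also have "\<dots> = (\<integral>\<^sup>+ x. ennreal (indicator A (H *v x)) * indicator UNIV x \<partial>lebesgue)"
        by (intro nn_integral_cong) (simp add: indicator_def)
      finally show ?thesis .
    qed
    also have "\<dots> = (\<integral>\<^sup>+ x. ennreal (\<bar>det (matrix ((*v) H))\<bar> * indicator A (H *v x)) *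
        indicator UNIV x \<partial>lebesgue)"
      using det_orthogonal_matrix[OF H] by (auto simp: matrix_of_matrix_vector_mul)
    also have "\<dots> = (\<integral>\<^sup>+ y. ennreal (indicator A y) * indicator (range ((*v) H)) y \<partial>lebesgue)"
      using A o by (intro nn_integral_change_of_variables linear_imp_has_derivative lin)
        (auto intro: orthogonal_transformation_inj)
    also have "range ((*v) H) = UNIV"
      using o by (simp add: orthogonal_transformation_surj)
    also have "(\<integral>\<^sup>+ y. ennreal (indicator A y) * indicator UNIV y \<partial>lebesgue) = emeasure lebesgue A"
      using A by (simp add: nn_integral_indicator[symmetric] ennreal_indicator del: nn_integral_indicator)
    finally show "emeasure lborel A = emeasure (distr lborel borel ((*v) H)) A" using A by simp
  qed simp
  then have "(\<integral>\<^sup>+ x. f x \<partial>lborel) = (\<integral>\<^sup>+ x. f x \<partial>distr lborel borel ((*v) H))" by simp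
  also have "\<dots> = (\<integral>\<^sup>+ x. f (H *v x) \<partial>lborel)" by (rule nn_integral_distr) auto
  finally show ?thesis ..
qed

section \<open>Cayley transforms and diagonalization\<close>

lemma bounded_bilinear_matrix_mult:
  "bounded_bilinear ((**) :: real^'n^'m \<Rightarrow> real^'p^'n \<Rightarrow> real^'p^'m)"
  unfolding bilinear_conv_bounded_bilinear[symmetric] bilinear_def linear_iff
  by (auto simp: vec_eq_iff matrix_matrix_mult_def sum.distrib sum_distrib_left algebra_simps)

interpretation matrix_mult: bounded_bilinear "(**) :: real^'n^'m \<Rightarrow> real^'p^'n \<Rightarrow> real^'p^'m"
  by (rule bounded_bilinear_matrix_mult)

lemma transpose_add: "transpose (A + B) = transpose A + transpose (B :: real^'n^'m)"
  and transpose_diff: "transpose (A - B) = transpose A - transpose (B :: real^'n^'m)"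
  by (simp_all add: vec_eq_iff transpose_def)

lemma matrix_inv_unique:
  fixes A B :: "real^'n^'n"
  assumes "A ** B = mat 1"
  shows "matrix_inv A = B"
proof -
  have BA: "B ** A = mat 1" using assms by (rule matrix_left_right_inverse[THEN iffD1])
  have "A ** matrix_inv A = mat 1 \<and> matrix_inv A ** A = mat 1"
    unfolding matrix_inv_def
    by (rule someI[where P="\<lambda>C. A ** C = mat 1 \<and> C ** A = mat 1" and x=B]) (simp add: assms BA)
  then have "B ** (A ** matrix_inv A) = B" by simp
  then show ?thesis by (simp add: matrix_mul_assoc BA)
qed

lemma inner_transpose_mult: "x \<bullet> (transpose E *v u) = u \<bullet> ((E :: real^'n^'m) *v x)"
  by (simp add: inner_commute[of x] dot_lmul_matrix)

section \<open>Resolvents and Cayley transforms of skew-symmetric matrices\<close>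

lemma skew_inner_zero:
  fixes A :: "real^'n^'n"
  assumes "transpose A = - A"
  shows "x \<bullet> (A *v x) = 0"
proof -
  have "x \<bullet> (A *v x) = (transpose A *v x) \<bullet> x"
    by (simp add: dot_lmul_matrix)
  also have "\<dots> = - (x \<bullet> (A *v x))"
    unfolding assms by (simp add: inner_commute matrix_vector_mult_def inner_vec_def sum_negf)
  finally show ?thesis by simp
qed

definition resolvent :: "real^'n^'n \<Rightarrow> real^'n^'n" where
  "resolvent A = matrix_inv (mat 1 + A)"

text \<open>For skew \<open>A\<close> the quadratic form of I + A is |x|^2, so the kernel is trivial
  however large \<open>A\<close> is.\<close>

lemma resolvent:
  fixes A :: "real^'n^'n"
  assumes A: "transpose A = - A"
  shows resolvent_right: "(mat 1 + A) ** resolvent A = mat 1"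
    and resolvent_left: "resolvent A ** (mat 1 + A) = mat 1"
proof -
  have "x = 0" if "(mat 1 + A) *v x = 0" for x
  proof -
    have "x \<bullet> ((mat 1 + A) *v x) = x \<bullet> x"
      by (simp add: matrix_vector_mult_add_rdistrib inner_right_distrib skew_inner_zero[OF A])
    then show ?thesis using that by simp
  qed
  then obtain B where B: "B ** (mat 1 + A) = mat 1"
    using matrix_left_invertible_ker[of "mat 1 + A"] by blast
  then have "(mat 1 + A) ** B = mat 1" by (rule matrix_left_right_inverse[THEN iffD1])
  then show "(mat 1 + A) ** resolvent A = mat 1" "resolvent A ** (mat 1 + A) = mat 1"
    using B by (auto simp: resolvent_def dest: matrix_inv_unique)
qed

text \<open>With x = (I + A) y, skewness gives y . x = |y|^2, and Cauchy-Schwarz yields |y| <= |x|.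
  The bound is uniform in \<open>A\<close>; this later keeps the derivative estimates and Jacobian
  constants independent of the point.\<close>

lemma norm_resolvent_le:
  assumes A: "transpose A = - A"
  shows "norm (resolvent A *v x) \<le> norm x"
proof -
  define y where "y = resolvent A *v x"
  have "x = (mat 1 + A) *v y"
    by (simp add: y_def matrix_vector_mul_assoc resolvent_right[OF A])
  then have "y \<bullet> x = y \<bullet> y"
    by (simp add: matrix_vector_mult_add_rdistrib inner_right_distrib skew_inner_zero[OF A])
  then have "norm y * norm y \<le> norm y * norm x"
    using norm_cauchy_schwarz[of y x] by (simp add: power2_norm_eq_inner[symmetric] power2_eq_square)
  then show ?thesis unfolding y_def[symmetric]
    by (cases "norm y = 0") (auto simp: mult_le_cancel_left)
qed

lemma abs_resolvent_le_1:
  assumes A: "transpose A = - A"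
  shows "\<bar>resolvent A $ i $ j\<bar> \<le> 1"
proof -
  have "\<bar>resolvent A $ i $ j\<bar> = \<bar>(resolvent A *v axis j 1) $ i\<bar>"
    by (simp add: matrix_vector_mult_basis column_def)
  also have "\<dots> \<le> norm (resolvent A *v axis j 1)" by (rule component_le_norm_cart)
  also have "\<dots> \<le> norm (axis j 1 :: real^'a)" by (rule norm_resolvent_le[OF A])
  finally show ?thesis by simp
qed

lemma transpose_resolvent:
  fixes A :: "real^'n^'n"
  assumes A: "transpose A = - A"
  shows "transpose (resolvent A) ** (mat 1 - A) = mat 1" "(mat 1 - A) ** transpose (resolvent A) = mat 1"
proof -
  show "transpose (resolvent A) ** (mat 1 - A) = mat 1"
    using arg_cong[OF resolvent_right[OF A], of transpose]
      by (simp add: matrix_transpose_mul transpose_add A)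
  show "(mat 1 - A) ** transpose (resolvent A) = mat 1"
    using arg_cong[OF resolvent_left[OF A], of transpose]
      by (simp add: matrix_transpose_mul transpose_add A)
qed

text \<open>With N the resolvent, N^t + N = N^t ((I + A) + (I - A)) N, as I - A is the transpose of
  I + A. Orthogonality of C = 2N - I and the relation N^t C = N are both rearrangements of this
  identity.\<close>

lemma resolvent_transpose_mult:
  fixes A :: "real^'n^'n"
  assumes A: "transpose A = - A"
  shows "2 *\<^sub>R (transpose (resolvent A) ** resolvent A) = transpose (resolvent A) + resolvent A"
proof -
  let ?N = "resolvent A" and ?T = "transpose (resolvent A)"
  have "?T + ?N = ?T ** ((mat 1 + A) ** ?N) + (?T ** (mat 1 - A)) ** ?N"
    by (simp add: resolvent_right[OF A] transpose_resolvent[OF A])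
  also have "\<dots> = 2 *\<^sub>R (?T ** ?N)"
    by (simp add: matrix_mult.add_left matrix_mult.add_right matrix_mult.diff_left matrix_mult.diff_right
        matrix_mul_assoc scaleR_2)
  finally show ?thesis ..
qed

text \<open>The classical (I - A)(I + A)^(-1), written as an affine function of the resolvent so
  that it inherits the algebra and the derivative of the latter.\<close>

definition cayley :: "real^'n^'n \<Rightarrow> real^'n^'n" where
  "cayley A = 2 *\<^sub>R resolvent A - mat 1"

lemma orthogonal_matrix_cayley:
  assumes A: "transpose A = - A"
  shows "orthogonal_matrix (cayley A)"
  using resolvent_transpose_mult[OF A]
  by (simp add: orthogonal_matrix cayley_def transpose_diff transpose_scalar matrix_mult.diff_left
      matrix_mult.diff_right matrix_mult.scaleR_left matrix_mult.scaleR_right scaleR_add_right)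

lemma transpose_resolvent_cayley:
  assumes A: "transpose A = - A"
  shows "transpose (resolvent A) ** cayley A = resolvent A"
  using resolvent_transpose_mult[OF A]
  by (simp add: cayley_def matrix_mult.diff_right matrix_mult.scaleR_right)

lemma cayley_inject:
  assumes A: "transpose A = - A" and B: "transpose B = - B" and eq: "cayley A = cayley B"
  shows "A = B"
proof -
  have "resolvent A = resolvent B" using eq by (simp add: cayley_def)
  then have "mat 1 + A = (mat 1 + A) ** (resolvent A ** (mat 1 + B))"
    by (simp add: resolvent_left[OF B])
  then show ?thesis by (simp add: matrix_mul_assoc resolvent_right[OF A])
qed

text \<open>On the kernel 2x = -(K - I)x, so in the sum norm 2|x| <= n \<delta> |x| <= |x|. This
  keeps -1, which is never an eigenvalue of a Cayley transform, out of the spectrum of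
  \<open>K\<close>.\<close>

lemma ker_add_mat_1_trivial:
  fixes K :: "real^'n^'n"
  assumes small: "\<And>i j. \<bar>(K - mat 1) $ i $ j\<bar> \<le> \<delta>" and \<delta>: "real CARD('n) * \<delta> \<le> 1"
    and "(mat 1 + K) *v x = 0"
  shows "x = 0"
proof -
  have eq: "2 * x $ i = - ((K - mat 1) *v x) $ i" for i
    using arg_cong[OF assms(3), of "\<lambda>y. y $ i"]
    by (simp add: matrix_vector_mult_add_rdistrib matrix_vector_mult_diff_rdistrib)
  have "2 * \<bar>x $ i\<bar> \<le> \<delta> * (\<Sum>j\<in>UNIV. \<bar>x $ j\<bar>)" for i
  proof -
    have "2 * \<bar>x $ i\<bar> = \<bar>((K - mat 1) *v x) $ i\<bar>" using eq[of i] by linarith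
    also have "\<dots> \<le> (\<Sum>j\<in>UNIV. \<bar>(K - mat 1) $ i $ j * x $ j\<bar>)"
      unfolding matrix_vector_mult_def by (simp add: sum_abs)
    also have "\<dots> \<le> (\<Sum>j\<in>UNIV. \<delta> * \<bar>x $ j\<bar>)"
      unfolding abs_mult by (intro sum_mono mult_right_mono small) auto
    finally show ?thesis by (simp add: sum_distrib_left)
  qed
  then have "(\<Sum>i\<in>UNIV. 2 * \<bar>x $ i\<bar>) \<le> (\<Sum>i\<in>(UNIV::'n set). \<delta> * (\<Sum>j\<in>UNIV. \<bar>x $ j\<bar>))"
    by (intro sum_mono)
  also have "\<dots> = (real CARD('n) * \<delta>) * (\<Sum>j\<in>UNIV. \<bar>x $ j\<bar>)" by simp
  also have "\<dots> \<le> 1 * (\<Sum>j\<in>UNIV. \<bar>x $ j\<bar>)" by (intro mult_right_mono \<delta> sum_nonneg) auto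
  finally have "(\<Sum>j\<in>UNIV. \<bar>x $ j\<bar>) \<le> 0" by (simp add: sum_distrib_left[symmetric])
  then have "(\<Sum>j\<in>UNIV. \<bar>x $ j\<bar>) = 0" by (intro antisym sum_nonneg) auto
  then show ?thesis by (simp add: sum_nonneg_eq_0_iff vec_eq_iff)
qed

text \<open>The Cayley transform is an involution: A = 2(I + K)^(-1) - I inverts it, and
  orthogonality of \<open>K\<close> makes A skew. That A is as small as K - I comes from A(I + K) =
  I - K.\<close>

lemma ex_small_cayley:
  fixes K :: "real^'n^'n"
  assumes K: "orthogonal_matrix K"
    and small: "\<And>i j. \<bar>(K - mat 1) $ i $ j\<bar> \<le> \<delta>" and \<delta>: "real CARD('n) * \<delta> \<le> 1"
  obtains A where "transpose A = - A" "cayley A = K" "\<And>i j. \<bar>A $ i $ j\<bar> \<le> \<delta>"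
proof -
  have KK: "transpose K ** K = mat 1" "K ** transpose K = mat 1" using K
    by (auto simp: orthogonal_matrix_def)
  obtain M where M: "M ** (mat 1 + K) = mat 1"
    using matrix_left_invertible_ker[of "mat 1 + K"] ker_add_mat_1_trivial[OF small \<delta>] by blast
  then have M': "(mat 1 + K) ** M = mat 1" by (rule matrix_left_right_inverse[THEN iffD1])
  have MT: "transpose M ** (mat 1 + transpose K) = mat 1"
    using arg_cong[OF M', of transpose] by (simp add: matrix_transpose_mul transpose_add)
  have "transpose M = transpose M ** ((mat 1 + transpose K) ** K) ** M"
  proof -
    have "(mat 1 + transpose K) ** K = mat 1 + K" by (simp add: matrix_mult.add_left KK add.commute)
    then show ?thesis by (simp only: matrix_mul_assoc[symmetric] M') simp
  qed
  also have "\<dots> = (transpose M ** (mat 1 + transpose K)) ** K ** M" by (simp only: matrix_mul_assoc)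
  finally have TM: "transpose M = K ** M" by (simp add: MT)
  define A where "A = 2 *\<^sub>R M - mat 1"
  have "M + K ** M = mat 1" using M' by (simp add: matrix_mult.add_left)
  then have KM: "K ** M = mat 1 - M" by (simp add: eq_diff_eq add.commute)
  have skew: "transpose A = - A"
    unfolding A_def transpose_diff transpose_scalar TM KM transpose_mat by (simp add: vec_eq_iff)
  have 1: "mat 1 + A = 2 *\<^sub>R M" by (simp add: A_def)
  have "resolvent A = (1/2) *\<^sub>R (mat 1 + K)"
    unfolding resolvent_def 1
    by (rule matrix_inv_unique) (simp add: matrix_mult.scaleR_left matrix_mult.scaleR_right M)
  then have cay: "cayley A = K" by (simp add: cayley_def)
  have "A ** (mat 1 + K) = 2 *\<^sub>R mat 1 - (mat 1 + K)"
    by (simp add: A_def matrix_mult.diff_left matrix_mult.scaleR_left M)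
  then have "2 *\<^sub>R A = (mat 1 - K) - A ** (K - mat 1)"
    by (simp add: matrix_mult.add_right matrix_mult.diff_right vec_eq_iff algebra_simps)
  then have eq: "2 * A $ i $ j = - (K - mat 1) $ i $ j - (\<Sum>l\<in>UNIV. A $ i $ l * (K - mat 1) $ l $ j)"
      for i j
    by (auto simp: vec_eq_iff matrix_matrix_mult_def)
  have le: "2 * \<bar>A $ i $ j\<bar> \<le> \<delta> + \<delta> * (\<Sum>l\<in>UNIV. \<bar>A $ i $ l\<bar>)" for i j
  proof -
    have "\<bar>\<Sum>l\<in>UNIV. A $ i $ l * (K - mat 1) $ l $ j\<bar> \<le> (\<Sum>l\<in>UNIV. \<bar>A $ i $ l\<bar> * \<delta>)"
      by (rule order_trans[OF sum_abs]) (unfold abs_mult, intro sum_mono mult_left_mono small, auto)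
    also have "\<dots> = \<delta> * (\<Sum>l\<in>UNIV. \<bar>A $ i $ l\<bar>)" by (simp add: sum_distrib_left mult.commute)
    finally show ?thesis using eq[of i j] small[of i j] by linarith
  qed
  have \<delta>0: "0 \<le> \<delta>" using order_trans[OF abs_ge_zero small] .
  have "\<bar>A $ i $ j\<bar> \<le> \<delta>" for i j
  proof -
    \<comment> \<open>Two passes: the row sum is first shown to be at most 1, and with that bound
      \<open>le\<close> gives \<delta> for each entry.\<close>
    define R where "R = (\<Sum>l\<in>UNIV. \<bar>A $ i $ l\<bar>)"
    have "(\<Sum>l\<in>UNIV. 2 * \<bar>A $ i $ l\<bar>) \<le> (\<Sum>l\<in>(UNIV::'n set). \<delta> + \<delta> * R)"
      unfolding R_def by (intro sum_mono le)
    then have "2 * R \<le> (real CARD('n) * \<delta>) * (1 + R)"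
      by (simp add: R_def sum_distrib_left[symmetric] algebra_simps)
    also have "\<dots> \<le> 1 * (1 + R)"
      by (intro mult_right_mono \<delta>) (auto simp: R_def intro!: add_nonneg_nonneg sum_nonneg)
    finally have "R \<le> 1" by simp
    then have "\<delta> * R \<le> \<delta>" using \<delta>0 mult_left_mono[of R 1 \<delta>] by simp
    then show ?thesis using le[of i j] unfolding R_def by linarith
  qed
  then show thesis using that skew cay by blast
qed

text \<open>C - I = -2NA with N a contraction, so the deviation is governed by the columns of
  \<open>A\<close>, whose norms are at most n r.\<close>

lemma abs_cayley_diff_le:
  fixes A :: "real^'n^'n"
  assumes A: "transpose A = - A" and r: "\<And>i j. \<bar>A $ i $ j\<bar> \<le> r"
  shows "\<bar>(cayley A - mat 1) $ i $ j\<bar> \<le> 2 * real CARD('n) * r"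
proof -
  have "resolvent A + resolvent A ** A = mat 1"
    using resolvent_left[OF A] by (simp add: matrix_mult.add_right)
  then have "resolvent A ** A = mat 1 - resolvent A" by (simp add: eq_diff_eq add.commute)
  then have "cayley A - mat 1 = (-2) *\<^sub>R (resolvent A ** A)"
    by (simp add: cayley_def vec_eq_iff)
  moreover have "(resolvent A ** A) $ i $ j = (resolvent A *v column j A) $ i"
    by (simp add: matrix_matrix_mult_def matrix_vector_mult_def column_def)
  ultimately have "\<bar>(cayley A - mat 1) $ i $ j\<bar> = 2 * \<bar>(resolvent A *v column j A) $ i\<bar>"
    by simp
  also have "\<bar>(resolvent A *v column j A) $ i\<bar> \<le> norm (column j A)"
    using component_le_norm_cart norm_resolvent_le[OF A] order_trans by blast
  also have "\<dots> \<le> (\<Sum>l\<in>UNIV. \<bar>A $ l $ j\<bar>)"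
    using norm_le_l1_cart[of "column j A"] by (simp add: column_def)
  also have "\<dots> \<le> (\<Sum>l\<in>(UNIV::'n set). r)" by (intro sum_mono r)
  finally show ?thesis by simp
qed

text \<open>The bound 1/(4n^2) makes both transforms differ from I entrywise by at most e = 1/(2n).
  The term j = i of the sum is then at least (1 - e)^2 >= 1/4, and the n - 1 others together exceed
  -1/4. A positive diagonal excludes sign changes of eigenvectors, the only ambiguity left when the
  eigenvalues are distinct and ordered.\<close>

lemma cayley_mult_transpose_diag_pos:
  fixes A B :: "real^'n^'n"
  assumes A: "transpose A = - A" "\<And>i j. \<bar>A $ i $ j\<bar> \<le> 1 / (4 * (real CARD('n))\<^sup>2)"
    and B: "transpose B = - B" "\<And>i j. \<bar>B $ i $ j\<bar> \<le> 1 / (4 * (real CARD('n))\<^sup>2)"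
  shows "(cayley A ** transpose (cayley B)) $ i $ i > 0"
proof -
  define n where "n = real CARD('n)"
  define e where "e = 1 / (2 * n)"
  have n: "n \<ge> 1" by (simp add: n_def Suc_leI)
  have e: "e \<le> 1/2" "0 < e" "2 * n * (1 / (4 * n\<^sup>2)) = e" using n
    by (auto simp: e_def field_simps power2_eq_square)
  have a: "\<bar>(cayley A - mat 1) $ i $ j\<bar> \<le> e" for j
    using abs_cayley_diff_le[OF A, of i j] e by (simp add: n_def)
  have b: "\<bar>(cayley B - mat 1) $ i $ j\<bar> \<le> e" for j
    using abs_cayley_diff_le[OF B, of i j] e by (simp add: n_def)
  have off: "- (e * e) \<le> cayley A $ i $ j * cayley B $ i $ j" if "j \<noteq> i" for j
  proof -
    have "\<bar>cayley A $ i $ j * cayley B $ i $ j\<bar> \<le> e * e"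
      unfolding abs_mult using a[of j] b[of j] that e by (intro mult_mono) (auto simp: mat_def)
    then show ?thesis by linarith
  qed
  have "(1 - e) * (1 - e) \<le> cayley A $ i $ i * cayley B $ i $ i"
    using a[of i] b[of i] e by (intro mult_mono) (auto simp: mat_def)
  moreover have "(1/2) * (1/2) \<le> (1 - e) * (1 - e)" using e by (intro mult_mono) auto
  moreover have "(\<Sum>j\<in>UNIV - {i}. - (e * e)) \<le> (\<Sum>j\<in>UNIV - {i}. cayley A $ i $ j * cayley B $ i $ j)"
    by (intro sum_mono off) auto
  moreover have "(\<Sum>j\<in>UNIV - {i}. - (e * e)) = - ((n - 1) * (e * e))"
    using n by (simp add: n_def card_Diff_singleton of_nat_diff Suc_leI)
  moreover have "(n - 1) * (e * e) < 1/4"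
  proof -
    have "(n - 1) * (e * e) < n * (e * e)" using e by (intro mult_strict_right_mono) auto
    also have "\<dots> = e / 2" using n by (simp add: e_def)
    also have "\<dots> \<le> 1/4" using e by simp
    finally show ?thesis .
  qed
  moreover have "(cayley A ** transpose (cayley B)) $ i $ i =
    cayley A $ i $ i * cayley B $ i $ i + (\<Sum>j\<in>UNIV - {i}. cayley A $ i $ j * cayley B $ i $ j)"
    by (simp add: matrix_matrix_mult_def transpose_def sum.remove[of _ i])
  ultimately show ?thesis by linarith
qed

section \<open>Diagonalization of symmetric matrices and its uniqueness\<close>

lemma linear_diag_mat: "linear diag_mat"
  by (auto simp: linear_iff diag_mat_def vec_eq_iff)

lemma diag_mat_mult: "(diag_mat d ** X) $ i $ j = d $ i * X $ i $ j"
proof -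
  have "(diag_mat d ** X) $ i $ j = (\<Sum>l\<in>UNIV. if l = i then d $ i * X $ i $ j else 0)"
    unfolding matrix_matrix_mult_def diag_mat_def vec_lambda_beta by (intro sum.cong) auto
  then show ?thesis by simp
qed

lemma mult_diag_mat: "(X ** diag_mat d) $ i $ j = X $ i $ j * d $ j"
proof -
  have "(X ** diag_mat d) $ i $ j = (\<Sum>l\<in>UNIV. if l = j then X $ i $ j * d $ j else 0)"
    unfolding matrix_matrix_mult_def diag_mat_def vec_lambda_beta by (intro sum.cong) auto
  then show ?thesis by simp
qed

lemma transpose_diag_mat [simp]: "transpose (diag_mat d) = diag_mat d"
  by (simp add: diag_mat_def transpose_def vec_eq_iff)

text \<open>P = H H'^t satisfies D P = P D'. Its positive diagonal gives D = D', distinctness of the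
  eigenvalues then kills the off-diagonal entries, and an orthogonal diagonal matrix with positive
  entries is I.\<close>

lemma diagonalization_unique:
  fixes H H' :: "real^'n^'n"
  assumes H: "orthogonal_matrix H" "orthogonal_matrix H'"
    and d: "\<And>i j. i \<noteq> j \<Longrightarrow> d $ i \<noteq> d $ j"
    and eq: "transpose H ** diag_mat d ** H = transpose H' ** diag_mat d' ** H'"
    and pos: "\<And>i. (H ** transpose H') $ i $ i > 0"
  shows "d = d' \<and> H = H'"
proof -
  define P where "P = H ** transpose H'"
  have HH: "H ** transpose H = mat 1" "transpose H ** H = mat 1" "H' ** transpose H' =
      mat 1" "transpose H' ** H' = mat 1"
    using H by (auto simp: orthogonal_matrix_def)
  have "H ** (transpose H ** diag_mat d ** H) ** transpose H' =
      H ** (transpose H' ** diag_mat d' ** H') ** transpose H'"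
    by (simp only: eq)
  then have "(H ** transpose H) ** diag_mat d ** P = P ** diag_mat d' ** (H' ** transpose H')"
    by (simp only: P_def matrix_mul_assoc)
  then have "diag_mat d ** P = P ** diag_mat d'" by (simp add: HH)
  then have eqs: "d $ i * P $ i $ j = P $ i $ j * d' $ j" for i j
    by (metis diag_mat_mult mult_diag_mat)
  have pos': "P $ i $ i > 0" for i using pos by (simp add: P_def)
  have dd: "d $ i = d' $ i" for i using eqs[of i i] pos'[of i] by simp
  have off: "P $ i $ j = 0" if "i \<noteq> j" for i j using eqs[of i j] d[OF that] dd[of j]
    by (simp add: mult.commute)
  have "P ** transpose P = H ** (transpose H' ** H') ** transpose H"
    by (simp only: P_def matrix_transpose_mul transpose_transpose matrix_mul_assoc)
  then have PP: "P ** transpose P = mat 1" by (simp add: HH)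
  have "P $ i $ i = 1" for i
  proof -
    have "(P ** transpose P) $ i $ i = (\<Sum>l\<in>UNIV. if l = i then P $ i $ i * P $ i $ i else 0)"
      unfolding matrix_matrix_mult_def transpose_def vec_lambda_beta using off by (intro sum.cong) auto
    then have "P $ i $ i * P $ i $ i = 1" using PP by (simp add: mat_def)
    then show ?thesis using pos'[of i] by (simp add: square_eq_1_iff)
  qed
  then have "P = mat 1" using off by (simp add: vec_eq_iff mat_def)
  then have "H = H'" using HH(4) unfolding P_def
    by (metis matrix_mul_assoc matrix_mul_lid matrix_mul_rid)
  then show ?thesis using dd by (simp add: vec_eq_iff)
qed

lemma compact_orthogonal_matrices: "compact {H :: real^'n^'n. orthogonal_matrix H}"
proof -
  have "norm (H $ i) = 1" if "orthogonal_matrix H" for H :: "real^'n^'n" and i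
    using that by (simp add: orthogonal_matrix_orthonormal_rows row_def vec_nth_inverse)
  then have "norm H \<le> real CARD('n)" if "orthogonal_matrix H" for H :: "real^'n^'n"
    unfolding norm_vec_def[of H] using that by (intro order_trans[OF L2_set_le_sum]) auto
  then have "bounded {H :: real^'n^'n. orthogonal_matrix H}"
    by (auto simp: bounded_iff)
  moreover have "closed {H :: real^'n^'n. orthogonal_matrix H}"
    unfolding orthogonal_matrix matrix_matrix_mult_def transpose_def mat_def vec_eq_iff
    by (intro closed_Collect_all closed_Collect_eq continuous_intros)
  ultimately show ?thesis by (simp add: compact_eq_bounded_closed)
qed

lemma orthogonal_matrix_rotate_rows:
  fixes H :: "real^'n^'n" and c s :: real
  assumes H: "orthogonal_matrix H" and "i \<noteq> j" and cs: "c\<^sup>2 + s\<^sup>2 = 1"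
  shows "orthogonal_matrix (\<chi> k. if k = i then c *\<^sub>R H $ i + s *\<^sub>R H $ j
           else if k = j then - s *\<^sub>R H $ i + c *\<^sub>R H $ j else H $ k)"
proof -
  have n: "H $ k \<bullet> H $ k = 1" for k
    using H by (simp add: orthogonal_matrix_orthonormal_rows row_def vec_nth_inverse norm_eq_1)
  have o: "H $ k \<bullet> H $ l = 0" if "k \<noteq> l" for k l
    using H that by (simp add: orthogonal_matrix_orthonormal_rows row_def vec_nth_inverse orthogonal_def)
  show ?thesis
    using \<open>i \<noteq> j\<close> cs
    by (auto simp: orthogonal_matrix_orthonormal_rows row_def vec_nth_inverse norm_eq_1 orthogonal_def
        inner_left_distrib inner_right_distrib
        inner_diff_left inner_diff_right n o power2_eq_square)
qed

type_synonym 'k sq_matrix = "((real, 'k) vec, 'k) vec"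

text \<open>A maximizer \<open>H\<close> of \<open>\<Sum>w\<^sub>i (H V H\<^sup>t)\<^sub>i\<^sub>i\<close> with decreasing weights \<open>w\<^sub>i\<close> diagonalizes \<open>V\<close> and orders the
  eigenvalues: a small rotation of two rows would increase the sum if their off-diagonal entry were
  nonzero, and a quarter turn would increase it if their diagonal entries were in the wrong order.\<close>

lemma ex_orthogonal_diagonalization:
  fixes V :: "('k::{finite,wellorder}) sq_matrix"
  assumes sym: "transpose V = V"
  obtains H d where "orthogonal_matrix H" "V = transpose H ** diag_mat d ** H"
    "\<And>i j. i < j \<Longrightarrow> d $ j \<le> d $ i"
proof -
  define w :: "'k \<Rightarrow> real" where "w i = real (card {j. i < j})" for i
  have w: "w j < w i" if "i < j" for i j
    using that unfolding w_def of_nat_less_iff by (intro psubset_card_mono) (auto intro: less_trans)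
  define a where "a x y = x \<bullet> (V *v y)" for x y
  define F where "F H = (\<Sum>k\<in>UNIV. w k * a (H $ k) (H $ k))" for H :: "('k::{finite,wellorder}) sq_matrix"
  have a_comm: "a x y = a y x" for x y
    by (metis a_def dot_lmul_matrix inner_commute matrix_vector_mul(1) sym transpose_matrix_vector)
  have "continuous_on {H. orthogonal_matrix H} F"
    unfolding F_def a_def matrix_vector_mult_def by (intro continuous_intros)
  then obtain H where H: "orthogonal_matrix H" and max: "\<And>H'. orthogonal_matrix H' \<Longrightarrow> F H' \<le> F H"
    using continuous_attains_sup[OF compact_orthogonal_matrices, of F] orthogonal_matrix_id by auto
  have key: "2 * s * c * a (H $ i) (H $ j) + s\<^sup>2 * (a (H $ j) (H $ j) - a (H $ i) (H $ i)) \<le> 0"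
    if "i < j" and cs: "c\<^sup>2 + s\<^sup>2 = 1" for i j and c s :: real
  proof -
    have ij: "i \<noteq> j" using that by auto
    define H' :: "('k::{finite,wellorder}) sq_matrix" where "H' = (\<chi> k. if k = i then c *\<^sub>R H $ i +
        s *\<^sub>R H $ j
           else if k = j then - s *\<^sub>R H $ i + c *\<^sub>R H $ j else H $ k)"
    have "F H' \<le> F H"
      unfolding H'_def by (intro max orthogonal_matrix_rotate_rows H ij cs)
    moreover have "F H' - F H = (\<Sum>k\<in>UNIV. w k * (a (H' $ k) (H' $ k) - a (H $ k) (H $ k)))"
      by (simp add: F_def sum_subtractf right_diff_distrib)
    moreover have "\<dots> = (\<Sum>k\<in>{i, j}. w k * (a (H' $ k) (H' $ k) - a (H $ k) (H $ k)))"
      by (rule sum.mono_neutral_right) (auto simp: H'_def)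
    moreover have "a (H' $ i) (H' $ i) = c\<^sup>2 * a (H $ i) (H $ i) + 2 * s * c * a (H $ i) (H $ j) + s\<^sup>2 *
        a (H $ j) (H $ j)"
      using a_comm[of "H $ j" "H $ i"]
      by (simp add: H'_def a_def matrix_vector_right_distrib matrix_vector_mult_scaleR inner_left_distrib
          inner_right_distrib power2_eq_square algebra_simps)
    moreover have "a (H' $ j) (H' $ j) = s\<^sup>2 * a (H $ i) (H $ i) - 2 * s * c * a (H $ i) (H $ j) + c\<^sup>2 *
        a (H $ j) (H $ j)"
      using a_comm[of "H $ j" "H $ i"] ij
      by (simp add: H'_def a_def matrix_vector_right_distrib matrix_vector_mult_scaleR inner_left_distrib
          inner_right_distrib power2_eq_square algebra_simps matrix_vector_mult_diff_distrib)
    ultimately have "w i * (c\<^sup>2 * a (H $ i) (H $ i) + 2 * s * c * a (H $ i) (H $ j) + s\<^sup>2 *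
        a (H $ j) (H $ j) - a (H $ i) (H $ i))
      + w j * (s\<^sup>2 * a (H $ i) (H $ i) - 2 * s * c * a (H $ i) (H $ j) + c\<^sup>2 * a (H $ j) (H $ j) - a (H $ j) (H $ j)) \<le> 0"
      using ij by simp
    moreover have "c\<^sup>2 = 1 - s\<^sup>2" using cs by simp
    \<comment> \<open>Once \<open>c\<^sup>2\<close> is eliminated, the two rows contribute opposite
      changes, so the weights enter only through the positive difference
      \<open>w i - w j\<close>.\<close>
    ultimately have "(w i - w j) * (2 * s * c * a (H $ i) (H $ j) + s\<^sup>2 *
        (a (H $ j) (H $ j) - a (H $ i) (H $ i))) \<le> 0"
      by (simp add: algebra_simps)
    then show ?thesis using w[OF \<open>i < j\<close>] by (simp add: mult_le_0_iff)
  qed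
  have off: "a (H $ i) (H $ j) = 0" if "i < j" for i j
  proof (rule ccontr)
    define p where "p = a (H $ i) (H $ j)"
    define q where "q = a (H $ i) (H $ i) - a (H $ j) (H $ j)"
    assume "\<not> ?thesis"
    then have p: "p \<noteq> 0" by (simp add: p_def)
    have le: "2 * t * p \<le> t\<^sup>2 * q" for t
    proof -
      \<comment> \<open>(r, t r) is the point of slope \<open>t\<close> on the unit circle; dividing
        \<open>key\<close> by \<open>r\<^sup>2\<close> removes the normalization.\<close>
      define r where "r = 1 / sqrt (1 + t\<^sup>2)"
      have r2: "r\<^sup>2 * (1 + t\<^sup>2) = 1" and r0: "r\<^sup>2 > 0"
        by (simp_all add: r_def power_divide add_pos_nonneg) (smt (verit) zero_le_power2)+
      have "r\<^sup>2 + (t * r)\<^sup>2 = 1" using r2 by (simp add: power_mult_distrib algebra_simps)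
      from key[OF \<open>i < j\<close> this] have "r\<^sup>2 * (2 * t * p - t\<^sup>2 * q) \<le> 0"
        by (simp add: p_def q_def power2_eq_square algebra_simps)
      then show ?thesis using r0 by (simp add: mult_le_0_iff)
    qed
    \<comment> \<open>Chosen so that t^2 (|q| + 1) = t p; then 2 t p <= t p, against t p >
      0.\<close>
    define t where "t = p / (\<bar>q\<bar> + 1)"
    have "2 * t * p \<le> t\<^sup>2 * (\<bar>q\<bar> + 1)"
      by (rule order_trans[OF le[of t]]) (intro mult_left_mono, auto)
    also have "\<dots> = t * p" by (simp add: t_def power2_eq_square)
    finally have "t * p \<le> 0" by linarith
    moreover have "t * p > 0" using p by (simp add: t_def divide_pos_pos add_nonneg_pos)
       (metis not_real_square_gt_zero divide_pos_pos add_nonneg_pos abs_ge_zero zero_less_one)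
    ultimately show False by simp
  qed
  define d where "d = (\<chi> i. a (H $ i) (H $ i))"
  have H1: "H ** transpose H = mat 1" "transpose H ** H = mat 1" using H
    by (auto simp: orthogonal_matrix_def)
  have "(H ** V ** transpose H) $ i $ j = a (H $ i) (H $ j)" for i j
  proof -
    have "(H ** V ** transpose H) $ i $ j = (\<Sum>l\<in>UNIV. (\<Sum>k\<in>UNIV. H $ i $ k * V $ k $ l) * H $ j $ l)"
      by (simp add: matrix_matrix_mult_def transpose_def)
    also have "\<dots> = (\<Sum>l\<in>UNIV. \<Sum>k\<in>UNIV. H $ i $ k * (V $ k $ l * H $ j $ l))"
      by (simp add: sum_distrib_right mult.assoc)
    also have "\<dots> = a (H $ i) (H $ j)"
      by (subst sum.swap) (simp add: a_def inner_vec_def matrix_vector_mult_def sum_distrib_left)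
    finally show ?thesis .
  qed
  moreover have "a (H $ i) (H $ j) = diag_mat d $ i $ j" for i j
    using off[of i j] off[of j i] a_comm[of "H $ i" "H $ j"]
    by (cases i j rule: linorder_cases) (auto simp: diag_mat_def d_def)
  ultimately have "H ** V ** transpose H = diag_mat d" by (simp add: vec_eq_iff)
  then have "transpose H ** diag_mat d ** H = transpose H ** (H ** V ** transpose H) ** H" by simp
  also have "\<dots> = (transpose H ** H) ** V ** (transpose H ** H)" by (simp only: matrix_mul_assoc)
  finally have "V = transpose H ** diag_mat d ** H" by (simp add: H1)
  moreover have "d $ j \<le> d $ i" if "i < j" for i j
    using key[OF that, of 0 1] by (simp add: d_def)
  ultimately show thesis using that H by blast
qed

section \<open>Coordinates on symmetric matrices\<close>

text \<open>The pairs i <= j have to form a type, because change of variables takes place on vectors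
  indexed by a type.\<close>

typedef (overloaded) 'k upper = "{(i::'k::linorder, j). i \<le> j}"
  by (rule exI[of _ "(undefined, undefined)"]) simp

instance upper :: ("{finite,linorder}") finite
  by standard (simp add: type_definition.univ[OF type_definition_upper])

text \<open>The order on the index type of the upper triangle carries no meaning; the change-of-variables
  theorem of HOL-Analysis asks for one.\<close>

instantiation upper :: ("{finite,linorder}") wellorder
begin

definition upper_rank :: "'a upper \<Rightarrow> nat" where "upper_rank = (SOME f. inj f)"

definition less_eq_upper :: "'a upper \<Rightarrow> 'a upper \<Rightarrow> bool" where
  "less_eq_upper p q \<longleftrightarrow> upper_rank p \<le> upper_rank q"

definition less_upper :: "'a upper \<Rightarrow> 'a upper \<Rightarrow> bool" where
  "less_upper p q \<longleftrightarrow> upper_rank p < upper_rank q"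

instance
proof
  have "inj (upper_rank :: 'a upper \<Rightarrow> nat)"
    using finite_imp_inj_to_nat_seg[of "UNIV :: 'a upper set"] unfolding upper_rank_def
    by (metis finite someI_ex)
  then show "p = q" if "p \<le> q" "q \<le> p" for p q :: "'a upper"
    using that by (auto simp: less_eq_upper_def inj_def)
  show "P p" if "\<And>p. (\<And>q. q < p \<Longrightarrow> P q) \<Longrightarrow> P p" for P and p :: "'a upper"
  proof (induction p rule: measure_induct_rule[of upper_rank])
    case (less p)
    show ?case by (rule that) (rule less, simp add: less_upper_def)
  qed
qed (auto simp: less_eq_upper_def less_upper_def)

end

type_synonym 'k upper_vec = "(real, 'k upper) vec"

definition lo :: "'k::linorder upper \<Rightarrow> 'k" where "lo p = fst (Rep_upper p)"
definition hi :: "'k::linorder upper \<Rightarrow> 'k" where "hi p = snd (Rep_upper p)"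
definition uix :: "'k::linorder \<Rightarrow> 'k \<Rightarrow> 'k upper" where "uix i j = Abs_upper (min i j, max i j)"

lemma lo_uix [simp]: "lo (uix i j) = min i j"
  and hi_uix [simp]: "hi (uix i j) = max i j"
  by (simp_all add: lo_def hi_def uix_def Abs_upper_inverse min_le_iff_disj)

lemma lo_le_hi: "lo p \<le> hi p"
  using Rep_upper[of p] by (simp add: lo_def hi_def case_prod_beta)

lemma uix_lo_hi [simp]: "uix (lo p) (hi p) = p"
  using lo_le_hi[of p] by (simp add: uix_def lo_def hi_def Rep_upper_inverse)

lemma uix_commute: "uix i j = uix j i"
  by (simp add: uix_def min.commute max.commute)

definition sym_of :: "('k::{finite,wellorder}) upper_vec \<Rightarrow> 'k sq_matrix" where
  "sym_of v = (\<chi> i j. v $ uix i j)"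

text \<open>One vector stores a pair (A, D): the slots i < j hold the skew matrix, the slots (i, i)
  the eigenvalues, read off by \<open>diag_of\<close>. Parameters and symmetric matrices thus live
  in the same space, as a Jacobian determinant requires.\<close>

definition skew_of :: "('k::{finite,wellorder}) upper_vec \<Rightarrow> 'k sq_matrix" where
  "skew_of v = (\<chi> i j. if i < j then v $ uix i j else if j < i then - v $ uix i j else 0)"

definition diag_of :: "('k::{finite,wellorder}) upper_vec \<Rightarrow> real^'k::{finite,wellorder}" where
  "diag_of v = (\<chi> i. v $ uix i i)"

definition upper_of :: "('k::{finite,wellorder}) sq_matrix \<Rightarrow> 'k upper_vec" where
  "upper_of M = (\<chi> p. M $ lo p $ hi p)"

lemma upper_of_sym_of [simp]: "upper_of (sym_of v) = v"
  by (simp add: upper_of_def sym_of_def vec_eq_iff)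

lemma sym_of_upper_of:
  assumes "transpose M = M"
  shows "sym_of (upper_of M) = M"
proof -
  have "M $ j $ i = M $ i $ j" for i j
    using arg_cong[OF assms, of "\<lambda>M. M $ i $ j"] by (simp add: transpose_def)
  then show ?thesis
    by (simp add: upper_of_def sym_of_def vec_eq_iff min_def max_def)
qed

lemma transpose_sym_of [simp]: "transpose (sym_of v) = sym_of v"
  by (simp add: sym_of_def transpose_def vec_eq_iff uix_commute)

lemma transpose_skew_of: "transpose (skew_of v) = - skew_of v"
  by (auto simp: skew_of_def transpose_def vec_eq_iff uix_commute)

lemma skew_of_offdiag:
  assumes "transpose W = - W"
  shows "skew_of (\<chi> p. if lo p = hi p then c p else W $ lo p $ hi p) = W"
proof -
  have *: "W $ j $ i = - W $ i $ j" for i j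
    using arg_cong[OF assms, of "\<lambda>M. M $ i $ j"] by (simp add: transpose_def)
  have "skew_of (\<chi> p. if lo p = hi p then c p else W $ lo p $ hi p) $ i $ j = W $ i $ j" for i j
    using *[of i j] *[of i i]
      by (cases i j rule: linorder_cases) (auto simp: skew_of_def min_def max_def)
  then show ?thesis by (simp add: vec_eq_iff)
qed

lemma vec_upper_eqI: "skew_of v = skew_of w \<Longrightarrow> diag_of v = diag_of w \<Longrightarrow> v = w"
proof -
  assume eq: "skew_of v = skew_of w" "diag_of v = diag_of w"
  have "v $ p = w $ p" for p
  proof (cases "lo p = hi p")
    case True
    then show ?thesis using arg_cong[OF eq(2), of "\<lambda>x. x $ lo p"] uix_lo_hi[of p]
      by (simp add: diag_of_def)
  next
    case False
    then have "lo p < hi p" using lo_le_hi[of p] by simp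
    then show ?thesis using arg_cong[OF eq(1), of "\<lambda>x. x $ lo p $ hi p"] by (simp add: skew_of_def)
  qed
  then show ?thesis by (simp add: vec_eq_iff)
qed

lemma linear_sym_of: "linear sym_of" and linear_skew_of: "linear skew_of"
  and linear_diag_of: "linear diag_of" and linear_upper_of: "linear upper_of"
  by (auto simp: linear_iff sym_of_def skew_of_def diag_of_def upper_of_def vec_eq_iff)

section \<open>The three linear factors of the Jacobian\<close>

definition conj_upper :: "('k::{finite,wellorder}) sq_matrix \<Rightarrow> 'k upper_vec \<Rightarrow> 'k upper_vec" where
  "conj_upper C w = upper_of (transpose C ** sym_of w ** C)"

text \<open>Off the diagonal this is the upper triangle of \<omega> in dC = \<omega> C, where C is
  the Cayley transform of \<open>A\<close> and \<omega> = -2 N dA N^t with N the resolvent. The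
  diagonal slots pass dD through unchanged.\<close>

definition angular :: "('k::{finite,wellorder}) sq_matrix \<Rightarrow> 'k upper_vec \<Rightarrow> 'k upper_vec" where
  "angular A h = (\<chi> p. if lo p = hi p then h $ p
     else ((-2) *\<^sub>R (resolvent A ** skew_of h ** transpose (resolvent A))) $ lo p $ hi p)"

definition angular_inv :: "('k::{finite,wellorder}) sq_matrix \<Rightarrow> 'k upper_vec \<Rightarrow> 'k upper_vec" where
  "angular_inv A h = (\<chi> p. if lo p = hi p then h $ p
     else ((-1/2) *\<^sub>R ((mat 1 + A) ** skew_of h ** (mat 1 - A))) $ lo p $ hi p)"

text \<open>The map from (\<omega>, dD) to D \<omega> - \<omega> D + dD in coordinates. It is
  diagonal, and the whole degeneracy of the parametrization at coinciding eigenvalues sits in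
  it.\<close>

definition gap :: "real^'k::{finite,wellorder} \<Rightarrow> ('k::{finite,wellorder}) upper_vec \<Rightarrow> 'k upper_vec" where
  "gap d w = (\<chi> p. if lo p = hi p then w $ p else (d $ lo p - d $ hi p) * w $ p)"

lemma linear_conj_upper: "linear (conj_upper C)"
  by (rule linearI) (simp_all add: conj_upper_def linear_add[OF linear_sym_of] linear_scale[OF linear_sym_of]
      linear_add[OF linear_upper_of] linear_scale[OF linear_upper_of] matrix_mult.add_left matrix_mult.add_right
      matrix_mult.scaleR_left matrix_mult.scaleR_right)

lemma linear_angular: "linear (angular A)" and linear_angular_inv: "linear (angular_inv A)"
  and linear_gap: "linear (gap d)"
  by (auto simp: linear_iff angular_def angular_inv_def gap_def linear_add[OF linear_skew_of]
      linear_scale[OF linear_skew_of] matrix_mult.add_left matrix_mult.add_right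
      matrix_mult.scaleR_left matrix_mult.scaleR_right vec_eq_iff algebra_simps)

lemma conj_upper_inverse:
  assumes "orthogonal_matrix C"
  shows "conj_upper C (conj_upper (transpose C) w) = w"
proof -
  have C: "C ** transpose C = mat 1" "transpose C ** C = mat 1" using assms
    by (auto simp: orthogonal_matrix_def)
  have "sym_of (conj_upper (transpose C) w) = C ** sym_of w ** transpose C"
    unfolding conj_upper_def
      by (subst sym_of_upper_of) (simp_all add: matrix_transpose_mul matrix_mul_assoc)
  then have "conj_upper C (conj_upper (transpose C) w) =
      upper_of ((transpose C ** C) ** sym_of w ** (transpose C ** C))"
    by (simp add: conj_upper_def[of C] matrix_mul_assoc)
  then show ?thesis by (simp add: C)
qed

lemma skew_conj:
  assumes "transpose W = - W"
  shows "transpose (c *\<^sub>R (M ** W ** transpose M)) = - (c *\<^sub>R (M ** W ** transpose (M :: real^'n^'n)))"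
  by (simp add: transpose_scalar matrix_transpose_mul assms matrix_mul_assoc matrix_mult.minus_left matrix_mult.minus_right)

lemma skew_of_angular:
  "skew_of (angular A h) = (-2) *\<^sub>R (resolvent A ** skew_of h ** transpose (resolvent A))"
  unfolding angular_def by (rule skew_of_offdiag[OF skew_conj[OF transpose_skew_of]])

lemma skew_of_angular_inv:
  assumes A: "transpose A = - A"
  shows "skew_of (angular_inv A h) = (-1/2) *\<^sub>R ((mat 1 + A) ** skew_of h ** (mat 1 - A))"
proof -
  have eq: "mat 1 - A = transpose (mat 1 + A)" by (simp add: transpose_add A)
  show ?thesis
    unfolding angular_inv_def eq by (rule skew_of_offdiag[OF skew_conj[OF transpose_skew_of]])
qed

lemma diag_of_angular [simp]: "diag_of (angular A h) = diag_of h"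
  and diag_of_angular_inv [simp]: "diag_of (angular_inv A h) = diag_of h"
  by (simp_all add: diag_of_def angular_def angular_inv_def)

lemma angular_inverse:
  assumes A: "transpose A = - A"
  shows "angular A (angular_inv A h) = h"
proof (rule vec_upper_eqI)
  have "skew_of (angular A (angular_inv A h)) =
    (resolvent A ** (mat 1 + A)) ** skew_of h ** ((mat 1 - A) ** transpose (resolvent A))"
    by (simp add: skew_of_angular skew_of_angular_inv[OF A] matrix_mult.scaleR_left matrix_mult.scaleR_right
        matrix_mult.minus_left matrix_mult.minus_right matrix_mul_assoc)
  then show "skew_of (angular A (angular_inv A h)) = skew_of h"
    by (simp add: resolvent_left[OF A] transpose_resolvent[OF A])
qed simp

lemma sym_of_gap:
  "sym_of (gap d w) = diag_mat d ** skew_of w - skew_of w ** diag_mat d + diag_mat (diag_of w)"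
proof -
  have "sym_of (gap d w) $ i $ j =
    d $ i * skew_of w $ i $ j - skew_of w $ i $ j * d $ j + diag_mat (diag_of w) $ i $ j" for i j
    by (cases i j rule: linorder_cases)
      (auto simp: sym_of_def gap_def skew_of_def diag_mat_def diag_of_def min_absorb1 min_absorb2
        max_absorb1 max_absorb2 left_diff_distrib)
  then show ?thesis by (simp add: vec_eq_iff diag_mat_mult mult_diag_mat)
qed

section \<open>The spectral parametrization and its Jacobian\<close>

lemma norm_le_sum_entries: "norm (M :: real^'n^'m) \<le> (\<Sum>i\<in>UNIV. \<Sum>j\<in>UNIV. \<bar>M $ i $ j\<bar>)"
proof -
  have "norm M \<le> (\<Sum>i\<in>UNIV. norm (M $ i))"
    unfolding norm_vec_def[of M] by (rule L2_set_le_sum) simp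
  also have "\<dots> \<le> (\<Sum>i\<in>UNIV. \<Sum>j\<in>UNIV. \<bar>M $ i $ j\<bar>)"
    by (intro sum_mono norm_le_l1_cart)
  finally show ?thesis .
qed

lemma norm_resolvent_bound:
  assumes "transpose A = - A"
  shows "norm (resolvent A :: real^'n^'n) \<le> real CARD('n) * real CARD('n)"
proof -
  have "norm (resolvent A) \<le> (\<Sum>i\<in>UNIV. \<Sum>j\<in>UNIV. \<bar>resolvent A $ i $ j\<bar>)"
    by (rule norm_le_sum_entries)
  also have "\<dots> \<le> (\<Sum>i\<in>(UNIV::'n set). \<Sum>j\<in>(UNIV::'n set). 1)"
    by (intro sum_mono abs_resolvent_le_1 assms)
  finally show ?thesis by simp
qed

text \<open>The resolvent identity N(w) - N(v) = -N(w) (A_w - A_v) N(v), used twice, writes the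
  remainder exactly as a product containing A_w - A_v two times. As resolvents are uniformly
  bounded, it is quadratically small.\<close>

lemma has_derivative_resolvent_skew_of:
  fixes v :: "('k::{finite,wellorder}) upper_vec"
  shows "((\<lambda>v. resolvent (skew_of v)) has_derivative
    (\<lambda>h. - (resolvent (skew_of v) ** skew_of h ** resolvent (skew_of v)))) (at v)"
proof -
  let ?N = "\<lambda>v. resolvent (skew_of v)"
  obtain K where K: "K > 0" "\<And>X Y. norm (X ** (Y :: ('k::{finite,wellorder}) sq_matrix) :: 'k sq_matrix) \<le> norm X * norm Y * K"
    using matrix_mult.pos_bounded by blast
  obtain L where L: "L > 0" "\<And>w. norm (skew_of w :: ('k::{finite,wellorder}) sq_matrix) \<le> norm w * L"
    using bounded_linear.pos_bounded[OF linear_conv_bounded_linear[THEN iffD1, OF linear_skew_of]]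
      by blast
  define B where "B = real CARD('k) * real CARD('k)"
  have B: "norm (?N w :: ('k::{finite,wellorder}) sq_matrix) \<le> B" for w
    unfolding B_def by (rule norm_resolvent_bound[OF transpose_skew_of])
  have diff: "?N w - ?N v = - (?N w ** skew_of (w - v) ** ?N v)" for w
  proof -
    have "?N w - ?N v = ?N w ** ((mat 1 + skew_of v) ** ?N v) - (?N w ** (mat 1 + skew_of w)) ** ?N v"
      by (simp add: resolvent_right[OF transpose_skew_of] resolvent_left[OF transpose_skew_of])
    then show ?thesis
      by (simp add: matrix_mult.add_left matrix_mult.add_right matrix_mult.diff_left matrix_mult.diff_right
          linear_diff[OF linear_skew_of] matrix_mul_assoc)
  qed
  have rem: "?N w - ?N v - - (?N v ** skew_of (w - v) ** ?N v) =
    ?N w ** skew_of (w - v) ** ?N v ** skew_of (w - v) ** ?N v" for w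
  proof -
    have "?N w - ?N v - - (?N v ** skew_of (w - v) ** ?N v) =
        - ((?N w - ?N v) ** skew_of (w - v) ** ?N v)"
      by (subst diff) (simp add: matrix_mult.diff_left)
    then show ?thesis by (simp add: diff matrix_mult.minus_left matrix_mul_assoc)
  qed
  have mono: "norm (X ** Y) \<le> x * y * K" if "norm X \<le> x" "norm Y \<le> y"
      for X Y :: "('k::{finite,wellorder}) sq_matrix" and x y
  proof -
    have "norm X * norm Y * K \<le> x * y * K"
      using that K(1) order_trans[OF norm_ge_zero that(1)] by (intro mult_right_mono mult_mono) auto
    then show ?thesis using K(2)[of X Y] by linarith
  qed
  define c where "c = B * L * K * B * K * L * K * B * K"
  have le: "norm (?N w - ?N v - - (?N v ** skew_of (w - v) ** ?N v)) \<le> c * norm (w - v) * norm (w - v)"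
      for w
  proof -
    let ?n = "norm (w - v)"
    have "norm (?N w ** skew_of (w - v) ** ?N v ** skew_of (w - v) ** ?N v) \<le>
      ((((B * (?n * L)) * K) * B * K) * (?n * L) * K) * B * K"
      by (intro mono B L)
    then show ?thesis unfolding rem c_def by (simp add: mult_ac)
  qed
  have "linear (\<lambda>h. - (?N v ** skew_of h ** ?N v))"
    by (auto simp: linear_iff linear_add[OF linear_skew_of] linear_scale[OF linear_skew_of] matrix_mult.add_left
        matrix_mult.add_right matrix_mult.scaleR_left matrix_mult.scaleR_right)
  then have "bounded_linear (\<lambda>h. - (?N v ** skew_of h ** ?N v))"
    by (simp add: linear_conv_bounded_linear)
  then show ?thesis
  proof (rule has_derivativeI_sandwich[of 1, rotated])
    show "norm (?N w - ?N v - - (?N v ** skew_of (w - v) ** ?N v)) / norm (w - v) \<le> c * norm (w - v)"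
      if "w \<noteq> v" for w
      using le[of w] that by (simp add: pos_divide_le_eq)
    have "((\<lambda>w. c * norm (w - v)) \<longlongrightarrow> c * norm (v - v)) (at v)"
      by (intro tendsto_intros)
    then show "((\<lambda>w. c * norm (w - v)) \<longlongrightarrow> 0) (at v)" by simp
  qed simp
qed

text \<open>The derivative -2 N dA N takes the form \<omega> C on replacing the right factor N by
  N^t C; \<omega> is then skew, as for any curve of orthogonal matrices.\<close>

lemma has_derivative_cayley_skew_of:
  "((\<lambda>v. cayley (skew_of v)) has_derivative
    (\<lambda>h. skew_of (angular (skew_of v) h) ** cayley (skew_of v))) (at v)"
proof -
  have "((\<lambda>v. cayley (skew_of v)) has_derivative
    (\<lambda>h. 2 *\<^sub>R - (resolvent (skew_of v) ** skew_of h ** resolvent (skew_of v)) - 0)) (at v)"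
    unfolding cayley_def by (intro derivative_intros has_derivative_resolvent_skew_of)
  moreover have "skew_of (angular (skew_of v) h) ** cayley (skew_of v) =
    2 *\<^sub>R - (resolvent (skew_of v) ** skew_of h ** resolvent (skew_of v)) - 0" for h
  proof -
    have "skew_of (angular (skew_of v) h) ** cayley (skew_of v) =
      (-2) *\<^sub>R (resolvent (skew_of v) ** skew_of h ** (transpose (resolvent (skew_of v)) ** cayley (skew_of v)))"
      by (simp add: skew_of_angular matrix_mult.scaleR_left matrix_mult.minus_left matrix_mul_assoc)
    then show ?thesis by (simp add: transpose_resolvent_cayley[OF transpose_skew_of])
  qed
  ultimately show ?thesis by simp
qed

definition frame :: "('k::{finite,wellorder}) sq_matrix \<Rightarrow> 'k upper_vec \<Rightarrow> 'k sq_matrix" where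
  "frame Q v = cayley (skew_of v) ** Q"

definition spectral_map :: "('k::{finite,wellorder}) sq_matrix \<Rightarrow> 'k upper_vec \<Rightarrow> 'k upper_vec" where
  "spectral_map Q v = upper_of (transpose (frame Q v) ** diag_mat (diag_of v) ** frame Q v)"

definition spectral_deriv :: "('k::{finite,wellorder}) sq_matrix \<Rightarrow> 'k upper_vec \<Rightarrow> 'k upper_vec \<Rightarrow>
    'k upper_vec" where
  "spectral_deriv Q v h = conj_upper (frame Q v) (gap (diag_of v) (angular (skew_of v) h))"

lemma orthogonal_matrix_frame: "orthogonal_matrix Q \<Longrightarrow> orthogonal_matrix (frame Q v)"
  unfolding frame_def by (intro orthogonal_matrix_mul orthogonal_matrix_cayley transpose_skew_of)

lemma sym_of_spectral_map:
  "sym_of (spectral_map Q v) = transpose (frame Q v) ** diag_mat (diag_of v) ** frame Q v"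
  unfolding spectral_map_def
  by (rule sym_of_upper_of) (simp add: matrix_transpose_mul matrix_mul_assoc)

text \<open>With \<open>E = C(A)Q\<close> and \<open>dE = \<omega>E\<close>, \<open>\<omega>\<close> skew, one has
  \<open>d(E\<^sup>t D E) = E\<^sup>t (D \<omega> - \<omega> D + dD) E\<close>, and \<open>D \<omega> - \<omega> D\<close> has the entries \<open>(d\<^sub>i - d\<^sub>j) \<omega>\<^sub>i\<^sub>j\<close>.\<close>

lemma has_derivative_spectral_map:
  fixes v :: "('k::{finite,wellorder}) upper_vec"
  shows "(spectral_map Q has_derivative spectral_deriv Q v) (at v)"
proof -
  let ?E = "frame Q" and ?D = "\<lambda>v. diag_mat (diag_of v)"
  let ?W = "\<lambda>h. skew_of (angular (skew_of v) h)"
  note lin = linear_conv_bounded_linear[THEN iffD1]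
  have "((\<lambda>v. cayley (skew_of v) ** Q) has_derivative (\<lambda>h. ?W h ** cayley (skew_of v) ** Q)) (at v)"
    by (rule bounded_linear.has_derivative[OF matrix_mult.bounded_linear_left has_derivative_cayley_skew_of])
  then have E: "(?E has_derivative (\<lambda>h. ?W h ** ?E v)) (at v)"
    unfolding frame_def by (simp add: matrix_mul_assoc)
  have "bounded_linear (transpose :: ('k::{finite,wellorder}) sq_matrix \<Rightarrow> 'k sq_matrix)"
    by (rule lin) (simp add: linear_iff transpose_add transpose_scalar)
  from bounded_linear.has_derivative[OF this E]
  have Et: "((\<lambda>v. transpose (?E v)) has_derivative (\<lambda>h. transpose (?W h ** ?E v))) (at v)" .
  have D: "(?D has_derivative ?D) (at v)"
    by (intro bounded_linear_imp_has_derivative bounded_linear_compose[OF lin lin] linear_diag_mat linear_diag_of)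
  have "((\<lambda>v. upper_of (transpose (?E v) ** ?D v ** ?E v)) has_derivative
    (\<lambda>h. upper_of ((transpose (?E v) ** ?D v) ** (?W h ** ?E v) +
        (transpose (?E v) ** ?D h + transpose (?W h ** ?E v) ** ?D v) ** ?E v))) (at v)"
    by (intro bounded_linear.has_derivative[OF lin[OF linear_upper_of]] matrix_mult.FDERIV E Et D)
  moreover have "upper_of ((transpose (?E v) ** ?D v) ** (?W h ** ?E v) +
        (transpose (?E v) ** ?D h + transpose (?W h ** ?E v) ** ?D v) ** ?E v) = spectral_deriv Q v h" for h
    by (simp add: spectral_deriv_def conj_upper_def sym_of_gap matrix_transpose_mul transpose_skew_of
        matrix_mult.add_left matrix_mult.add_right matrix_mult.diff_left matrix_mult.diff_right
        matrix_mult.minus_left matrix_mult.minus_right matrix_mul_assoc)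
      (simp add: algebra_simps)
  ultimately show ?thesis unfolding spectral_map_def by simp
qed

lemma spectral_map_differentiable_on: "spectral_map Q differentiable_on S"
  unfolding differentiable_on_def
  using has_derivative_spectral_map differentiableI differentiable_at_withinI by blast

section \<open>Two-sided bounds for the Jacobian determinant\<close>

lemma abs_det_le:
  fixes A :: "real^'n^'n"
  assumes "\<And>i j. \<bar>A $ i $ j\<bar> \<le> B"
  shows "\<bar>det A\<bar> \<le> fact CARD('n) * B ^ CARD('n)"
proof -
  have "\<bar>det A\<bar> \<le> (\<Sum>p | p permutes (UNIV :: 'n set). \<bar>of_int (sign p) * (\<Prod>i\<in>UNIV. A $ i $ p i)\<bar>)"
    unfolding det_def by (rule sum_abs)
  also have "\<dots> \<le> (\<Sum>p | p permutes (UNIV :: 'n set). B ^ CARD('n))"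
  proof (rule sum_mono)
    fix p
    have "\<bar>of_int (sign p) * (\<Prod>i\<in>UNIV. A $ i $ p i)\<bar> = (\<Prod>i\<in>(UNIV::'n set). \<bar>A $ i $ p i\<bar>)"
      by (simp add: abs_mult abs_prod sign_def)
    also have "\<dots> \<le> (\<Prod>i\<in>(UNIV::'n set). B)" by (intro prod_mono) (auto simp: assms)
    finally show "\<bar>of_int (sign p) * (\<Prod>i\<in>UNIV. A $ i $ p i)\<bar> \<le> B ^ CARD('n)" by simp
  qed
  also have "\<dots> = fact CARD('n) * B ^ CARD('n)"
    by (simp add: card_permutations[of UNIV "CARD('n)"])
  finally show ?thesis .
qed

text \<open>An upper bound on the determinant of the inverse is a lower bound on the determinant, so
  crude entrywise bounds on \<open>f\<close> and \<open>g\<close> serve both sides.\<close>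

lemma abs_det_matrix_bounds:
  fixes f g :: "real^'n \<Rightarrow> real^'n"
  assumes lin: "linear f" "linear g" and inv: "\<And>x. f (g x) = x"
    and f: "\<And>i j. \<bar>f (axis j 1) $ i\<bar> \<le> B" and g: "\<And>i j. \<bar>g (axis j 1) $ i\<bar> \<le> B"
  defines "K \<equiv> fact CARD('n) * B ^ CARD('n)"
  shows "\<bar>det (matrix f)\<bar> \<le> K" and "1 \<le> K * \<bar>det (matrix f)\<bar>"
proof -
  have entries: "\<bar>det (matrix f)\<bar> \<le> K" "\<bar>det (matrix g)\<bar> \<le> K"
    unfolding K_def by (intro abs_det_le; simp add: matrix_def f g)+
  then show "\<bar>det (matrix f)\<bar> \<le> K" by simp
  have "matrix f ** matrix g = mat 1"
    using matrix_compose[OF lin(2,1)] inv by (simp add: o_def matrix_id_mat_1[unfolded id_def])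
  then have "\<bar>det (matrix f)\<bar> * \<bar>det (matrix g)\<bar> = 1"
    by (metis abs_mult abs_one det_I det_mul)
  then show "1 \<le> K * \<bar>det (matrix f)\<bar>"
    using mult_left_mono[OF entries(2), of "\<bar>det (matrix f)\<bar>"] by (simp add: mult.commute)
qed

lemma abs_triple_mult_le:
  fixes X Y Z :: "real^'n^'n"
  assumes X: "\<And>i j. \<bar>X $ i $ j\<bar> \<le> a" and Y: "\<And>i j. \<bar>Y $ i $ j\<bar> \<le> b" and Z: "\<And>i j. \<bar>Z $ i $ j\<bar> \<le> c"
  shows "\<bar>(X ** Y ** Z) $ i $ j\<bar> \<le> (real CARD('n))\<^sup>2 * (a * b * c)"
proof -
  have mul: "\<bar>(P ** R) $ i $ j\<bar> \<le> real CARD('n) * (p * r)"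
    if P: "\<And>i j. \<bar>P $ i $ j\<bar> \<le> p" and R: "\<And>i j. \<bar>R $ i $ j\<bar> \<le> r" for P R :: "real^'n^'n" and p r i j
  proof -
    have "0 \<le> p" using order_trans[OF abs_ge_zero P] .
    have "\<bar>(P ** R) $ i $ j\<bar> \<le> (\<Sum>l\<in>UNIV. \<bar>P $ i $ l * R $ l $ j\<bar>)"
      by (simp add: matrix_matrix_mult_def sum_abs)
    also have "\<dots> \<le> (\<Sum>l\<in>(UNIV::'n set). p * r)"
      unfolding abs_mult by (intro sum_mono mult_mono P R abs_ge_zero \<open>0 \<le> p\<close>)
    finally show ?thesis by simp
  qed
  have "\<bar>(X ** Y ** Z) $ i $ j\<bar> \<le> real CARD('n) * ((real CARD('n) * (a * b)) * c)"
    by (intro mul X Y Z)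
  then show ?thesis by (simp add: power2_eq_square mult_ac)
qed

lemma abs_orthogonal_matrix_le:
  assumes "orthogonal_matrix (Q :: real^'n^'n)"
  shows "\<bar>Q $ i $ j\<bar> \<le> 1"
proof -
  have "norm (Q $ i) = 1"
    using assms by (simp add: orthogonal_matrix_orthonormal_rows row_def vec_nth_inverse)
  then show ?thesis using component_le_norm_cart[of "Q $ i" j] by simp
qed

lemma det_gap: "det (matrix (gap d)) = vandermonde d"
proof -
  have "det (matrix (gap d)) = (\<Prod>p\<in>UNIV. matrix (gap d) $ p $ p)"
    by (rule det_diagonal) (simp add: matrix_def gap_def axis_def)
  also have "\<dots> = (\<Prod>p\<in>UNIV. if lo p = hi p then 1 else d $ lo p - d $ hi p)"
    by (intro prod.cong) (auto simp: matrix_def gap_def)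
  also have "\<dots> = (\<Prod>p\<in>{p. lo p < hi p}. d $ lo p - d $ hi p)"
    by (intro prod.mono_neutral_cong_right) (use lo_le_hi in \<open>auto simp: less_le\<close>)
  also have "\<dots> = (\<Prod>(i, j)\<in>{(i, j). i < j}. d $ i - d $ j)"
    by (rule prod.reindex_bij_witness[of _ "\<lambda>(i, j). uix i j" "\<lambda>p. (lo p, hi p)"]) auto
  finally show ?thesis by (simp add: vandermonde_def)
qed

text \<open>The derivative is \<open>conj_upper\<close> after \<open>gap\<close> after
  \<open>angular\<close>. The outer two have determinants between 1/K and K in absolute value; the
  middle one is the Vandermonde product. The entry bound 2 n^2 in \<open>K\<close> comes from triple
  matrix products: n^2 for conjugation, 2 n^2 for \<open>angular\<close>, and 4 n^2 / 2 for its
  inverse, where \<open>small\<close> bounds the entries of I + A and I - A by 2.\<close>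

lemma jacobian_bounds:
  fixes Q :: "('k::{finite,wellorder}) sq_matrix"
  assumes Q: "orthogonal_matrix Q" and small: "\<And>i j. \<bar>skew_of v $ i $ j\<bar> \<le> 1"
    and van: "0 \<le> vandermonde (diag_of v)"
  defines "K \<equiv> fact CARD('k upper) * (2 * (real CARD('k))\<^sup>2) ^ CARD('k upper)"
  shows "\<bar>det (matrix (spectral_deriv Q v))\<bar> \<le> K\<^sup>2 * vandermonde (diag_of v)"
    and "vandermonde (diag_of v) \<le> K\<^sup>2 * \<bar>det (matrix (spectral_deriv Q v))\<bar>"
proof -
  let ?n = "(real CARD('k))\<^sup>2" and ?A = "skew_of v"
  have A: "transpose ?A = - ?A" by (rule transpose_skew_of)
  have n: "1 \<le> ?n" by (simp add: Suc_leI)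
  have K: "K > 0" unfolding K_def by (intro mult_pos_pos zero_less_power) (use n in auto)
  have ax: "\<bar>sym_of (axis p 1) $ i $ j\<bar> \<le> 1" "\<bar>skew_of (axis p 1) $ i $ j\<bar> \<le> 1"
    for p :: "'k upper" and i j
    by (auto simp: sym_of_def skew_of_def axis_def)
  have ax1: "\<bar>axis p 1 $ q\<bar> \<le> 2 * ?n" for p q :: "'k upper"
  proof -
    have "\<bar>axis p 1 $ q\<bar> \<le> (1 :: real)" by (simp add: axis_def)
    then show ?thesis using n by linarith
  qed
  have conj: "\<bar>conj_upper C (axis p 1) $ q\<bar> \<le> 2 * ?n" if "orthogonal_matrix C"
      for C :: "('k::{finite,wellorder}) sq_matrix" and p q
  proof -
    have "\<bar>(transpose C ** sym_of (axis p 1) ** C) $ lo q $ hi q\<bar> \<le> ?n * (1 * 1 * 1)"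
      using that by (intro abs_triple_mult_le ax abs_orthogonal_matrix_le) auto
    then show ?thesis using n by (simp add: conj_upper_def upper_of_def)
  qed
  have ang: "\<bar>angular ?A (axis p 1) $ q\<bar> \<le> 2 * ?n" for p q
  proof -
    have "\<bar>(resolvent ?A ** skew_of (axis p 1) ** transpose (resolvent ?A)) $ lo q $ hi q\<bar> \<le> ?n * (1 *
        1 * 1)"
      by (intro abs_triple_mult_le ax) (auto simp: transpose_def abs_resolvent_le_1[OF A])
    then show ?thesis using ax1[of p q] by (cases "lo q = hi q") (simp_all add: angular_def abs_mult)
  qed
  have ang': "\<bar>angular_inv ?A (axis p 1) $ q\<bar> \<le> 2 * ?n" for p q
  proof -
    have "\<bar>(mat 1 + ?A) $ i $ j\<bar> \<le> 2" "\<bar>(mat 1 - ?A) $ i $ j\<bar> \<le> 2" for i j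
      using small[of i j] by (auto simp: mat_def)
    then have "\<bar>((mat 1 + ?A) ** skew_of (axis p 1) ** (mat 1 - ?A)) $ lo q $ hi q\<bar> \<le> ?n * (2 * 1 * 2)"
      by (intro abs_triple_mult_le ax)
    then show ?thesis using ax1[of p q] by (cases "lo q = hi q") (simp_all add: angular_inv_def abs_mult)
  qed
  have E: "orthogonal_matrix (frame Q v)" "orthogonal_matrix (transpose (frame Q v))"
    using orthogonal_matrix_frame[OF Q] by auto
  define a where "a = \<bar>det (matrix (conj_upper (frame Q v)))\<bar>"
  define b where "b = \<bar>det (matrix (angular ?A))\<bar>"
  have a: "a \<le> K" "1 \<le> K * a"
    using abs_det_matrix_bounds[OF linear_conj_upper linear_conj_upper conj_upper_inverse[OF E(1)] conj[OF E(1)] conj[OF E(2)]]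
    by (simp_all add: a_def K_def)
  have b: "b \<le> K" "1 \<le> K * b"
    using abs_det_matrix_bounds[OF linear_angular linear_angular_inv angular_inverse[OF A] ang ang']
    by (simp_all add: b_def K_def)
  have ab: "0 \<le> a" "0 \<le> b" by (simp_all add: a_def b_def)
  have "spectral_deriv Q v = conj_upper (frame Q v) \<circ> (gap (diag_of v) \<circ> angular ?A)"
    by (simp add: fun_eq_iff spectral_deriv_def)
  then have "det (matrix (spectral_deriv Q v)) =
    det (matrix (conj_upper (frame Q v))) * (vandermonde (diag_of v) * det (matrix (angular ?A)))"
    by (simp add: matrix_compose linear_conj_upper linear_compose linear_gap linear_angular det_mul det_gap)
  then have eq: "\<bar>det (matrix (spectral_deriv Q v))\<bar> = (a * b) * vandermonde (diag_of v)"
    using van by (simp add: abs_mult a_def b_def mult_ac)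
  have "a * b \<le> K * K" using a b ab by (intro mult_mono) auto
  then show "\<bar>det (matrix (spectral_deriv Q v))\<bar> \<le> K\<^sup>2 * vandermonde (diag_of v)"
    unfolding eq using van by (simp add: power2_eq_square mult_right_mono)
  have "1 * 1 \<le> (K * a) * (K * b)" using a b ab K by (intro mult_mono) auto
  then have "1 * vandermonde (diag_of v) \<le> ((K * a) * (K * b)) * vandermonde (diag_of v)"
    using van by (intro mult_right_mono) auto
  then show "vandermonde (diag_of v) \<le> K\<^sup>2 * \<bar>det (matrix (spectral_deriv Q v))\<bar>"
    unfolding eq by (simp add: power2_eq_square mult_ac)
qed

section \<open>Patches: injectivity, covering and the exceptional null set\<close>

definition spectral_patch :: "real \<Rightarrow> ('k::{finite,wellorder}) upper_vec set" where
  "spectral_patch r = {v. ordered_spectrum (diag_of v) \<and> (\<forall>p. lo p \<noteq> hi p \<longrightarrow> \<bar>v $ p\<bar> \<le> r)}"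

lemma abs_skew_of_le:
  assumes "v \<in> spectral_patch r" "0 \<le> r"
  shows "\<bar>skew_of v $ i $ j\<bar> \<le> r"
proof (cases "i = j")
  case False
  then have "lo (uix i j) \<noteq> hi (uix i j)" by (auto simp: min_def max_def)
  then have "\<bar>v $ uix i j\<bar> \<le> r" using assms by (auto simp: spectral_patch_def)
  then show ?thesis using assms(2) by (simp add: skew_of_def)
qed (use assms in \<open>simp add: skew_of_def\<close>)

lemma vandermonde_pos: "ordered_spectrum d \<Longrightarrow> 0 < vandermonde d"
  unfolding vandermonde_def by (rule prod_pos) (auto simp: ordered_spectrum_def)

text \<open>The centre \<open>Q\<close> cancels in the product of one frame with the transpose of
  the other. What remains is a product of two Cayley transforms close to I, whose positive diagonal
  makes the diagonalization unique.\<close>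

lemma inj_on_spectral_map:
  fixes Q :: "('k::{finite,wellorder}) sq_matrix"
  assumes Q: "orthogonal_matrix Q" and r: "r \<le> 1 / (4 * (real CARD('k))\<^sup>2)" "0 \<le> r"
  shows "inj_on (spectral_map Q) (spectral_patch r)"
proof (rule inj_onI)
  fix v w assume v: "v \<in> spectral_patch r" and w: "w \<in> spectral_patch r"
      and eq: "spectral_map Q v = spectral_map Q w"
  have QQ: "Q ** transpose Q = mat 1" using Q by (simp add: orthogonal_matrix_def)
  have "frame Q v ** transpose (frame Q w) =
      cayley (skew_of v) ** (Q ** transpose Q) ** transpose (cayley (skew_of w))"
    by (simp add: frame_def matrix_transpose_mul matrix_mul_assoc)
  then have "frame Q v ** transpose (frame Q w) = cayley (skew_of v) ** transpose (cayley (skew_of w))"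
    by (simp add: QQ)
  then have pos: "(frame Q v ** transpose (frame Q w)) $ i $ i > 0" for i
    using abs_skew_of_le[OF v r(2)] abs_skew_of_le[OF w r(2)] r(1)
    by (simp add: cayley_mult_transpose_diag_pos transpose_skew_of order_trans[OF _ r(1)])
  have "diag_of v $ i \<noteq> diag_of v $ j" if "i \<noteq> j" for i j
    using v that
      by (cases i j rule: linorder_cases) (force simp: spectral_patch_def ordered_spectrum_def)+
  moreover have "transpose (frame Q v) ** diag_mat (diag_of v) ** frame Q v =
      transpose (frame Q w) ** diag_mat (diag_of w) ** frame Q w"
    using arg_cong[OF eq, of sym_of] by (simp add: sym_of_spectral_map)
  ultimately have "diag_of v = diag_of w \<and> frame Q v = frame Q w"
    by (intro diagonalization_unique orthogonal_matrix_frame Q pos)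
  then have d: "diag_of v = diag_of w" and "frame Q v ** transpose Q = frame Q w ** transpose Q"
    by simp_all
  then have "cayley (skew_of v) ** (Q ** transpose Q) = cayley (skew_of w) ** (Q ** transpose Q)"
    by (simp add: frame_def matrix_mul_assoc)
  then have "cayley (skew_of v) = cayley (skew_of w)" by (simp add: QQ)
  then have "skew_of v = skew_of w" by (rule cayley_inject[OF transpose_skew_of transpose_skew_of])
  then show "v = w" using d by (rule vec_upper_eqI)
qed

lemma finite_orthogonal_net:
  fixes r :: real
  assumes r: "0 < r" "real CARD('k) * r \<le> 1"
  obtains F :: "('k::{finite,wellorder}) sq_matrix set"
  where "finite F" "\<And>Q. Q \<in> F \<Longrightarrow> orthogonal_matrix Q"
    "\<And>H. orthogonal_matrix H \<Longrightarrow> \<exists>Q\<in>F. \<exists>A. transpose A = - A \<and> (\<forall>i j. \<bar>A $ i $ j\<bar> \<le> r) \<and> cayley A ** Q = H"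
proof -
  \<comment> \<open>Nearness is measured after translating the centre to the identity, which is the
    form that \<open>ex_small_cayley\<close> takes.\<close>
  define U :: "('k::{finite,wellorder}) sq_matrix \<Rightarrow> 'k sq_matrix set"
    where "U Q = {X. \<forall>i j. \<bar>(X ** transpose Q - mat 1) $ i $ j\<bar> < r}" for Q
  have "open (U Q)" for Q
  proof -
    have "U Q = (\<Inter>i. \<Inter>j. {X. \<bar>(X ** transpose Q - mat 1) $ i $ j\<bar> < r})"
      by (auto simp: U_def)
    also have "open \<dots>"
      unfolding matrix_matrix_mult_def vector_minus_component vec_lambda_beta
      by (intro open_INT ballI open_Collect_less continuous_intros) auto
    finally show ?thesis .
  qed
  moreover have "{H. orthogonal_matrix H} \<subseteq> (\<Union>Q\<in>{H. orthogonal_matrix H}. U Q)"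
    using r by (auto simp: U_def orthogonal_matrix_def)
  ultimately obtain F where F: "F \<subseteq> {H. orthogonal_matrix H}" "finite F" "{H. orthogonal_matrix H} \<subseteq> (\<Union>Q\<in>F. U Q)"
    using compactE_image[OF compact_orthogonal_matrices] by metis
  show thesis
  proof
    fix H :: "('k::{finite,wellorder}) sq_matrix" assume H: "orthogonal_matrix H"
    then obtain Q where Q: "Q \<in> F" "H \<in> U Q" using F by auto
    then have oQ: "orthogonal_matrix Q" using F by auto
    have "orthogonal_matrix (H ** transpose Q)" using H oQ by (intro orthogonal_matrix_mul) auto
    moreover have "\<bar>(H ** transpose Q - mat 1) $ i $ j\<bar> \<le> r" for i j
      using Q(2) by (auto simp: U_def intro: less_imp_le)
    ultimately obtain A where A: "transpose A = - A" "cayley A = H ** transpose Q" "\<And>i j. \<bar>A $ i $ j\<bar> \<le>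
        r"
      using ex_small_cayley[of "H ** transpose Q" r] r(2) by blast
    have "cayley A ** Q = H"
      using oQ by (simp add: A orthogonal_matrix_def matrix_mul_assoc[symmetric])
    then show "\<exists>Q\<in>F. \<exists>A. transpose A = - A \<and> (\<forall>i j. \<bar>A $ i $ j\<bar> \<le> r) \<and> cayley A ** Q = H"
      using A Q(1) by blast
  qed (use F in auto)
qed

lemma negligible_repeated_diag:
  "negligible {v :: ('k::{finite,wellorder}) upper_vec. \<exists>i j. i < j \<and> diag_of v $ i = diag_of v $ j}"
proof -
  have "negligible {v :: ('k::{finite,wellorder}) upper_vec. diag_of v $ i = diag_of v $ j}" if "i < j"
      for i j
  proof -
    have "{v :: ('k::{finite,wellorder}) upper_vec. diag_of v $ i = diag_of v $ j} =
      {v. (axis (uix i i) 1 - axis (uix j j) 1) \<bullet> v = 0}"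
      by (auto simp: diag_of_def inner_diff_left inner_axis' )
    moreover have "axis (uix i i) (1::real) - axis (uix j j) 1 \<noteq> 0"
    proof
      assume "axis (uix i i) (1::real) - axis (uix j j) 1 = 0"
      then have "uix i i = uix j j" by (simp add: axis_eq_axis)
      then show False using that by (metis lo_uix min.idem less_irrefl)
    qed
    ultimately show ?thesis by (simp add: negligible_hyperplane)
  qed
  then have "negligible (\<Union>(i, j)\<in>{(i, j). i < j}. {v :: ('k::{finite,wellorder}) upper_vec. diag_of v $ i = diag_of v $ j})"
    by (intro negligible_Union) auto
  moreover have "(\<Union>(i, j)\<in>{(i, j). i < j}. {v :: ('k::{finite,wellorder}) upper_vec. diag_of v $ i =
      diag_of v $ j}) =
    {v. \<exists>i j. i < j \<and> diag_of v $ i = diag_of v $ j}" by auto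
  ultimately show ?thesis by simp
qed

lemma pos_def_spectral_map:
  fixes v :: "('k::{finite,wellorder}) upper_vec"
  assumes Q: "orthogonal_matrix Q" and pos: "\<And>i. 0 < diag_of v $ i"
  shows "pos_def (sym_of (spectral_map Q v))"
  unfolding pos_def_def
proof (intro conjI allI impI)
  fix x :: "real^'k::{finite,wellorder}" assume "x \<noteq> 0"
  let ?E = "frame Q v"
  define y where "y = ?E *v x"
  have E: "transpose ?E ** ?E = mat 1" using orthogonal_matrix_frame[OF Q]
    by (simp add: orthogonal_matrix)
  have "transpose ?E *v y = x" unfolding y_def matrix_vector_mul_assoc E by simp
  then have "y \<noteq> 0" using \<open>x \<noteq> 0\<close> by auto
  then obtain i where i: "y $ i \<noteq> 0" by (auto simp: vec_eq_iff)
  have "x \<bullet> (sym_of (spectral_map Q v) *v x) = x \<bullet> (transpose ?E *v (diag_mat (diag_of v) *v y))"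
    by (simp add: sym_of_spectral_map y_def matrix_vector_mul_assoc matrix_mul_assoc del: transpose_matrix_vector)
  also have "\<dots> = (diag_mat (diag_of v) *v y) \<bullet> y"
    unfolding inner_transpose_mult y_def ..
  also have "\<dots> = (\<Sum>i\<in>UNIV. diag_of v $ i * (y $ i)\<^sup>2)"
    by (simp add: inner_vec_def matrix_vector_mult_def diag_mat_def power2_eq_square if_distrib[of "\<lambda>x. x * _"] mult.assoc cong: if_cong)
  also have "\<dots> > 0"
    by (rule sum_pos2[of _ i]) (use i pos in \<open>auto intro!: mult_pos_pos mult_nonneg_nonneg less_imp_le[OF pos]\<close>)
  finally show "x \<bullet> (sym_of (spectral_map Q v) *v x) > 0" .
qed simp

lemma ex_pos_def_diagonalization:
  fixes V :: "('k::{finite,wellorder}) sq_matrix"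
  assumes pd: "pos_def V"
  obtains H d where "orthogonal_matrix H" "V = transpose H ** diag_mat d ** H"
    "\<And>i j. i < j \<Longrightarrow> d $ j \<le> d $ i" "\<And>i. 0 < d $ i"
proof -
  obtain H d where H: "orthogonal_matrix H" and V: "V = transpose H ** diag_mat d ** H"
    and d: "\<And>i j. i < j \<Longrightarrow> d $ j \<le> d $ i"
    using ex_orthogonal_diagonalization[of V] pd by (auto simp: pos_def_def)
  have dpos: "0 < d $ i" for i
  proof -
    have HH: "H ** transpose H = mat 1" using H by (simp add: orthogonal_matrix_def)
    define x where "x = transpose H *v axis i 1"
    have Hx: "H *v x = axis i 1"
      by (simp add: x_def matrix_vector_mul_assoc HH del: transpose_matrix_vector)
    then have "x \<noteq> 0" by auto
    then have "0 < x \<bullet> (V *v x)" using pd by (simp add: pos_def_def)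
    also have "x \<bullet> (V *v x) = x \<bullet> (transpose H *v (diag_mat d *v (H *v x)))"
      by (simp add: V matrix_vector_mul_assoc matrix_mul_assoc del: transpose_matrix_vector)
    also have "\<dots> = (diag_mat d *v axis i 1) \<bullet> axis i 1"
      unfolding inner_transpose_mult Hx ..
    also have "\<dots> = d $ i" by (simp add: inner_axis matrix_vector_mult_basis column_def diag_mat_def)
    finally show ?thesis .
  qed
  then show thesis using that H V d by blast
qed

text \<open>Diagonalization gives weakly decreasing eigenvalues only. Strictly decreasing ones lead
  to a patch; a tie puts the parameter on a hyperplane, whatever the skew part is.\<close>

lemma ex_spectral_map:
  fixes w :: "('k::{finite,wellorder}) upper_vec"
  assumes net: "\<And>H. orthogonal_matrix H \<Longrightarrow>
      \<exists>Q\<in>F. \<exists>A. transpose A = - A \<and> (\<forall>i j. \<bar>A $ i $ j\<bar> \<le> r) \<and> cayley A ** Q = (H :: ('k::{finite,wellorder}) sq_matrix)"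
    and pd: "pos_def (sym_of w)"
  shows "w \<in> (\<Union>Q\<in>F. spectral_map Q ` spectral_patch r) \<union>
    (\<Union>Q\<in>F. spectral_map Q ` {v. \<exists>i j. i < j \<and> diag_of v $ i = diag_of v $ j})"
proof -
  obtain H d where H: "orthogonal_matrix H" and w: "sym_of w = transpose H ** diag_mat d ** H"
    and d: "\<And>i j. i < j \<Longrightarrow> d $ j \<le> d $ i" and dpos: "\<And>i. 0 < d $ i"
    using ex_pos_def_diagonalization[OF pd] by metis
  obtain Q A where Q: "Q \<in> F" and A: "transpose A = - A" "\<And>i j. \<bar>A $ i $ j\<bar> \<le> r" "cayley A ** Q = H"
    using net[OF H] by blast
  define v where "v = (\<chi> p. if lo p = hi p then d $ lo p else A $ lo p $ hi p)"
  have v: "skew_of v = A" "diag_of v = d"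
    unfolding v_def by (rule skew_of_offdiag[OF A(1)]) (simp add: diag_of_def vec_eq_iff)
  have "spectral_map Q v = upper_of (sym_of w)" by (simp add: spectral_map_def frame_def v A(3) w)
  then have wv: "w = spectral_map Q v" by simp
  show ?thesis
  proof (cases "\<exists>i j. i < j \<and> d $ i = d $ j")
    case True
    then have "v \<in> {v. \<exists>i j. i < j \<and> diag_of v $ i = diag_of v $ j}" using v by simp
    then show ?thesis using Q unfolding wv by blast
  next
    case False
    then have "ordered_spectrum d"
      unfolding ordered_spectrum_def using d dpos by (metis order_le_neq_trans)
    moreover have "\<bar>v $ p\<bar> \<le> r" if "lo p \<noteq> hi p" for p using that A(2) by (simp add: v_def)
    ultimately have "v \<in> spectral_patch r" using v by (simp add: spectral_patch_def)
    then show ?thesis using Q unfolding wv by blast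
  qed
qed

lemma negligible_spectral_map_repeated:
  assumes "finite F"
  shows "negligible (\<Union>Q\<in>F. spectral_map Q ` {v. \<exists>i j. i < j \<and> diag_of v $ i = diag_of v $ j})"
proof (rule negligible_Union)
  fix T assume "T \<in> (\<lambda>Q. spectral_map Q ` {v. \<exists>i j. i < j \<and> diag_of v $ i = diag_of v $ j}) ` F"
  then obtain Q where T: "T = spectral_map Q ` {v. \<exists>i j. i < j \<and> diag_of v $ i = diag_of v $ j}" by auto
  show "negligible T"
    unfolding T by (intro negligible_differentiable_image_negligible negligible_repeated_diag
        spectral_map_differentiable_on) auto
qed (use assms in auto)

section \<open>Integrating out the location parameters\<close>

lemma sqrt_prod_nonneg: "(\<And>i. i \<in> A \<Longrightarrow> 0 \<le> f i) \<Longrightarrow> sqrt (\<Prod>i\<in>A. f i) = (\<Prod>i\<in>A. sqrt (f i))"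
  by (induction A rule: infinite_finite_induct) (auto simp: real_sqrt_mult)

lemma det_diag_mat: "det (diag_mat d) = (\<Prod>i\<in>UNIV. d $ i)"
  by (subst det_diagonal) (auto simp: diag_mat_def)

lemma det_orthogonal_conj:
  fixes H :: "real^'n^'n"
  assumes "orthogonal_matrix H"
  shows "det (transpose H ** M ** H) = det M"
  using det_orthogonal_matrix[OF assms] by (auto simp: det_mul det_transpose)

text \<open>In coordinates rotated by \<open>H\<close> the quadratic form is a sum and the
  determinant a product over the eigenvalues, so the components are independent with variances
  \<open>d $ j\<close>.\<close>

lemma mvn_density_diagonalized:
  fixes H :: "real^'n^'n"
  assumes H: "orthogonal_matrix H" and d: "\<And>i. 0 < d $ i"
  shows "mvn_density \<mu> (transpose H ** diag_mat d ** H) y =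
    (\<Prod>j\<in>UNIV. normal_density ((H *v \<mu>) $ j) (sqrt (d $ j)) ((H *v y) $ j))"
proof -
  have HH: "H ** transpose H = mat 1" "transpose H ** H = mat 1" using H
    by (auto simp: orthogonal_matrix_def)
  define e where "e = (\<chi> j. 1 / d $ j)"
  have de: "diag_mat d ** diag_mat e = mat 1"
    unfolding vec_eq_iff diag_mat_mult
    using d by (auto simp: diag_mat_def mat_def e_def less_imp_neq[THEN not_sym])
  have "(transpose H ** diag_mat d ** H) ** (transpose H ** diag_mat e ** H) =
     transpose H ** diag_mat d ** (H ** transpose H) ** diag_mat e ** H"
    by (simp only: matrix_mul_assoc)
  also have "\<dots> = transpose H ** (diag_mat d ** diag_mat e) ** H"
    by (simp add: HH matrix_mul_assoc)
  also have "\<dots> = mat 1" by (simp add: de HH)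
  finally have inv: "matrix_inv (transpose H ** diag_mat d ** H) = transpose H ** diag_mat e ** H"
    by (rule matrix_inv_unique)
  define z where "z = H *v y - H *v \<mu>"
  have z: "H *v (y - \<mu>) = z" by (simp add: z_def matrix_vector_mult_diff_distrib)
  have "(y - \<mu>) \<bullet> (matrix_inv (transpose H ** diag_mat d ** H) *v (y - \<mu>)) =
    (y - \<mu>) \<bullet> (transpose H *v (diag_mat e *v (H *v (y - \<mu>))))"
    by (simp add: inv matrix_vector_mul_assoc matrix_mul_assoc del: transpose_matrix_vector)
  also have "\<dots> = (diag_mat e *v z) \<bullet> z"
    unfolding inner_transpose_mult z ..
  also have "\<dots> = (\<Sum>j\<in>UNIV. (z $ j)\<^sup>2 / d $ j)"
    by (simp add: inner_vec_def matrix_vector_mult_def diag_mat_def power2_eq_square if_distrib[of "\<lambda>x. x * _"]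
        e_def cong: if_cong)
  finally have quad: "(y - \<mu>) \<bullet> (matrix_inv (transpose H ** diag_mat d ** H) *v (y - \<mu>)) =
    (\<Sum>j\<in>UNIV. (z $ j)\<^sup>2 / d $ j)" .
  have "(\<Prod>j\<in>UNIV. normal_density ((H *v \<mu>) $ j) (sqrt (d $ j)) ((H *v y) $ j)) =
    (\<Prod>j\<in>UNIV. 1 / sqrt (2 * pi * d $ j)) * (\<Prod>j\<in>UNIV. exp (- (1/2) * ((z $ j)\<^sup>2 / d $ j)))"
    unfolding prod.distrib[symmetric]
    by (intro prod.cong) (simp_all add: normal_density_def z_def less_imp_le[OF d])
  also have "(\<Prod>j\<in>UNIV. 1 / sqrt (2 * pi * d $ j)) = 1 / sqrt ((2 * pi) ^ CARD('n) * (\<Prod>j\<in>UNIV. d $ j))"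
    using d by (subst prod_dividef) (simp add: sqrt_prod_nonneg[symmetric] less_imp_le[OF d] prod.distrib)
  also have "(\<Prod>j\<in>UNIV. exp (- (1/2) * ((z $ j)\<^sup>2 / d $ j))) = exp (- (1/2) *
      (\<Sum>j\<in>UNIV. (z $ j)\<^sup>2 / d $ j))"
    by (simp only: exp_sum[OF finite, symmetric] sum_distrib_left)
  finally show ?thesis
    unfolding mvn_density_def quad by (simp add: det_orthogonal_conj[OF H] det_diag_mat)
qed

lemma mvn_density_identity:
  fixes H :: "real^'n^'n"
  assumes H: "orthogonal_matrix H"
  shows "mvn_density \<mu> (mat 1) y = (\<Prod>j\<in>UNIV. normal_density ((H *v \<mu>) $ j) 1 ((H *v y) $ j))"
proof -
  have "diag_mat (\<chi> j. 1) = (mat 1 :: real^'n^'n)" by (simp add: diag_mat_def mat_def vec_eq_iff)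
  then have "transpose H ** diag_mat (\<chi> j. 1) ** H = mat 1" using H by (simp add: orthogonal_matrix_def)
  then show ?thesis using mvn_density_diagonalized[OF H, of "\<chi> j. 1" \<mu> y] by simp
qed

lemma normal_density_shift: "normal_density \<mu> \<sigma> x = normal_density 0 \<sigma> (x - \<mu>)"
  by (simp add: normal_density_def)

lemma normal_density_swap: "normal_density \<mu> \<sigma> x = normal_density x \<sigma> \<mu>"
  by (simp add: normal_density_def power2_commute)

lemma normal_density_convolution:
  assumes "0 < \<sigma>" "0 < \<tau>"
  shows "(\<integral>\<^sup>+ s. ennreal (normal_density s \<sigma> y * normal_density b \<tau> s) \<partial>lborel) =
      normal_density b (sqrt (\<sigma>\<^sup>2 + \<tau>\<^sup>2)) y"
proof -
  have "(\<integral>\<^sup>+ s. ennreal (normal_density s \<sigma> y * normal_density b \<tau> s) \<partial>lborel) =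
    (\<integral>\<^sup>+ s. ennreal (normal_density 0 \<sigma> (y - s) * normal_density 0 \<tau> (s - b)) \<partial>lborel)"
    by (simp add: normal_density_def)
  also have "\<dots> = (\<integral>\<^sup>+ s. ennreal (normal_density 0 \<sigma> (y - b - s) * normal_density 0 \<tau> s) \<partial>lborel)"
    by (subst nn_integral_real_affine[of _ 1 b]) (simp_all add: algebra_simps)
  also have "\<dots> = normal_density 0 (sqrt (\<sigma>\<^sup>2 + \<tau>\<^sup>2)) (y - b)"
    using fun_cong[OF conv_normal_density_zero_mean[OF assms], of "y - b"] .
  finally show ?thesis by (simp add: normal_density_shift[of b])
qed

text \<open>Mean and argument of a normal density may be exchanged, so one factor integrates to 1 in
  \<gamma>; the other m - 1 are at most 1/\<sigma>. The exponent is m - 1 rather than m because the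
  flat prior on \<beta> uses up one observation.\<close>

lemma nn_integral_prod_normal_density_le:
  fixes y :: "'m::finite \<Rightarrow> real"
  assumes \<sigma>: "1 \<le> \<sigma>"
  shows "(\<integral>\<^sup>+ \<gamma>. ennreal (\<Prod>i\<in>UNIV. normal_density \<gamma> \<sigma> (y i)) \<partial>lborel) \<le> ennreal (1 / \<sigma> ^ (CARD('m) - 1))"
proof -
  fix i0 :: 'm
  have le: "normal_density \<gamma> \<sigma> z \<le> 1 / \<sigma>" for \<gamma> z
  proof -
    have "\<sigma> \<le> sqrt (2 * pi * \<sigma>\<^sup>2)"
      using \<sigma> pi_gt3 by (intro real_le_rsqrt) auto
    then have "1 / sqrt (2 * pi * \<sigma>\<^sup>2) * exp (- (z - \<gamma>)\<^sup>2 / (2 * \<sigma>\<^sup>2)) \<le> 1 / \<sigma> * 1"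
      using \<sigma> by (intro mult_mono divide_left_mono) auto
    then show ?thesis by (simp add: normal_density_def)
  qed
  have "(\<Prod>i\<in>UNIV. normal_density \<gamma> \<sigma> (y i)) \<le> 1 / \<sigma> ^ (CARD('m) - 1) * normal_density (y i0) \<sigma> \<gamma>" for \<gamma>
  proof -
    have "(\<Prod>i\<in>UNIV. normal_density \<gamma> \<sigma> (y i)) = normal_density \<gamma> \<sigma> (y i0) *
        (\<Prod>i\<in>UNIV - {i0}. normal_density \<gamma> \<sigma> (y i))"
      by (simp add: prod.remove[of UNIV i0])
    also have "\<dots> \<le> normal_density \<gamma> \<sigma> (y i0) * (\<Prod>i\<in>UNIV - {i0}. 1 / \<sigma>)"
      by (intro mult_left_mono prod_mono) (auto simp: le)
    finally show ?thesis by (simp add: normal_density_swap[of \<gamma>] card_Diff_singleton power_one_over)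
  qed
  then have "(\<integral>\<^sup>+ \<gamma>. ennreal (\<Prod>i\<in>UNIV. normal_density \<gamma> \<sigma> (y i)) \<partial>lborel) \<le>
    (\<integral>\<^sup>+ \<gamma>. ennreal (1 / \<sigma> ^ (CARD('m) - 1)) * ennreal (normal_density (y i0) \<sigma> \<gamma>) \<partial>lborel)"
    using \<sigma> by (intro nn_integral_mono) (simp add: ennreal_mult[symmetric] ennreal_leI)
  also have "\<dots> = ennreal (1 / \<sigma> ^ (CARD('m) - 1)) * (\<integral>\<^sup>+ \<gamma>. ennreal (normal_density (y i0) \<sigma> \<gamma>) \<partial>lborel)"
    by (rule nn_integral_cmult) simp
  also have "(\<integral>\<^sup>+ \<gamma>. ennreal (normal_density (y i0) \<sigma> \<gamma>) \<partial>lborel) = 1"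
    using \<sigma> by (subst nn_integral_eq_integral) auto
  finally show ?thesis by simp
qed

text \<open>For |\<gamma>| <= \<sigma> each exponent (y - \<gamma>)^2 / (2 \<sigma>^2) is at most
  R^2 + 1, so all m factors are at least of order 1/\<sigma>. The length 2 \<sigma> of that interval
  gives one power back, and the upper bound is matched.\<close>

lemma nn_integral_prod_normal_density_ge:
  fixes y :: "'m::finite \<Rightarrow> real"
  assumes \<sigma>: "1 \<le> \<sigma>" and R: "\<And>i. \<bar>y i\<bar> \<le> R"
  shows "(\<integral>\<^sup>+ \<gamma>. ennreal (\<Prod>i\<in>UNIV. normal_density \<gamma> \<sigma> (y i)) \<partial>lborel) \<ge>
    ennreal ((exp (- R\<^sup>2 - 1) / sqrt (2 * pi)) ^ CARD('m) / \<sigma> ^ (CARD('m) - 1))"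
proof -
  define a where "a = exp (- R\<^sup>2 - 1) / sqrt (2 * pi)"
  have a: "a > 0" by (simp add: a_def)
  have ge: "a / \<sigma> \<le> normal_density \<gamma> \<sigma> (y i)" if "\<bar>\<gamma>\<bar> \<le> \<sigma>" for \<gamma> i
  proof -
    have "(y i - \<gamma>)\<^sup>2 \<le> 2 * (y i)\<^sup>2 + 2 * \<gamma>\<^sup>2"
      using zero_le_power2[of "y i + \<gamma>"] by (simp add: power2_eq_square algebra_simps)
    also have "(y i)\<^sup>2 \<le> R\<^sup>2" using R[of i] by (simp add: abs_le_square_iff[symmetric])
    also have "R\<^sup>2 \<le> R\<^sup>2 * \<sigma>\<^sup>2" using \<sigma> by (simp add: mult_le_cancel_left1)
    also have "\<gamma>\<^sup>2 \<le> \<sigma>\<^sup>2" using that \<sigma> by (simp add: abs_le_square_iff[symmetric])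
    finally have "(y i - \<gamma>)\<^sup>2 \<le> (R\<^sup>2 + 1) * (2 * \<sigma>\<^sup>2)" by (simp add: algebra_simps)
    then have "(y i - \<gamma>)\<^sup>2 / (2 * \<sigma>\<^sup>2) \<le> R\<^sup>2 + 1" using \<sigma> by (subst pos_divide_le_eq) auto
    then have "exp (- R\<^sup>2 - 1) \<le> exp (- (y i - \<gamma>)\<^sup>2 / (2 * \<sigma>\<^sup>2))" by simp
    then have "1 / (sqrt (2 * pi) * \<sigma>) * exp (- R\<^sup>2 - 1) \<le> 1 / (sqrt (2 * pi) * \<sigma>) *
        exp (- (y i - \<gamma>)\<^sup>2 / (2 * \<sigma>\<^sup>2))"
      using \<sigma> by (intro mult_left_mono) auto
    then show ?thesis using \<sigma> by (simp add: normal_density_def a_def real_sqrt_mult mult_ac)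
  qed
  have "ennreal (a ^ CARD('m) / \<sigma> ^ (CARD('m) - 1)) \<le> ennreal ((a / \<sigma>) ^ CARD('m) * (2 * \<sigma>))"
  proof (rule ennreal_leI)
    have "\<sigma> ^ CARD('m) = \<sigma> * \<sigma> ^ (CARD('m) - 1)"
      by (metis Suc_pred' power_Suc zero_less_card_finite)
    then have "(a / \<sigma>) ^ CARD('m) * (2 * \<sigma>) = 2 * (a ^ CARD('m) / \<sigma> ^ (CARD('m) - 1))"
      using \<sigma> by (simp add: power_divide)
    moreover have "0 \<le> a ^ CARD('m) / \<sigma> ^ (CARD('m) - 1)" using a \<sigma> by simp
    ultimately show "a ^ CARD('m) / \<sigma> ^ (CARD('m) - 1) \<le> (a / \<sigma>) ^ CARD('m) * (2 * \<sigma>)" by linarith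
  qed
  also have "\<dots> = (\<integral>\<^sup>+ \<gamma>. ennreal ((a / \<sigma>) ^ CARD('m)) * indicator {-\<sigma>..\<sigma>} \<gamma> \<partial>lborel)"
    using \<sigma> a by (subst nn_integral_cmult_indicator) (auto simp: ennreal_mult)
  also have "\<dots> \<le> (\<integral>\<^sup>+ \<gamma>. ennreal (\<Prod>i\<in>UNIV. normal_density \<gamma> \<sigma> (y i)) \<partial>lborel)"
  proof (intro nn_integral_mono)
    fix \<gamma>
    have "(\<Prod>i\<in>(UNIV::'m set). a / \<sigma>) \<le> (\<Prod>i\<in>UNIV. normal_density \<gamma> \<sigma> (y i))" if "\<bar>\<gamma>\<bar> \<le> \<sigma>"
      using a \<sigma> by (intro prod_mono) (auto simp: ge[OF that])
    then show "ennreal ((a / \<sigma>) ^ CARD('m)) * indicator {-\<sigma>..\<sigma>} \<gamma> \<le>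
        ennreal (\<Prod>i\<in>UNIV. normal_density \<gamma> \<sigma> (y i))"
      by (auto simp: indicator_def abs_le_iff intro!: ennreal_leI)
  qed
  finally show ?thesis unfolding a_def .
qed

lemma mat_1_add_diagonalized:
  fixes H :: "real^'n^'n"
  assumes H: "orthogonal_matrix H"
  shows "mat 1 + transpose H ** diag_mat d ** H = transpose H ** diag_mat (\<chi> i. 1 + d $ i) ** H"
proof -
  have "diag_mat (\<chi> i. 1 + d $ i) = mat 1 + diag_mat d"
    by (simp add: vec_eq_iff diag_mat_def mat_def)
  then show ?thesis
    using H by (simp add: matrix_mult.add_left matrix_mult.add_right orthogonal_matrix)
qed

lemma det_mat_1_add_diagonalized:
  fixes H :: "real^'n^'n"
  assumes "orthogonal_matrix H"
  shows "det (mat 1 + transpose H ** diag_mat d ** H) = (\<Prod>i\<in>UNIV. 1 + d $ i)"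
  by (simp add: mat_1_add_diagonalized[OF assms] det_orthogonal_conj[OF assms] det_diag_mat)

text \<open>In the eigenbasis the model splits into k one-dimensional ones. In coordinate j the
  \<theta> integral is a convolution of variances 1 and \<open>d $ j\<close>; after \<beta> is
  rotated, the mean of that coordinate is a free variable \<gamma>.\<close>

lemma nn_integral_densities_diagonalized:
  fixes H :: "('k::{finite,wellorder}) sq_matrix" and x :: "real^'k::{finite,wellorder}^'m"
  assumes H: "orthogonal_matrix H" and d: "\<And>i. 0 < d $ i"
  defines "V \<equiv> transpose H ** diag_mat d ** H"
  shows "(\<integral>\<^sup>+ \<beta>. \<integral>\<^sup>+ \<theta>. ennreal (sampling_density \<theta> x * theta_density \<beta> V \<theta>) \<partial>lborel \<partial>lborel) =
    (\<Prod>j\<in>UNIV. \<integral>\<^sup>+ \<gamma>. ennreal (\<Prod>i\<in>UNIV. normal_density \<gamma> (sqrt (1 + d $ j)) ((H *v x $ i) $ j)) \<partial>lborel)"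
proof -
  note I = mvn_density_identity[OF H] and D = mvn_density_diagonalized[OF H d, folded V_def]
  have Hm [measurable]: "(*v) H \<in> borel_measurable borel"
    by (intro borel_measurable_continuous_onI linear_continuous_on linear_conv_bounded_linear[THEN iffD1]) simp
  have nd [measurable]: "(\<lambda>\<mu>. normal_density \<mu> \<sigma> y) \<in> borel_measurable borel" for \<sigma> y
    unfolding normal_density_swap[of _ \<sigma> y] by simp
  have inner: "(\<integral>\<^sup>+ \<theta>. ennreal (sampling_density \<theta> x * theta_density \<beta> V \<theta>) \<partial>lborel) =
    (\<Prod>j\<in>UNIV. ennreal (\<Prod>i\<in>UNIV. normal_density ((H *v \<beta>) $ j) (sqrt (1 + d $ j)) ((H *v x $ i) $ j)))" for \<beta>
  proof -
    have "(\<integral>\<^sup>+ \<theta>. ennreal (sampling_density \<theta> x * theta_density \<beta> V \<theta>) \<partial>lborel) =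
      (\<integral>\<^sup>+ \<theta>. (\<Prod>i\<in>UNIV. ennreal (mvn_density (\<theta> $ i) (mat 1) (x $ i) * mvn_density \<beta> V (\<theta> $ i))) \<partial>lborel)"
      unfolding sampling_density_def theta_density_def prod.distrib[symmetric]
      by (subst prod_ennreal) (auto simp: I D intro!: mult_nonneg_nonneg prod_nonneg)
    also have "\<dots> = (\<Prod>i\<in>UNIV. \<integral>\<^sup>+ t. ennreal (mvn_density t (mat 1) (x $ i) * mvn_density \<beta> V t) \<partial>lborel)"
      by (rule nn_integral_lborel_vec_prod) (unfold I D, measurable)
    also have "\<dots> = (\<Prod>i\<in>UNIV. \<Prod>j\<in>UNIV. ennreal (normal_density ((H *v \<beta>) $ j) (sqrt (1 +
        d $ j)) ((H *v x $ i) $ j)))"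
    proof (rule prod.cong[OF refl])
      fix i
      let ?f = "\<lambda>j s. ennreal (normal_density s 1 ((H *v x $ i) $ j) *
          normal_density ((H *v \<beta>) $ j) (sqrt (d $ j)) s)"
      have "(\<integral>\<^sup>+ t. ennreal (mvn_density t (mat 1) (x $ i) * mvn_density \<beta> V t) \<partial>lborel) =
        (\<integral>\<^sup>+ t. (\<Prod>j\<in>UNIV. ?f j ((H *v t) $ j)) \<partial>lborel)"
        unfolding I D prod.distrib[symmetric] by (subst prod_ennreal) auto
      also have "\<dots> = (\<integral>\<^sup>+ s. (\<Prod>j\<in>UNIV. ?f j (s $ j)) \<partial>lborel)"
        by (rule nn_integral_orthogonal_image[OF H]) measurable
      also have "\<dots> = (\<Prod>j\<in>UNIV. \<integral>\<^sup>+ s. ?f j s \<partial>lborel)"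
        by (rule nn_integral_lborel_vec_prod) measurable
      also have "\<dots> = (\<Prod>j\<in>UNIV. ennreal (normal_density ((H *v \<beta>) $ j) (sqrt (1 +
          d $ j)) ((H *v x $ i) $ j)))"
        using d by (intro prod.cong refl) (subst normal_density_convolution, auto simp: less_imp_le)
      finally show "(\<integral>\<^sup>+ t. ennreal (mvn_density t (mat 1) (x $ i) * mvn_density \<beta> V t) \<partial>lborel) = \<dots>" .
    qed
    also have "\<dots> = (\<Prod>j\<in>UNIV. \<Prod>i\<in>UNIV. ennreal (normal_density ((H *v \<beta>) $ j) (sqrt (1 +
        d $ j)) ((H *v x $ i) $ j)))"
      by (rule prod.swap)
    finally show ?thesis by (simp add: prod_ennreal)
  qed
  have "(\<integral>\<^sup>+ \<beta>. \<integral>\<^sup>+ \<theta>. ennreal (sampling_density \<theta> x * theta_density \<beta> V \<theta>) \<partial>lborel \<partial>lborel) =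
    (\<integral>\<^sup>+ \<gamma>. (\<Prod>j\<in>UNIV. ennreal (\<Prod>i\<in>UNIV. normal_density (\<gamma> $ j) (sqrt (1 + d $ j)) ((H *v x $ i) $ j))) \<partial>lborel)"
    unfolding inner by (rule nn_integral_orthogonal_image[OF H]) measurable
  also have "\<dots> = (\<Prod>j\<in>UNIV. \<integral>\<^sup>+ \<gamma>. ennreal (\<Prod>i\<in>UNIV. normal_density \<gamma> (sqrt (1 +
      d $ j)) ((H *v x $ i) $ j)) \<partial>lborel)"
    by (rule nn_integral_lborel_vec_prod) measurable
  finally show ?thesis .
qed

text \<open>The standard deviations sqrt(1 + d_j) multiply to a power of det(I + V). The lower
  constant does not depend on \<open>V\<close>, since |(H x_i)_j| <= |x| for every orthogonal
  H.\<close>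

lemma nn_integral_densities_bounds:
  fixes x :: "real^'k::{finite,wellorder}^'m" and V :: "('k::{finite,wellorder}) sq_matrix"
  assumes V: "pos_def V"
  defines "J \<equiv> (\<integral>\<^sup>+ \<beta>. \<integral>\<^sup>+ \<theta>. ennreal (sampling_density \<theta> x * theta_density \<beta> V \<theta>) \<partial>lborel \<partial>lborel)"
    and "w \<equiv> det (mat 1 + V) powr - ((real CARD('m) - 1) / 2)"
  shows "J \<le> ennreal w"
    and "ennreal (((exp (- (norm x)\<^sup>2 - 1) / sqrt (2 * pi)) ^ CARD('m)) ^ CARD('k) * w) \<le> J"
proof -
  obtain H d where H: "orthogonal_matrix H" and VH: "V = transpose H ** diag_mat d ** H"
      and d: "\<And>i. 0 < d $ i"
    using ex_pos_def_diagonalization[OF V] by metis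
  define \<sigma> where "\<sigma> j = sqrt (1 + d $ j)" for j
  have \<sigma>: "1 \<le> \<sigma> j" for j using d[of j] by (simp add: \<sigma>_def)
  have m: "CARD('m) \<ge> 1" by (simp add: Suc_leI)
  have "1 / \<sigma> j ^ (CARD('m) - 1) = (1 + d $ j) powr - ((real CARD('m) - 1) / 2)" for j
  proof -
    have "\<sigma> j ^ (CARD('m) - 1) = \<sigma> j powr real (CARD('m) - 1)"
      using \<sigma>[of j] by (intro powr_realpow[symmetric]) simp
    also have "\<dots> = ((1 + d $ j) powr (1/2)) powr real (CARD('m) - 1)"
      unfolding \<sigma>_def using d[of j] by (subst powr_half_sqrt) simp_all
    also have "\<dots> = (1 + d $ j) powr ((real CARD('m) - 1) / 2)"
      unfolding powr_powr using m by (simp add: of_nat_diff)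
    finally show ?thesis by (simp only: powr_minus_divide)
  qed
  moreover have "w = (\<Prod>j\<in>UNIV. (1 + d $ j) powr - ((real CARD('m) - 1) / 2))"
    unfolding w_def VH det_mat_1_add_diagonalized[OF H]
    by (rule prod_powr_distrib)
  ultimately have w: "w = (\<Prod>j\<in>UNIV. 1 / \<sigma> j ^ (CARD('m) - 1))" by simp
  have J: "J = (\<Prod>j\<in>UNIV. \<integral>\<^sup>+ \<gamma>. ennreal (\<Prod>i\<in>UNIV. normal_density \<gamma> (\<sigma> j) ((H *v x $ i) $ j)) \<partial>lborel)"
    unfolding J_def VH \<sigma>_def by (rule nn_integral_densities_diagonalized[OF H d])
  have "J \<le> (\<Prod>j\<in>UNIV. ennreal (1 / \<sigma> j ^ (CARD('m) - 1)))"
    unfolding J by (intro prod_mono_ennreal nn_integral_prod_normal_density_le \<sigma>)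
  also have "\<dots> = ennreal w"
    unfolding w by (intro prod_ennreal) (simp add: order_trans[OF zero_le_one \<sigma>])
  finally show "J \<le> ennreal w" .
  let ?a = "(exp (- (norm x)\<^sup>2 - 1) / sqrt (2 * pi)) ^ CARD('m)"
  have y: "\<bar>(H *v x $ i) $ j\<bar> \<le> norm x" for i j
  proof -
    have "orthogonal_transformation ((*v) H)"
      using H by (simp add: orthogonal_transformation_matrix)
    then have "norm (H *v x $ i) = norm (x $ i)" by (simp add: orthogonal_transformation_norm)
    then show ?thesis
      using component_le_norm_cart[of "H *v x $ i" j] Finite_Cartesian_Product.norm_nth_le[of x i]
        by linarith
  qed
  have "ennreal (?a ^ CARD('k) * w) = ennreal (\<Prod>j\<in>UNIV. ?a / \<sigma> j ^ (CARD('m) - 1))"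
    unfolding w by (simp add: prod_dividef)
  also have "\<dots> = (\<Prod>j\<in>UNIV. ennreal (?a / \<sigma> j ^ (CARD('m) - 1)))"
    by (intro prod_ennreal[symmetric]) (simp add: order_trans[OF zero_le_one \<sigma>])
  also have "\<dots> \<le> J"
    unfolding J by (intro prod_mono_ennreal nn_integral_prod_normal_density_ge \<sigma> y)
  finally show "ennreal (?a ^ CARD('k) * w) \<le> J" .
qed

section \<open>The measure on symmetric matrices and joint measurability\<close>

lemma bij_betw_Rep_upper: "bij_betw Rep_upper UNIV {(i, j). i \<le> j}"
  unfolding bij_betw_def using type_definition.Rep_range[OF type_definition_upper]
  by (simp add: inj_on_def Rep_upper_inject)

lemma measurable_sym_of [measurable]: "sym_of \<in> borel_measurable borel"
  by (intro borel_measurable_continuous_onI linear_continuous_on linear_conv_bounded_linear[THEN iffD1] linear_sym_of)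

text \<open>Moves the integral over V to Lebesgue measure on the space where the spectral map
  acts.\<close>

lemma sym_lborel_eq:
  "(sym_lborel :: ('k::{finite,wellorder}) sq_matrix measure) = distr lborel borel sym_of"
proof -
  have eq: "(sym_matrix_of :: ('k::{finite,wellorder} \<times> 'k \<Rightarrow> real) \<Rightarrow> _) =
      sym_of \<circ> (\<lambda>f. \<chi> p. f (Rep_upper p))"
    by (auto simp: fun_eq_iff sym_matrix_of_def sym_of_def vec_eq_iff uix_def Abs_upper_inverse min_le_iff_disj)
  have "range (Rep_upper :: 'k upper \<Rightarrow> _) \<subseteq> {(i, j). i \<le> j}"
    by (rule equalityD1[OF bij_betw_imp_surj_on[OF bij_betw_Rep_upper]])
  then have "(sym_lborel :: ('k::{finite,wellorder}) sq_matrix measure) =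
      distr (distr (\<Pi>\<^sub>M p\<in>{(i, j). i \<le> j}. lborel) borel (\<lambda>f. \<chi> p. f (Rep_upper p))) borel sym_of"
    unfolding sym_lborel_def eq
      by (intro distr_distr[symmetric] measurable_sym_of measurable_vec_nth_PiM)
  then show ?thesis by (simp add: distr_PiM_lborel_vec[OF bij_betw_Rep_upper])
qed

text \<open>Positivity is an uncountable family of strict inequalities. By compactness of the unit
  sphere it amounts to a uniform lower bound 1/(n + 1) there for some n, hence to a countable union
  of closed conditions.\<close>

lemma borel_pos_def: "{V :: real^'k^'k. pos_def V} \<in> sets borel"
proof -
  have *: "(\<forall>x. x \<noteq> 0 \<longrightarrow> x \<bullet> (V *v x) > 0) \<longleftrightarrow> (\<exists>n. \<forall>x\<in>sphere 0 1. 1 / real (Suc n) \<le> x \<bullet> (V *v x))"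
      for V :: "real^'k^'k"
  proof
    assume pos: "\<forall>x. x \<noteq> 0 \<longrightarrow> x \<bullet> (V *v x) > 0"
    have "continuous_on (sphere 0 1) (\<lambda>x. x \<bullet> (V *v x))"
      unfolding matrix_vector_mult_def by (intro continuous_intros)
    moreover have "(axis undefined 1 :: real^'k) \<in> sphere 0 (1::real)" by simp
    ultimately obtain z where z: "z \<in> sphere 0 1" "\<And>x. x \<in> sphere 0 1 \<Longrightarrow> z \<bullet> (V *v z) \<le> x \<bullet> (V *v x)"
      using continuous_attains_inf[of "sphere 0 1" "\<lambda>x. x \<bullet> (V *v x)"]
        by (metis compact_sphere empty_iff)
    then have "z \<noteq> 0" by auto
    then have "0 < z \<bullet> (V *v z)" using pos by simp
    then obtain n where "1 / real (Suc n) < z \<bullet> (V *v z)"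
      using reals_Archimedean[of "z \<bullet> (V *v z)"] by (auto simp: inverse_eq_divide)
    then show "\<exists>n. \<forall>x\<in>sphere 0 1. 1 / real (Suc n) \<le> x \<bullet> (V *v x)"
      using z(2) by (intro exI[of _ n]) force
  next
    assume "\<exists>n. \<forall>x\<in>sphere 0 1. 1 / real (Suc n) \<le> x \<bullet> (V *v x)"
    then obtain n where n: "\<And>x. x \<in> sphere 0 1 \<Longrightarrow> 1 / real (Suc n) \<le> x \<bullet> (V *v x)" by blast
    show "\<forall>x. x \<noteq> 0 \<longrightarrow> x \<bullet> (V *v x) > 0"
    proof (intro allI impI)
      fix x :: "real^'k" assume x: "x \<noteq> 0"
      have "0 < 1 / real (Suc n)" by simp
      also have "\<dots> \<le> (x /\<^sub>R norm x) \<bullet> (V *v (x /\<^sub>R norm x))" using x by (intro n) simp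
      also have "\<dots> = (inverse (norm x))\<^sup>2 * (x \<bullet> (V *v x))"
        by (simp add: matrix_vector_mult_scaleR power2_eq_square)
      finally show "x \<bullet> (V *v x) > 0" using x by (simp add: zero_less_mult_iff)
    qed
  qed
  have "{V :: real^'k^'k. pos_def V} =
    {V. transpose V = V} \<inter> (\<Union>n. \<Inter>x\<in>sphere 0 1. {V. 1 / real (Suc n) \<le> x \<bullet> (V *v x)})"
    by (auto simp: pos_def_def *)
  moreover have "closed {V :: real^'k^'k. transpose V = V}"
    unfolding transpose_def vec_eq_iff vec_lambda_beta
      by (intro closed_Collect_all closed_Collect_eq continuous_intros)
  moreover have "closed (\<Inter>x\<in>sphere 0 1. {V :: real^'k^'k. 1 / real (Suc n) \<le> x \<bullet> (V *v x)})" for n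
    unfolding matrix_vector_mult_def by (intro closed_INT ballI closed_Collect_le continuous_intros)
  ultimately show ?thesis by (auto intro!: sets.Int sets.countable_UN borel_closed)
qed

lemma measurable_vec_nth' [measurable (raw)]:
  "f \<in> borel_measurable M \<Longrightarrow> (\<lambda>z. (f z :: 'a::euclidean_space^'n) $ i) \<in> borel_measurable M"
  by (rule measurable_compose[OF _ measurable_vec_nth_lborel])

lemma measurable_det [measurable (raw)]:
  fixes A :: "'z \<Rightarrow> real^'n^'n"
  assumes [measurable]: "\<And>i j. (\<lambda>z. A z $ i $ j) \<in> borel_measurable M"
  shows "(\<lambda>z. det (A z)) \<in> borel_measurable M"
  unfolding det_def by measurable

text \<open>By Cramer's rule this is the normal density wherever the covariance matrix is invertible. Unlike
  \<open>matrix_inv\<close> it is a measurable expression on all matrices.\<close>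

definition cramer_density :: "real^'k^'k \<Rightarrow> real^'k \<Rightarrow> real" where
  "cramer_density V y =
     exp (- (1/2) * (\<Sum>k\<in>UNIV. y $ k * (det (\<chi> i j. if j = k then y $ i else V $ i $ j) / det V))) /
       sqrt ((2 * pi) ^ CARD('k) * det V)"

lemma mvn_density_eq_cramer:
  assumes "det V \<noteq> 0"
  shows "mvn_density \<mu> V y = cramer_density V (y - \<mu>)"
proof -
  obtain B where "V ** B = mat 1" using assms invertible_det_nz[of V] by (auto simp: invertible_def)
  then have "V *v (matrix_inv V *v (y - \<mu>)) = y - \<mu>"
    by (simp add: matrix_inv_unique matrix_vector_mul_assoc)
  then have "matrix_inv V *v (y - \<mu>) = (\<chi> k. det (\<chi> i j. if j =
      k then (y - \<mu>) $ i else V $ i $ j) / det V)"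
    by (simp only: cramer[OF assms])
  then show ?thesis
    by (simp add: mvn_density_def cramer_density_def inner_vec_def)
qed

lemma measurable_cramer_density [measurable (raw)]:
  fixes V :: "'z \<Rightarrow> real^'k^'k"
  assumes [measurable]: "\<And>i j. (\<lambda>z. V z $ i $ j) \<in> borel_measurable M" "y \<in> borel_measurable M"
  shows "(\<lambda>z. cramer_density (V z) (y z)) \<in> borel_measurable M"
proof -
  have [measurable]: "(\<lambda>z. det (\<chi> i j. if j = k then y z $ i else V z $ i $ j)) \<in> borel_measurable M"
      for k
    by (rule measurable_det) (unfold vec_lambda_beta, measurable)
  show ?thesis unfolding cramer_density_def by measurable
qed

lemma det_pos_def:
  fixes V :: "('k::{finite,wellorder}) sq_matrix"
  assumes "pos_def V"
  shows "0 < det V"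
proof -
  obtain H d where "orthogonal_matrix H" "V = transpose H ** diag_mat d ** H" "\<And>i. 0 < d $ i"
    using ex_pos_def_diagonalization[OF assms] by metis
  then show ?thesis by (simp add: det_orthogonal_conj det_diag_mat prod_pos)
qed

text \<open>The weight that remains of the model after integrating out \<open>\<beta>\<close> and \<open>\<theta>\<close>, up to constants.\<close>

definition reduced_density :: "nat \<Rightarrow> (real^'k^'k \<Rightarrow> real) \<Rightarrow> real^'k^'k \<Rightarrow> real" where
  "reduced_density m prior V =
     (if pos_def V then det (mat 1 + V) powr - ((real m - 1) / 2) * prior V else 0)"

lemma measurable_prior:
  assumes "prior_density prior"
  shows "(\<lambda>V :: real^'k^'k. if pos_def V then prior V else 0) \<in> borel_measurable borel"
proof -
  have "(\<lambda>V. indicator {V. pos_def V} V *\<^sub>R prior V) \<in> borel_measurable borel"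
    using assms borel_pos_def unfolding prior_density_def
    by (intro borel_measurable_restrict_space_iff[THEN iffD1]) auto
  moreover have "(\<lambda>V. indicator {V. pos_def V} V *\<^sub>R prior V) = (\<lambda>V. if pos_def V then prior V else 0)"
    by (auto simp: fun_eq_iff)
  ultimately show ?thesis by simp
qed

lemma measurable_reduced_density:
  assumes "prior_density prior"
  shows "reduced_density m prior \<in> borel_measurable borel"
proof -
  note measurable_prior[OF assms, measurable]
  have "(\<lambda>V. det (mat 1 + V) powr - ((real m - 1) / 2) *
      (if pos_def V then prior V else 0)) \<in> borel_measurable borel"
    by (measurable; simp)
  also have "(\<lambda>V. det (mat 1 + V) powr - ((real m - 1) / 2) * (if pos_def V then prior V else 0)) =
      reduced_density m prior"
    by (auto simp: fun_eq_iff reduced_density_def)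
  finally show ?thesis .
qed

lemma reduced_density_nonneg: "prior_density prior \<Longrightarrow> 0 \<le> reduced_density m prior V"
  by (simp add: reduced_density_def prior_density_def)

text \<open>Tonelli is applied to the product of \<open>L\<close> and \<open>P\<close>, where
  \<open>L\<close> is built from \<open>cramer_density\<close> and is jointly measurable everywhere.
  It agrees with the model density on positive-definite matrices and \<open>P\<close> vanishes
  elsewhere, so the original integrand can be restored after the exchanges.\<close>

lemma marginal_density_tonelli:
  fixes x :: "real^'k::{finite,wellorder}^'m" and prior :: "('k::{finite,wellorder}) sq_matrix \<Rightarrow> real"
  assumes prior: "prior_density prior"
  shows "marginal_density (\<lambda>\<beta>. 1) prior x =
    (\<integral>\<^sup>+ w. (\<integral>\<^sup>+ \<beta>. \<integral>\<^sup>+ \<theta>. ennreal (sampling_density \<theta> x * theta_density \<beta> (sym_of w) \<theta>) \<partial>lborel \<partial>lborel) *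
       ennreal (if pos_def (sym_of w) then prior (sym_of w) else 0) \<partial>lborel)"
proof -
  define P where "P V = ennreal (if pos_def V then prior V else 0)" for V
  define L where "L \<theta> \<beta> V = ennreal ((\<Prod>i\<in>UNIV. cramer_density (mat 1) (x $ i - \<theta> $ i)) *
    (\<Prod>i\<in>UNIV. cramer_density V (\<theta> $ i - \<beta>)))" for \<theta> :: "real^'k::{finite,wellorder}^'m" and \<beta> V
  have [measurable]: "P \<in> borel_measurable borel"
    unfolding P_def using measurable_prior[OF prior] by measurable
  have L_meas [measurable (raw)]: "(\<lambda>z. L (f z) (g z) (h z)) \<in> borel_measurable M"
    if [measurable]: "f \<in> borel_measurable M" "g \<in> borel_measurable M" "h \<in> borel_measurable M" for f g h
        and M :: "'z measure"
    unfolding L_def by measurable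
  define G where "G \<theta> \<beta> w = L \<theta> \<beta> (sym_of w) * P (sym_of w)" for \<theta> \<beta> w
  have G_meas [measurable (raw)]: "(\<lambda>z. G (f z) (g z) (h z)) \<in> borel_measurable M"
    if [measurable]: "f \<in> borel_measurable M" "g \<in> borel_measurable M" "h \<in> borel_measurable M" for f g h
        and M :: "'z measure"
    unfolding G_def by measurable
  have pdL: "ennreal (sampling_density \<theta> x * theta_density \<beta> V \<theta>) = L \<theta> \<beta> V" if "pos_def V" for \<theta> \<beta> V
    using det_pos_def[OF that]
      by (simp add: L_def sampling_density_def theta_density_def mvn_density_eq_cramer)
  have PL: "ennreal (sampling_density \<theta> x * theta_density \<beta> V \<theta> * 1 * prior V) *
      indicator {V. pos_def V} V =
    L \<theta> \<beta> V * P V" for \<theta> \<beta> V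
  proof (cases "pos_def V")
    case True
    then have "0 \<le> prior V" using prior by (simp add: prior_density_def)
    then have "ennreal (sampling_density \<theta> x * theta_density \<beta> V \<theta> * 1 * prior V) =
      ennreal (sampling_density \<theta> x * theta_density \<beta> V \<theta>) * ennreal (prior V)"
      by (simp add: ennreal_mult'')
    then show ?thesis using True by (simp add: pdL[OF True] P_def)
  qed (simp add: P_def)
  have sym: "(\<integral>\<^sup>+ V. L \<theta> \<beta> V * P V \<partial>sym_lborel) = (\<integral>\<^sup>+ w. G \<theta> \<beta> w \<partial>lborel)" for \<theta> \<beta>
    unfolding sym_lborel_eq G_def by (subst nn_integral_distr) measurable
  have "marginal_density (\<lambda>\<beta>. 1) prior x = (\<integral>\<^sup>+ \<theta>. \<integral>\<^sup>+ \<beta>. \<integral>\<^sup>+ w. G \<theta> \<beta> w \<partial>lborel \<partial>lborel \<partial>lborel)"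
    unfolding marginal_density_def PL sym ..
  also have "\<dots> = (\<integral>\<^sup>+ \<theta>. \<integral>\<^sup>+ w. \<integral>\<^sup>+ \<beta>. G \<theta> \<beta> w \<partial>lborel \<partial>lborel \<partial>lborel)"
    by (intro nn_integral_cong lborel_pair.Fubini') measurable
  also have "\<dots> = (\<integral>\<^sup>+ w. \<integral>\<^sup>+ \<theta>. \<integral>\<^sup>+ \<beta>. G \<theta> \<beta> w \<partial>lborel \<partial>lborel \<partial>lborel)"
    by (rule lborel_pair.Fubini') measurable
  also have "\<dots> = (\<integral>\<^sup>+ w. \<integral>\<^sup>+ \<beta>. \<integral>\<^sup>+ \<theta>. G \<theta> \<beta> w \<partial>lborel \<partial>lborel \<partial>lborel)"
    by (intro nn_integral_cong lborel_pair.Fubini') measurable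
  also have "\<dots> = (\<integral>\<^sup>+ w. (\<integral>\<^sup>+ \<beta>. \<integral>\<^sup>+ \<theta>. L \<theta> \<beta> (sym_of w) \<partial>lborel \<partial>lborel) * P (sym_of w) \<partial>lborel)"
    unfolding G_def by (subst nn_integral_multc nn_integral_multc, measurable)+
  also have "\<dots> = (\<integral>\<^sup>+ w. (\<integral>\<^sup>+ \<beta>. \<integral>\<^sup>+ \<theta>. ennreal (sampling_density \<theta> x *
      theta_density \<beta> (sym_of w) \<theta>) \<partial>lborel \<partial>lborel) *
       P (sym_of w) \<partial>lborel)"
  proof (intro nn_integral_cong)
    fix w :: "('k::{finite,wellorder}) upper_vec"
    show "(\<integral>\<^sup>+ \<beta>. \<integral>\<^sup>+ \<theta>. L \<theta> \<beta> (sym_of w) \<partial>lborel \<partial>lborel) * P (sym_of w) =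
      (\<integral>\<^sup>+ \<beta>. \<integral>\<^sup>+ \<theta>. ennreal (sampling_density \<theta> x * theta_density \<beta> (sym_of w) \<theta>) \<partial>lborel \<partial>lborel) * P (sym_of w)"
      by (cases "pos_def (sym_of w)") (simp_all add: pdL P_def)
  qed
  finally show ?thesis unfolding P_def .
qed

lemma marginal_density_bounds:
  fixes x :: "real^'k::{finite,wellorder}^'m" and prior :: "('k::{finite,wellorder}) sq_matrix \<Rightarrow> real"
  assumes prior: "prior_density prior"
  defines "I \<equiv> (\<integral>\<^sup>+ w. ennreal (reduced_density CARD('m) prior (sym_of w)) \<partial>lborel)"
  shows "marginal_density (\<lambda>\<beta>. 1) prior x \<le> I"
    and "ennreal (((exp (- (norm x)\<^sup>2 - 1) / sqrt (2 * pi)) ^ CARD('m)) ^ CARD('k)) * I \<le>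
        marginal_density (\<lambda>\<beta>. 1) prior x"
proof -
  let ?J = "\<lambda>w. (\<integral>\<^sup>+ \<beta>. \<integral>\<^sup>+ \<theta>. ennreal (sampling_density \<theta> x *
      theta_density \<beta> (sym_of w) \<theta>) \<partial>lborel \<partial>lborel)"
  let ?P = "\<lambda>w. ennreal (if pos_def (sym_of w) then prior (sym_of w) else 0)"
  let ?c = "((exp (- (norm x)\<^sup>2 - 1) / sqrt (2 * pi)) ^ CARD('m)) ^ CARD('k)"
  have r: "ennreal (reduced_density CARD('m) prior (sym_of w)) =
      ennreal (det (mat 1 + sym_of w) powr - ((real CARD('m) - 1) / 2)) * ?P w" for w
    using prior by (simp add: reduced_density_def prior_density_def ennreal_mult)
  show "marginal_density (\<lambda>\<beta>. 1) prior x \<le> I"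
    unfolding marginal_density_tonelli[OF prior] I_def
  proof (rule nn_integral_mono)
    fix w
    show "?J w * ?P w \<le> ennreal (reduced_density CARD('m) prior (sym_of w))"
      using nn_integral_densities_bounds(1)[of "sym_of w" x] unfolding r
      by (cases "pos_def (sym_of w)") (auto intro!: mult_right_mono)
  qed
  have "ennreal ?c * I = (\<integral>\<^sup>+ w. ennreal ?c *
      ennreal (reduced_density CARD('m) prior (sym_of w)) \<partial>lborel)"
    unfolding I_def using measurable_compose[OF measurable_sym_of measurable_reduced_density[OF prior]]
    by (intro nn_integral_cmult[symmetric]) measurable
  also have "\<dots> \<le> marginal_density (\<lambda>\<beta>. 1) prior x"
    unfolding marginal_density_tonelli[OF prior]
  proof (rule nn_integral_mono)
    fix w
    show "ennreal ?c * ennreal (reduced_density CARD('m) prior (sym_of w)) \<le> ?J w * ?P w"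
    proof (cases "pos_def (sym_of w)")
      case True
      have "ennreal ?c * ennreal (det (mat 1 + sym_of w) powr - ((real CARD('m) - 1) / 2)) \<le> ?J w"
        using nn_integral_densities_bounds(2)[OF True, of x]
          by (simp add: ennreal_mult del: power_mult_distrib)
      then show ?thesis unfolding r mult.assoc[symmetric] by (rule mult_right_mono) simp
    qed (simp add: reduced_density_def)
  qed
  finally show "ennreal ?c * I \<le> marginal_density (\<lambda>\<beta>. 1) prior x" .
qed

section \<open>Reduction to the eigenvalues\<close>

text \<open>No Vandermonde factor is added for the Jacobian, because \<open>prior_bound\<close>
  stands for \<open>prior_HD\<close>, which includes it. The ordering is built in to make this a
  function on the whole space.\<close>

definition eigen_density :: "nat \<Rightarrow> real \<Rightarrow> real \<Rightarrow> real \<Rightarrow> real^'k::{finite,wellorder} \<Rightarrow> real" where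
  "eigen_density m a\<^sub>1 a\<^sub>2 l d =
     (if ordered_spectrum d then (\<Prod>i\<in>UNIV. 1 + d $ i) powr - ((real m - 1) / 2) * prior_bound a\<^sub>1 a\<^sub>2 l d else 0)"

lemma prior_bound_eq:
  "prior_bound a\<^sub>1 a\<^sub>2 l d =
     vandermonde d powr l / ((\<Prod>i\<in>UNIV. 1 + d $ i) powr (a\<^sub>2 - a\<^sub>1) * (\<Prod>i\<in>UNIV. d $ i) powr a\<^sub>1)"
proof -
  have "mat 1 + diag_mat d = diag_mat (\<chi> i. 1 + d $ i)"
    by (simp add: vec_eq_iff diag_mat_def mat_def)
  then show ?thesis by (simp add: prior_bound_def det_diag_mat)
qed

lemma measurable_ordered_spectrum [measurable]: "Measurable.pred borel (ordered_spectrum :: real^'k::{finite,wellorder} \<Rightarrow> bool)"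
  unfolding ordered_spectrum_def by measurable

lemma measurable_vandermonde [measurable]: "(vandermonde :: real^'k::{finite,wellorder} \<Rightarrow>
    real) \<in> borel_measurable borel"
  unfolding vandermonde_def split_def by measurable

lemma measurable_eigen_density [measurable]: "eigen_density m a\<^sub>1 a\<^sub>2 l \<in> borel_measurable borel"
  unfolding eigen_density_def prior_bound_eq by measurable

lemma eigen_density_nonneg: "0 \<le> eigen_density m a\<^sub>1 a\<^sub>2 l d"
  by (simp add: eigen_density_def prior_bound_eq)

lemma measurable_diag_of [measurable]: "diag_of \<in> borel_measurable borel"
  by (intro borel_measurable_continuous_onI linear_continuous_on linear_conv_bounded_linear[THEN iffD1] linear_diag_of)

lemma borel_spectral_patch: "spectral_patch r \<in> sets borel"
proof -
  have "Measurable.pred borel (\<lambda>v. ordered_spectrum (diag_of v) \<and> (\<forall>p. lo p \<noteq> hi p \<longrightarrow> \<bar>v $ p\<bar> \<le> r))"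
    by measurable
  then show ?thesis by (simp add: spectral_patch_def pred_def)
qed

text \<open>The Vandermonde factor of the Jacobian is exactly what turns the density on V into
  \<open>prior_HD\<close>, the quantity that the hypothesis controls.\<close>

lemma reduced_density_spectral_map:
  assumes Q: "orthogonal_matrix Q" and v: "ordered_spectrum (diag_of v)"
  shows "reduced_density m prior (sym_of (spectral_map Q v)) * vandermonde (diag_of v) =
    (\<Prod>i\<in>UNIV. 1 + diag_of v $ i) powr - ((real m - 1) / 2) * prior_HD prior (frame Q v) (diag_of v)"
proof -
  have "pos_def (sym_of (spectral_map Q v))"
    using v by (intro pos_def_spectral_map Q) (simp add: ordered_spectrum_def)
  then show ?thesis
    by (simp add: reduced_density_def prior_HD_def sym_of_spectral_map det_mat_1_add_diagonalized orthogonal_matrix_frame[OF Q])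
qed

text \<open>Change of variables, then two comparisons: the Jacobian with the Vandermonde product, at
  the price of \<open>K\<close>, and \<open>prior_HD\<close> with \<open>prior_bound\<close>, at the
  price of \<open>C\<^sub>1\<close> and \<open>C\<^sub>2\<close>. As \<open>Z\<close> does not
  involve \<open>Q\<close>, all patches behave alike.\<close>

lemma nn_integral_spectral_patch_image:
  fixes Q :: "('k::{finite,wellorder}) sq_matrix" and m :: nat
    and prior :: "('k::{finite,wellorder}) sq_matrix \<Rightarrow> real"
  assumes prior: "prior_density prior" and Q: "orthogonal_matrix Q"
    and r: "r \<le> 1 / (4 * (real CARD('k))\<^sup>2)" "0 \<le> r"
    and C: "0 < C\<^sub>1" "0 < C\<^sub>2"
    and bounds: "\<And>H d. orthogonal_matrix H \<Longrightarrow> ordered_spectrum d \<Longrightarrow>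
           C\<^sub>1 * prior_bound a\<^sub>1 a\<^sub>2 l d \<le> prior_HD prior H d \<and>
           prior_HD prior H d \<le> C\<^sub>2 * prior_bound a\<^sub>1 a\<^sub>2 l d"
  defines "K \<equiv> (fact CARD('k upper) * (2 * (real CARD('k))\<^sup>2) ^ CARD('k upper))\<^sup>2"
    and "I \<equiv> (\<integral>\<^sup>+ y. ennreal (reduced_density m prior (sym_of y)) *
        indicator (spectral_map Q ` spectral_patch r) y \<partial>lebesgue)"
    and "Z \<equiv> (\<integral>\<^sup>+ v. ennreal (eigen_density m a\<^sub>1 a\<^sub>2 l (diag_of v)) * indicator (spectral_patch r) v
         \<partial>(lborel :: ('k::{finite,wellorder}) upper_vec measure))"
  shows "I \<le> ennreal (K * C\<^sub>2) * Z" and "Z \<le> ennreal (K / C\<^sub>1) * I"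
proof -
  let ?f = "\<lambda>y. reduced_density m prior (sym_of y)" and ?J = "\<lambda>v. \<bar>det (matrix (spectral_deriv Q v))\<bar>"
  let ?e = "\<lambda>v :: ('k::{finite,wellorder}) upper_vec. eigen_density m a\<^sub>1 a\<^sub>2 l (diag_of v)"
  let ?S = "spectral_patch r :: ('k::{finite,wellorder}) upper_vec set"
  have f [measurable]: "?f \<in> borel_measurable borel"
    by (rule measurable_compose[OF measurable_sym_of measurable_reduced_density[OF prior]])
  have S [measurable]: "?S \<in> sets borel" by (rule borel_spectral_patch)
  have I: "I = (\<integral>\<^sup>+ v. ennreal (?J v * ?f (spectral_map Q v)) * indicator ?S v \<partial>lebesgue)"
    unfolding I_def using S f
    by (intro nn_integral_change_of_variables[symmetric] has_derivative_at_withinI[OF has_derivative_spectral_map]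
        inj_on_spectral_map Q r reduced_density_nonneg prior) auto
  have Z: "Z = (\<integral>\<^sup>+ v. ennreal (?e v) * indicator ?S v \<partial>lebesgue)"
    unfolding Z_def nn_integral_completion ..
  have "1 \<le> (real CARD('k))\<^sup>2" by (simp add: Suc_leI)
  then have K: "0 < K" unfolding K_def by (intro zero_less_power mult_pos_pos) auto
  have r1: "r \<le> 1"
  proof -
    have "1 / (4 * (real CARD('k))\<^sup>2) \<le> 1" using \<open>1 \<le> (real CARD('k))\<^sup>2\<close>
      by (subst divide_le_eq_1_pos; linarith)
    then show ?thesis by (rule order_trans[OF r(1)])
  qed
  have le: "?J v * ?f (spectral_map Q v) \<le> K * C\<^sub>2 * ?e v" "?e v \<le> K / C\<^sub>1 * (?J v *
      ?f (spectral_map Q v))"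
    if v: "v \<in> ?S" for v
  proof -
    have o: "ordered_spectrum (diag_of v)" using v by (simp add: spectral_patch_def)
    let ?van = "vandermonde (diag_of v)"
        and ?w = "(\<Prod>i\<in>UNIV. 1 + diag_of v $ i) powr - ((real m - 1) / 2)"
    have van: "0 \<le> ?van" using vandermonde_pos[OF o] by simp
    have J: "?J v \<le> K * ?van" "?van \<le> K * ?J v"
      unfolding K_def using abs_skew_of_le[OF v r(2)] r1
      by (intro jacobian_bounds Q van; meson order_trans)+
    have f0: "0 \<le> ?f (spectral_map Q v)" by (rule reduced_density_nonneg[OF prior])
    have fe: "?f (spectral_map Q v) * ?van = ?w * prior_HD prior (frame Q v) (diag_of v)"
      by (rule reduced_density_spectral_map[OF Q o])
    have e: "?e v = ?w * prior_bound a\<^sub>1 a\<^sub>2 l (diag_of v)" using o by (simp add: eigen_density_def)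
    have b: "C\<^sub>1 * prior_bound a\<^sub>1 a\<^sub>2 l (diag_of v) \<le> prior_HD prior (frame Q v) (diag_of v)"
       "prior_HD prior (frame Q v) (diag_of v) \<le> C\<^sub>2 * prior_bound a\<^sub>1 a\<^sub>2 l (diag_of v)"
      using bounds[OF orthogonal_matrix_frame[OF Q] o] by auto
    have fC: "?f (spectral_map Q v) * ?van \<le> C\<^sub>2 * ?e v" "C\<^sub>1 * ?e v \<le> ?f (spectral_map Q v) * ?van"
      unfolding fe e using mult_left_mono[OF b(1), of ?w] mult_left_mono[OF b(2), of ?w]
        by (auto simp: mult_ac)
    have "?J v * ?f (spectral_map Q v) \<le> K * ?van * ?f (spectral_map Q v)"
      by (intro mult_right_mono J f0)
    also have "\<dots> = K * (?f (spectral_map Q v) * ?van)" by simp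
    also have "\<dots> \<le> K * (C\<^sub>2 * ?e v)" using K by (intro mult_left_mono fC) auto
    finally show "?J v * ?f (spectral_map Q v) \<le> K * C\<^sub>2 * ?e v" by simp
    have "?f (spectral_map Q v) * ?van \<le> ?f (spectral_map Q v) * (K * ?J v)"
      by (intro mult_left_mono J f0)
    with fC(2) have "C\<^sub>1 * ?e v \<le> K * (?J v * ?f (spectral_map Q v))" by (simp add: mult_ac)
    then show "?e v \<le> K / C\<^sub>1 * (?J v * ?f (spectral_map Q v))"
      using C by (simp add: field_simps)
  qed
  have meas: "(\<lambda>v. ennreal (?J v * ?f (spectral_map Q v)) * indicator ?S v) \<in> borel_measurable lebesgue"
  proof -
    have "?J \<in> borel_measurable (lebesgue_on UNIV)"
      by (intro borel_measurable_abs borel_measurable_det_Jacobian[where f="spectral_map Q"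
          and S=UNIV] has_derivative_spectral_map) auto
    moreover have "spectral_map Q \<in> borel_measurable (lebesgue_on UNIV)"
      by (intro continuous_imp_measurable_on_sets_lebesgue differentiable_imp_continuous_on
          spectral_map_differentiable_on) auto
    then have "(\<lambda>v. ?f (spectral_map Q v)) \<in> borel_measurable (lebesgue_on UNIV)"
      using f by (rule measurable_compose)
    moreover have "?S \<in> sets lebesgue" using S by simp
    ultimately show ?thesis
      unfolding lebesgue_on_UNIV_eq
      by (intro borel_measurable_times_ennreal measurable_compose[OF _ measurable_ennreal]
          borel_measurable_times borel_measurable_indicator)
  qed
  have "I \<le> (\<integral>\<^sup>+ v. ennreal (K * C\<^sub>2) * (ennreal (?e v) * indicator ?S v) \<partial>lebesgue)"
    unfolding I
  proof (rule nn_integral_mono)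
    fix v :: "('k::{finite,wellorder}) upper_vec"
    show "ennreal (?J v * ?f (spectral_map Q v)) * indicator ?S v \<le> ennreal (K * C\<^sub>2) * (ennreal (?e v) *
        indicator ?S v)"
      using le(1)[of v] K C
        by (auto simp: indicator_def ennreal_mult[symmetric] eigen_density_nonneg intro!: ennreal_leI)
  qed
  also have "\<dots> = ennreal (K * C\<^sub>2) * Z"
    unfolding Z by (intro nn_integral_cmult measurable_completion) measurable
  finally show "I \<le> ennreal (K * C\<^sub>2) * Z" .
  have "Z \<le> (\<integral>\<^sup>+ v. ennreal (K / C\<^sub>1) * (ennreal (?J v * ?f (spectral_map Q v)) *
      indicator ?S v) \<partial>lebesgue)"
    unfolding Z
  proof (rule nn_integral_mono)
    fix v :: "('k::{finite,wellorder}) upper_vec"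
    show "ennreal (?e v) * indicator ?S v \<le> ennreal (K / C\<^sub>1) * (ennreal (?J v * ?f (spectral_map Q v)) *
        indicator ?S v)"
      using le(2)[of v] K C reduced_density_nonneg[OF prior]
      by (auto simp: indicator_def ennreal_mult[symmetric] intro!: ennreal_leI)
  qed
  also have "\<dots> = ennreal (K / C\<^sub>1) * I"
    unfolding I by (intro nn_integral_cmult meas)
  finally show "Z \<le> ennreal (K / C\<^sub>1) * I" .
qed

text \<open>A patch restricts the off-diagonal slots to a box and the eigenvalues only by their
  order. Tonelli over the two groups of slots therefore splits off the volume of the box.\<close>

lemma nn_integral_diag_of_box:
  fixes F :: "real^'k::{finite,wellorder} \<Rightarrow> ennreal"
  assumes [measurable]: "F \<in> borel_measurable borel" and r: "0 \<le> r"
  shows "(\<integral>\<^sup>+ v. F (diag_of v) * (\<Prod>p\<in>{p. lo p \<noteq> hi p}. indicator {-r..r} (v $ p)) \<partial>lborel) =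
    ennreal (2 * r) ^ card {p :: 'k upper. lo p \<noteq> hi p} * (\<integral>\<^sup>+ d. F d \<partial>lborel)"
proof -
  interpret product_sigma_finite "\<lambda>p :: 'k upper. lborel :: real measure" ..
  define I where "I = {p :: 'k upper. lo p = hi p}"
  define J where "J = {p :: 'k upper. lo p \<noteq> hi p}"
  have IJ: "I \<inter> J = {}" "I \<union> J = UNIV" "finite I" "finite J" by (auto simp: I_def J_def)
  have uI: "uix i i \<in> I" for i by (simp add: I_def)
  have bij: "bij_betw (\<lambda>i. uix i i) UNIV I"
  proof (rule bij_betw_byWitness[where f'=lo])
    show "\<forall>p\<in>I. uix (lo p) (lo p) = p" by (metis (mono_tags) I_def mem_Collect_eq uix_lo_hi)
  qed (auto simp: uI)
  have [measurable]: "(\<lambda>f. \<chi> i. f (uix i i)) \<in> borel_measurable (\<Pi>\<^sub>M p\<in>I. lborel)"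
    by (rule measurable_vec_nth_PiM) (use uI in auto)
  have [measurable]: "(\<lambda>f. \<chi> p. f p) \<in> borel_measurable (\<Pi>\<^sub>M p\<in>(UNIV :: 'k upper set). lborel)"
    using measurable_vec_nth_PiM[of id UNIV] by simp
  let ?H = "\<lambda>v :: real^'k upper. F (diag_of v) * (\<Prod>p\<in>J. indicator {-r..r} (v $ p))"
  have "(\<integral>\<^sup>+ v. ?H v \<partial>lborel) =
      (\<integral>\<^sup>+ v. ?H v \<partial>distr (\<Pi>\<^sub>M p\<in>(UNIV :: 'k upper set). lborel) borel (\<lambda>f. \<chi> p. f (id p)))"
    by (subst distr_PiM_lborel_vec) (auto simp: bij_betw_def)
  also have "\<dots> = (\<integral>\<^sup>+ f. ?H (\<chi> p. f p) \<partial>(\<Pi>\<^sub>M p\<in>I \<union> J. lborel))"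
    unfolding IJ by (subst nn_integral_distr) simp_all
  also have "\<dots> = (\<integral>\<^sup>+ f. \<integral>\<^sup>+ g. ?H (\<chi> p. merge I J (f, g) p) \<partial>(\<Pi>\<^sub>M p\<in>J. lborel) \<partial>(\<Pi>\<^sub>M p\<in>I. lborel))"
    by (rule product_nn_integral_fold) (use IJ in simp_all)
  also have "\<dots> = (\<integral>\<^sup>+ f. F (\<chi> i. f (uix i i)) * ennreal (2 * r) ^ card J \<partial>(\<Pi>\<^sub>M p\<in>I. lborel))"
  proof (rule nn_integral_cong)
    fix f
    have "?H (\<chi> p. merge I J (f, g) p) = F (\<chi> i. f (uix i i)) * (\<Prod>p\<in>J. indicator {-r..r} (g p))" for g
    proof -
      have "diag_of (\<chi> p. merge I J (f, g) p) = (\<chi> i. f (uix i i))"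
        by (simp add: diag_of_def merge_def uI)
      moreover have "(\<Prod>p\<in>J. indicator {-r..r} ((\<chi> p. merge I J (f, g) p) $ p)) =
          (\<Prod>p\<in>J. indicator {-r..r} (g p) :: ennreal)"
        using IJ by (intro prod.cong) (auto simp: merge_def)
      ultimately show ?thesis by simp
    qed
    then have "(\<integral>\<^sup>+ g. ?H (\<chi> p. merge I J (f, g) p) \<partial>(\<Pi>\<^sub>M p\<in>J. lborel)) =
      F (\<chi> i. f (uix i i)) * (\<integral>\<^sup>+ g. (\<Prod>p\<in>J. indicator {-r..r} (g p)) \<partial>(\<Pi>\<^sub>M p\<in>J. lborel))"
      by (simp add: nn_integral_cmult)
    also have "(\<integral>\<^sup>+ g. (\<Prod>p\<in>J. indicator {-r..r} (g p)) \<partial>(\<Pi>\<^sub>M p\<in>J. lborel)) =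
        (\<Prod>p\<in>J. \<integral>\<^sup>+ t. indicator {-r..r} t \<partial>(lborel :: real measure))"
      by (rule product_nn_integral_prod) (use IJ in auto)
    also have "\<dots> = ennreal (2 * r) ^ card J" using r by simp
    finally show "(\<integral>\<^sup>+ g. ?H (\<chi> p. merge I J (f, g) p) \<partial>(\<Pi>\<^sub>M p\<in>J. lborel)) = F (\<chi> i. f (uix i i)) *
        ennreal (2 * r) ^ card J" .
  qed
  also have "\<dots> = (\<integral>\<^sup>+ f. F (\<chi> i. f (uix i i)) \<partial>(\<Pi>\<^sub>M p\<in>I. lborel)) * ennreal (2 * r) ^ card J"
    by (rule nn_integral_multc) measurable
  also have "(\<integral>\<^sup>+ f. F (\<chi> i. f (uix i i)) \<partial>(\<Pi>\<^sub>M p\<in>I. lborel)) =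
      (\<integral>\<^sup>+ d. F d \<partial>distr (\<Pi>\<^sub>M p\<in>I. lborel) borel (\<lambda>f. \<chi> i. f (uix i i)))"
    by (rule nn_integral_distr[symmetric]) measurable
  also have "\<dots> = (\<integral>\<^sup>+ d. F d \<partial>lborel)" by (simp add: distr_PiM_lborel_vec[OF bij])
  finally show ?thesis by (simp add: J_def mult.commute)
qed

section \<open>The integral over the ordered spectra\<close>

lemma nn_integral_reciprocal_Icc:
  assumes "0 < a" "a \<le> b"
  shows "(\<integral>\<^sup>+ t. ennreal (1 / t) * indicator {a..b} t \<partial>lborel) = ennreal (ln b - ln a)"
proof (rule nn_integral_has_integral_lebesgue')
  show "((\<lambda>t. 1 / t) has_integral (ln b - ln a)) {a..b}"
    using assms
    by (intro fundamental_theorem_of_calculus)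
      (auto intro!: derivative_eq_intros simp: has_real_derivative_iff_has_vector_derivative[symmetric])
qed (use assms in auto)

lemma ennreal_eq_top_if_unbounded:
  assumes "\<And>M :: real. 0 < M \<Longrightarrow> ennreal M \<le> x"
  shows "x = \<infinity>"
proof (rule ccontr)
  assume "x \<noteq> \<infinity>"
  then obtain r where r: "x = ennreal r" "0 \<le> r" by (cases x) auto
  have "ennreal (r + 1) \<le> ennreal r" using assms[of "r + 1"] r by simp
  then show False using r(2) by (simp add: ennreal_le_iff)
qed

lemma nn_integral_powr_at_0_infinite:
  assumes a: "1 \<le> a"
  shows "(\<integral>\<^sup>+ t. ennreal (t powr - a) * indicator {0<..<1} t \<partial>lborel) = \<infinity>"
proof (rule ennreal_eq_top_if_unbounded)
  fix M :: real assume M: "0 < M"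
  \<comment> \<open>The interval from exp(-M - 1) to exp(-1) has logarithmic length exactly M, and
    its right end stays inside the open interval (0, 1).\<close>
  define e where "e = exp (- M - 1)"
  have e: "0 < e" "e < exp (-1)" using M by (simp_all add: e_def)
  have "ennreal M = ennreal (ln (exp (-1)) - ln e)" by (simp add: e_def)
  also have "\<dots> = (\<integral>\<^sup>+ t. ennreal (1 / t) * indicator {e..exp (-1)} t \<partial>lborel)"
    using e by (subst nn_integral_reciprocal_Icc) auto
  also have "\<dots> \<le> (\<integral>\<^sup>+ t. ennreal (t powr - a) * indicator {0<..<1} t \<partial>lborel)"
  proof (rule nn_integral_mono)
    fix t :: real
    have "1 / t \<le> t powr - a \<and> 0 < t \<and> t < 1" if "e \<le> t" "t \<le> exp (-1)"
    proof -
      have "exp (-1) < (1 :: real)" by simp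
      then have that: "0 < t" "t < 1" using that e by linarith+
      have "t powr a \<le> t powr 1" using that a by (intro powr_mono') auto
      then show ?thesis using that by (simp add: powr_minus_divide divide_left_mono)
    qed
    then show "ennreal (1 / t) * indicator {e..exp (-1)} t \<le> ennreal (t powr - a) * indicator {0<..<1} t"
      by (auto simp: indicator_def intro!: ennreal_leI)
  qed
  finally show "ennreal M \<le> (\<integral>\<^sup>+ t. ennreal (t powr - a) * indicator {0<..<1} t \<partial>lborel)" .
qed

lemma nn_integral_powr_at_top_infinite:
  assumes s: "-1 \<le> s" and T: "1 \<le> T"
  shows "(\<integral>\<^sup>+ t. ennreal (t powr s) * indicator {T..} t \<partial>lborel) = \<infinity>"
proof (rule ennreal_eq_top_if_unbounded)
  fix M :: real assume M: "0 < M"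
  have "ennreal M = ennreal (ln (T * exp M) - ln T)" using T by (simp add: ln_mult)
  also have "\<dots> = (\<integral>\<^sup>+ t. ennreal (1 / t) * indicator {T..T * exp M} t \<partial>lborel)"
    using T M by (subst nn_integral_reciprocal_Icc) auto
  also have "\<dots> \<le> (\<integral>\<^sup>+ t. ennreal (t powr s) * indicator {T..} t \<partial>lborel)"
  proof (rule nn_integral_mono)
    fix t :: real
    have "1 / t \<le> t powr s" if "T \<le> t"
      using powr_mono[of "-1" s t] that T s by (simp add: powr_minus_divide)
    then show "ennreal (1 / t) * indicator {T..T * exp M} t \<le> ennreal (t powr s) * indicator {T..} t"
      by (auto simp: indicator_def intro!: ennreal_leI)
  qed
  finally show "ennreal M \<le> (\<integral>\<^sup>+ t. ennreal (t powr s) * indicator {T..} t \<partial>lborel)" .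
qed

text \<open>The exponents that occur have no fixed sign; max and min with 1 bound a power over
  [1, M] in either case.\<close>

lemma powr_between:
  fixes y s M :: real
  assumes "1 \<le> y" "y \<le> M"
  shows "y powr s \<le> max 1 (M powr s)" "min 1 (M powr s) \<le> y powr s"
proof -
  have "y powr s \<le> max 1 (M powr s) \<and> min 1 (M powr s) \<le> y powr s"
  proof (cases "0 \<le> s")
    case True
    then have "y powr s \<le> M powr s" "1 \<le> y powr s"
      using assms by (auto intro: powr_mono2 ge_one_powr_ge_zero)
    then show ?thesis by auto
  next
    case False
    then have "M powr s \<le> y powr s" using assms by (intro powr_mono2') auto
    moreover have "y powr s \<le> 1" using False assms powr_mono[of s 0 y] by simp
    ultimately show ?thesis by auto
  qed
  then show "y powr s \<le> max 1 (M powr s)" "min 1 (M powr s) \<le> y powr s" by auto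
qed

text \<open>Near 0 the integrand is of order t^(-a). At infinity it is of order t^(s - a), because 1
  + t = (1 + 1/t) t with 1 + 1/t in [1, 2]. The two exponents give the two hypotheses.\<close>

lemma nn_integral_beta_prime_finite:
  fixes a s :: real
  assumes a: "a < 1" and s: "s - a < -1"
  shows "(\<integral>\<^sup>+ t. ennreal ((1 + t) powr s * t powr - a) * indicator {0<..} t \<partial>lborel) < \<infinity>"
proof -
  define c where "c = max 1 ((2 :: real) powr s)"
  have c: "0 < c" by (simp add: c_def)
  have b1: "(1 + t) powr s * t powr - a \<le> c * t powr - a" if "0 < t" "t \<le> 1" for t
    unfolding c_def using that by (intro mult_right_mono powr_between) auto
  have b2: "(1 + t) powr s * t powr - a \<le> c * t powr (s - a)" if "1 \<le> t" for t
  proof -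
    have "1 + t = (1 + 1 / t) * t" using that by (simp add: field_simps)
    then have "(1 + t) powr s = (1 + 1 / t) powr s * t powr s"
      using that by (simp only: powr_mult)
    also have "\<dots> \<le> c * t powr s"
      unfolding c_def using that by (intro mult_right_mono powr_between) auto
    finally have "(1 + t) powr s * t powr - a \<le> c * t powr s * t powr - a"
      by (intro mult_right_mono) auto
    then show ?thesis by (simp add: mult.assoc powr_add[symmetric])
  qed
  have i1: "(\<integral>\<^sup>+ t. ennreal (t powr - a) * indicator {0..1} t \<partial>lborel) < \<infinity>"
    using has_integral_powr_from_0[of "- a" 1] a by (subst nn_integral_has_integral_lebesgue') auto
  have i2: "(\<integral>\<^sup>+ t. ennreal (t powr (s - a)) * indicator {1..} t \<partial>lborel) < \<infinity>"
    using has_integral_powr_to_inf[of "s - a" 1] s by (subst nn_integral_has_integral_lebesgue') auto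
  have "(\<integral>\<^sup>+ t. ennreal ((1 + t) powr s * t powr - a) * indicator {0<..} t \<partial>lborel) \<le>
    (\<integral>\<^sup>+ t. ennreal c * (ennreal (t powr - a) * indicator {0..1} t) + ennreal c * (ennreal (t powr (s - a)) * indicator {1..} t) \<partial>lborel)"
  proof (rule nn_integral_mono)
    fix t :: real
    consider "t \<le> 0" | "0 < t" "t < 1" | "t = 1" | "1 < t" by linarith
    then show "ennreal ((1 + t) powr s * t powr - a) * indicator {0<..} t \<le>
      ennreal c * (ennreal (t powr - a) * indicator {0..1} t) + ennreal c * (ennreal (t powr (s - a)) * indicator {1..} t)"
    proof cases
      case 2
      then show ?thesis using b1[of t] c by (simp add: ennreal_mult[symmetric] ennreal_leI)
    next
      case 3
      then show ?thesis using b1[of t] c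
        by (simp add: ennreal_mult[symmetric] ennreal_leI ennreal_plus[symmetric] del: ennreal_plus)
    next
      case 4
      then show ?thesis using b2[of t] c by (simp add: ennreal_mult[symmetric] ennreal_leI)
    qed simp
  qed
  also have "\<dots> = ennreal c * (\<integral>\<^sup>+ t. ennreal (t powr - a) * indicator {0..1} t \<partial>lborel) +
    ennreal c * (\<integral>\<^sup>+ t. ennreal (t powr (s - a)) * indicator {1..} t \<partial>lborel)"
    by (simp add: nn_integral_add nn_integral_cmult)
  also have "\<dots> < \<infinity>" using i1 i2 by (simp add: ennreal_mult_less_top)
  finally show ?thesis .
qed

section \<open>Upper bound: convergence over the ordered spectra\<close>

lemma eigen_density_eq:
  assumes "ordered_spectrum d"
  shows "eigen_density m a\<^sub>1 a\<^sub>2 l d = vandermonde d powr l *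
    (\<Prod>i\<in>UNIV. (1 + d $ i) powr (a\<^sub>1 - a\<^sub>2 - (real m - 1) / 2) * d $ i powr - a\<^sub>1)"
proof -
  define P where "P = (\<Prod>i\<in>UNIV. 1 + d $ i)"
  define R where "R = (\<Prod>i\<in>UNIV. d $ i)"
  have "(\<Prod>i\<in>UNIV. (1 + d $ i) powr (a\<^sub>1 - a\<^sub>2 - (real m - 1) / 2) * d $ i powr - a\<^sub>1) =
    P powr (- ((real m - 1) / 2) + - (a\<^sub>2 - a\<^sub>1)) * R powr - a\<^sub>1"
    unfolding P_def R_def by (simp add: prod.distrib prod_powr_distrib algebra_simps)
  also have "\<dots> = P powr - ((real m - 1) / 2) / (P powr (a\<^sub>2 - a\<^sub>1) * R powr a\<^sub>1)"
    unfolding powr_add powr_minus by (simp add: field_simps)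
  finally show ?thesis using assms
    by (simp add: eigen_density_def prior_bound_eq P_def R_def)
qed

lemma vandermonde_eq: "vandermonde d = (\<Prod>i\<in>UNIV. \<Prod>j\<in>{j. i < j}. d $ i - d $ j)"
proof -
  have eq: "{(i, j). i < j} = (SIGMA i:UNIV. {j. i < j})" by auto
  have "(\<Prod>i\<in>UNIV. \<Prod>j\<in>{j. i < j}. d $ i - d $ j) = (\<Prod>(i, j)\<in>(SIGMA i:UNIV. {j. i < j}). d $ i - d $ j)"
    by (rule prod.Sigma) auto
  then show ?thesis by (simp only: vandermonde_def eq)
qed

text \<open>Each gap d_i - d_j is at most 1 + d_i, and every index is granted k - 1 gaps. The count
  is exact at the largest eigenvalue, and the bound becomes a product over coordinates.\<close>

lemma vandermonde_le:
  fixes d :: "real^'k::{finite,wellorder}"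
  assumes d: "ordered_spectrum d"
  shows "vandermonde d \<le> (\<Prod>i\<in>UNIV. (1 + d $ i) ^ (CARD('k) - 1))"
  unfolding vandermonde_eq
proof (intro prod_mono conjI)
  fix i :: 'k
  have pos: "0 < d $ j" for j using d by (simp add: ordered_spectrum_def)
  show "0 \<le> (\<Prod>j\<in>{j. i < j}. d $ i - d $ j)"
    using d by (intro prod_nonneg) (auto simp: ordered_spectrum_def less_imp_le)
  have "(\<Prod>j\<in>{j. i < j}. d $ i - d $ j) \<le> (\<Prod>j\<in>{j. i < j}. 1 + d $ i)"
  proof (intro prod_mono conjI)
    fix j assume "j \<in> {j. i < j}"
    then show "0 \<le> d $ i - d $ j" using d by (auto simp: ordered_spectrum_def less_imp_le)
    show "d $ i - d $ j \<le> 1 + d $ i" using pos[of j] by linarith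
  qed
  also have "\<dots> = (1 + d $ i) ^ card {j. i < j}" by simp
  also have "\<dots> \<le> (1 + d $ i) ^ (CARD('k) - 1)"
  proof (rule power_increasing)
    have "card {j. i < j} \<le> card (UNIV - {i})" by (intro card_mono) auto
    then show "card {j. i < j} \<le> CARD('k) - 1" by (simp add: card_Diff_singleton)
  qed (use pos[of i] in simp)
  finally show "(\<Prod>j\<in>{j. i < j}. d $ i - d $ j) \<le> (1 + d $ i) ^ (CARD('k) - 1)" .
qed

lemma nn_integral_eigen_density_finite:
  assumes l: "0 \<le> l" and a1: "a\<^sub>1 < 1" and a2: "a\<^sub>2 > (3 - real m) / 2 + (real CARD('k) - 1) * l"
  shows "(\<integral>\<^sup>+ d. ennreal (eigen_density m a\<^sub>1 a\<^sub>2 l (d :: real^'k::{finite,wellorder})) \<partial>lborel) < \<infinity>"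
proof -
  define e where "e = a\<^sub>1 - a\<^sub>2 - (real m - 1) / 2"
  define s where "s = e + (real CARD('k) - 1) * l"
  define u where "u t = ennreal ((1 + t) powr s * t powr - a\<^sub>1) * indicator {0<..} t" for t
  have [measurable]: "u \<in> borel_measurable borel" unfolding u_def by measurable
  have "(\<integral>\<^sup>+ d. ennreal (eigen_density m a\<^sub>1 a\<^sub>2 l (d :: real^'k::{finite,wellorder})) \<partial>lborel) \<le>
    (\<integral>\<^sup>+ d. (\<Prod>i\<in>UNIV. u ((d :: real^'k::{finite,wellorder}) $ i)) \<partial>lborel)"
  proof (rule nn_integral_mono)
    fix d :: "real^'k::{finite,wellorder}"
    show "ennreal (eigen_density m a\<^sub>1 a\<^sub>2 l d) \<le> (\<Prod>i\<in>UNIV. u (d $ i))"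
    proof (cases "ordered_spectrum d")
      case True
      then have pos: "0 < d $ i" for i by (simp add: ordered_spectrum_def)
      have k: "real (CARD('k) - 1) = real CARD('k) - 1" by (simp add: of_nat_diff Suc_leI)
      have "vandermonde d powr l \<le> (\<Prod>i\<in>UNIV. (1 + d $ i) ^ (CARD('k) - 1)) powr l"
        using l vandermonde_pos[OF True] vandermonde_le[OF True] by (intro powr_mono2) auto
      also have "\<dots> = (\<Prod>i\<in>UNIV. (1 + d $ i) powr ((real CARD('k) - 1) * l))"
        unfolding prod_powr_distrib
      proof (rule prod.cong[OF refl])
        fix i
        have "(1 + d $ i) ^ (CARD('k) - 1) = (1 + d $ i) powr real (CARD('k) - 1)"
          using pos[of i] by (intro powr_realpow[symmetric]) simp
        then show "((1 + d $ i) ^ (CARD('k) - 1)) powr l = (1 + d $ i) powr ((real CARD('k) - 1) * l)"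
          by (simp only: k powr_powr)
      qed
      finally have "eigen_density m a\<^sub>1 a\<^sub>2 l d \<le>
        (\<Prod>i\<in>UNIV. (1 + d $ i) powr ((real CARD('k) - 1) * l)) * (\<Prod>i\<in>UNIV. (1 + d $ i) powr e * d $ i powr - a\<^sub>1)"
        unfolding eigen_density_eq[OF True] e_def by (intro mult_right_mono prod_nonneg) auto
      also have "\<dots> = (\<Prod>i\<in>UNIV. (1 + d $ i) powr s * d $ i powr - a\<^sub>1)"
        unfolding prod.distrib[symmetric] s_def powr_add by (intro prod.cong) auto
      finally have "ennreal (eigen_density m a\<^sub>1 a\<^sub>2 l d) \<le> ennreal (\<Prod>i\<in>UNIV. (1 + d $ i) powr s *
          d $ i powr - a\<^sub>1)"
        by (rule ennreal_leI)
      also have "\<dots> = (\<Prod>i\<in>UNIV. u (d $ i))"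
        by (simp add: prod_ennreal[symmetric] u_def pos)
      finally show ?thesis .
    qed (simp add: eigen_density_def)
  qed
  also have "\<dots> = (\<Prod>i\<in>(UNIV :: 'k set). \<integral>\<^sup>+ t. u t \<partial>lborel)"
    by (rule nn_integral_lborel_vec_prod) measurable
  also have "\<dots> < \<infinity>"
  proof -
    \<comment> \<open>Here s - a_1 = (k - 1) l - a_2 - (m - 1)/2, so this is precisely the condition
      on \<open>a\<^sub>2\<close>.\<close>
    have "s - a\<^sub>1 < -1" using a2 by (simp add: s_def e_def field_simps)
    then have "(\<integral>\<^sup>+ t. u t \<partial>lborel) < \<infinity>"
      unfolding u_def by (rule nn_integral_beta_prime_finite[OF a1])
    then show ?thesis by (simp add: power_less_top_ennreal)
  qed
  finally show ?thesis .
qed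

section \<open>Lower bounds: divergence and positivity from boxes\<close>

lemma nn_integral_eigen_density_ge:
  fixes A :: "'k::{finite,wellorder} \<Rightarrow> real set"
  assumes c: "0 \<le> c" and A [measurable]: "\<And>i. A i \<in> sets borel"
    and A1: "\<And>i. i \<noteq> i\<^sub>0 \<Longrightarrow> emeasure lborel (A i) = 1"
    and \<phi> [measurable]: "\<phi> \<in> borel_measurable borel" "\<And>t. 0 \<le> \<phi> t"
    and le: "\<And>d. (\<And>i. d $ i \<in> A i) \<Longrightarrow> c * \<phi> (d $ i\<^sub>0) \<le> eigen_density m a\<^sub>1 a\<^sub>2 l d"
  shows "ennreal c * (\<integral>\<^sup>+ t. ennreal (\<phi> t) * indicator (A i\<^sub>0) t \<partial>lborel) \<le>
    (\<integral>\<^sup>+ d. ennreal (eigen_density m a\<^sub>1 a\<^sub>2 l (d :: real^'k::{finite,wellorder})) \<partial>lborel)"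
proof -
  \<comment> \<open>All coordinates except \<open>i\<^sub>0\<close> range over sets of measure 1, so
    their factors integrate to 1 and only the free coordinate is left.\<close>
  define f where "f i t = (if i = i\<^sub>0 then ennreal (c * \<phi> t) else 1) * indicator (A i) t" for i t
  have [measurable]: "f i \<in> borel_measurable borel" for i unfolding f_def by (cases "i = i\<^sub>0") simp_all
  have "ennreal c * (\<integral>\<^sup>+ t. ennreal (\<phi> t) * indicator (A i\<^sub>0) t \<partial>lborel) = (\<integral>\<^sup>+ t. f i\<^sub>0 t \<partial>lborel)"
    using c \<phi>(2)
      by (subst nn_integral_cmult[symmetric]) (auto simp: f_def ennreal_mult mult.assoc intro!: nn_integral_cong)
  also have "\<dots> = (\<Prod>i\<in>UNIV. \<integral>\<^sup>+ t. f i t \<partial>lborel)"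
  proof -
    have "(\<integral>\<^sup>+ t. f i t \<partial>lborel) = 1" if "i \<noteq> i\<^sub>0" for i
      using that A1[OF that] by (simp add: f_def)
    then show ?thesis by (subst prod.remove[of UNIV i\<^sub>0]) auto
  qed
  also have "\<dots> = (\<integral>\<^sup>+ d. (\<Prod>i\<in>UNIV. f i (d $ i)) \<partial>lborel)"
    by (rule nn_integral_lborel_vec_prod[symmetric]) measurable
  also have "\<dots> \<le> (\<integral>\<^sup>+ d. ennreal (eigen_density m a\<^sub>1 a\<^sub>2 l (d :: real^'k::{finite,wellorder})) \<partial>lborel)"
  proof (rule nn_integral_mono)
    fix d :: "real^'k::{finite,wellorder}"
    show "(\<Prod>i\<in>UNIV. f i (d $ i)) \<le> ennreal (eigen_density m a\<^sub>1 a\<^sub>2 l d)"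
    proof (cases "\<forall>i. d $ i \<in> A i")
      case True
      then have "(\<Prod>i\<in>UNIV. f i (d $ i)) = ennreal (c * \<phi> (d $ i\<^sub>0))"
        by (subst prod.remove[of UNIV i\<^sub>0]) (auto simp: f_def)
      then show ?thesis using le[of d] True by (simp add: ennreal_leI)
    next
      case False
      then obtain i where "d $ i \<notin> A i" by blast
      then have "f i (d $ i) = 0" by (simp add: f_def)
      then have "(\<Prod>i\<in>UNIV. f i (d $ i)) = 0" by (intro prod_zero) auto
      then show ?thesis by (simp only: zero_le)
    qed
  qed
  finally show ?thesis .
qed

definition num_above :: "'k::{finite,wellorder} \<Rightarrow> real" where
  "num_above i = real (card {j. i < j})"

lemma num_above_less: "i < j \<Longrightarrow> num_above j + 1 \<le> num_above i"
proof -
  assume "i < j"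
  then have "card {k. j < k} < card {k. i < k}"
    by (intro psubset_card_mono) (auto intro: less_trans)
  then show ?thesis by (simp add: num_above_def)
qed

lemma num_above_le: "num_above (i :: 'k::{finite,wellorder}) \<le> real CARD('k) - 1"
proof -
  have "card {j. i < j} \<le> card (UNIV - {i})" by (intro card_mono) auto
  then have "card {j. i < j} \<le> CARD('k) - 1" by (simp add: card_Diff_singleton)
  then show ?thesis unfolding num_above_def
    by (metis One_nat_def Suc_leI of_nat_1 of_nat_diff of_nat_le_iff zero_less_card_finite)
qed

lemma num_above_nonneg: "0 \<le> num_above i"
  by (simp add: num_above_def)

text \<open>In the boxes below, one eigenvalue is free and the others lie in the fixed intervals
  \<open>[2 r\<^sub>i + 1, 2 r\<^sub>i + 2]\<close>, where \<open>r\<^sub>i\<close> is the number of indices above \<open>i\<close>. The gaps are at least \<open>1\<close>.\<close>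

lemma ex_fixed_factor_bound:
  fixes a e :: real
  obtains c where "0 < c"
    "\<And>d (i :: 'k::{finite,wellorder}). d \<in> {2 * num_above i + 1..2 * num_above i + 2} \<Longrightarrow> c \<le> (1 +
        d) powr e * d powr a"
proof
  \<comment> \<open>As \<open>num_above i\<close> is at most k - 1, 1 + d is at most 1 + 2(k - 1) +
    2 = 2k + 1.\<close>
  let ?M = "2 * real CARD('k) + 1"
  show "0 < min 1 (?M powr e) * min 1 (?M powr a)" by simp
  fix d and i :: 'k assume "d \<in> {2 * num_above i + 1..2 * num_above i + 2}"
  then have "1 \<le> d" "1 + d \<le> ?M" using num_above_nonneg[of i] num_above_le[of i] by auto
  then show "min 1 (?M powr e) * min 1 (?M powr a) \<le> (1 + d) powr e * d powr a"
    by (intro mult_mono powr_between) auto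
qed

text \<open>The smallest eigenvalue is free in (0, 1). All gaps stay at least 1, so the Vandermonde
  power is at least 1, and up to constants only t^(-a_1) varies.\<close>

lemma nn_integral_eigen_density_ge_near_0:
  assumes l: "0 \<le> l"
  obtains c where "0 < c"
    "ennreal c * (\<integral>\<^sup>+ t. ennreal (t powr - a\<^sub>1) * indicator {0<..<1} t \<partial>lborel) \<le>
      (\<integral>\<^sup>+ d. ennreal (eigen_density m a\<^sub>1 a\<^sub>2 l (d :: real^'k::{finite,wellorder})) \<partial>lborel)"
proof -
  define e where "e = a\<^sub>1 - a\<^sub>2 - (real m - 1) / 2"
  obtain c where c: "0 < c"
    "\<And>d (i :: 'k). d \<in> {2 * num_above i + 1..2 * num_above i + 2} \<Longrightarrow> c \<le> (1 + d) powr e * d powr - a\<^sub>1"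
    using ex_fixed_factor_bound[where 'k='k and e=e and a="- a\<^sub>1"] by blast
  \<comment> \<open>Eigenvalues decrease with the index, so the last index carries the smallest.
    Every other index has at least one above it, and its fixed interval starts at 3 or
    later.\<close>
  define b :: 'k where "b = Max UNIV"
  have b: "i \<le> b" for i by (simp add: b_def)
  define A where "A i = (if i = b then {0<..<1} else {2 * num_above i + 1..2 * num_above i + 2})" for i
  let ?c = "c ^ (CARD('k) - 1) * min 1 (2 powr e)"
  have "ennreal ?c * (\<integral>\<^sup>+ t. ennreal (t powr - a\<^sub>1) * indicator (A b) t \<partial>lborel) \<le>
      (\<integral>\<^sup>+ d. ennreal (eigen_density m a\<^sub>1 a\<^sub>2 l (d :: real^'k::{finite,wellorder})) \<partial>lborel)"
  proof (rule nn_integral_eigen_density_ge)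
    fix d :: "real^'k::{finite,wellorder}" assume d: "\<And>i. d $ i \<in> A i"
    have gap: "1 \<le> d $ i - d $ j" if "i < j" for i j
    proof -
      have "i \<noteq> b" using that b[of j] by auto
      then have "2 * num_above i + 1 \<le> d $ i" using d[of i] by (simp add: A_def)
      moreover have "d $ j \<le> 2 * num_above j + 2" using d[of j] num_above_nonneg[of j]
        by (auto simp: A_def split: if_splits)
      moreover have "d $ j \<le> 1" if "j = b" using d[of j] that by (simp add: A_def)
      ultimately show ?thesis using num_above_less[OF that] by linarith
    qed
    have pos: "0 < d $ i" for i using d[of i] num_above_nonneg[of i]
      by (auto simp: A_def split: if_splits)
    have o: "ordered_spectrum d" unfolding ordered_spectrum_def using gap pos by force
    have "1 \<le> vandermonde d" unfolding vandermonde_def using gap by (intro prod_ge_1) auto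
    then have "1 \<le> vandermonde d powr l" using l by (rule ge_one_powr_ge_zero)
    have "?c * (d $ b) powr - a\<^sub>1 = (min 1 (2 powr e) * (d $ b) powr - a\<^sub>1) * (\<Prod>i\<in>UNIV - {b}. c)"
      by (simp add: card_Diff_singleton)
    also have "\<dots> \<le> ((1 + d $ b) powr e * d $ b powr - a\<^sub>1) * (\<Prod>i\<in>UNIV - {b}. (1 + d $ i) powr e *
        d $ i powr - a\<^sub>1)"
    proof (intro mult_mono prod_mono conjI)
      show "min 1 (2 powr e) \<le> (1 + d $ b) powr e" using d[of b]
        by (intro powr_between) (auto simp: A_def)
      fix i assume "i \<in> UNIV - {b}"
      then show "c \<le> (1 + d $ i) powr e * d $ i powr - a\<^sub>1" using d[of i]
        by (intro c(2)) (auto simp: A_def)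
    qed (use c in \<open>auto intro!: prod_nonneg\<close>)
    also have "\<dots> = 1 * (\<Prod>i\<in>UNIV. (1 + d $ i) powr e * d $ i powr - a\<^sub>1)"
      by (simp add: prod.remove[of UNIV b])
    also have "\<dots> \<le> eigen_density m a\<^sub>1 a\<^sub>2 l d"
      unfolding eigen_density_eq[OF o] e_def[symmetric] using \<open>1 \<le> vandermonde d powr l\<close>
      by (intro mult_right_mono prod_nonneg) auto
    finally show "?c * (d $ b) powr - a\<^sub>1 \<le> eigen_density m a\<^sub>1 a\<^sub>2 l d" .
  qed (use c in \<open>auto simp: A_def\<close>)
  then show thesis using that[of ?c] c by (simp add: A_def)
qed

text \<open>The largest eigenvalue is free. Its k - 1 gaps grow like t and contribute t^((k - 1) l);
  the gaps among the fixed eigenvalues are at least 1.\<close>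

lemma nn_integral_eigen_density_ge_at_top:
  assumes l: "0 \<le> l"
  obtains c where "0 < c"
    "ennreal c * (\<integral>\<^sup>+ t. ennreal (t powr (a\<^sub>1 - a\<^sub>2 - (real m - 1) / 2 - a\<^sub>1 + (real CARD('k) - 1) *
        l)) * indicator {4 * real CARD('k)..} t \<partial>lborel) \<le>
      (\<integral>\<^sup>+ d. ennreal (eigen_density m a\<^sub>1 a\<^sub>2 l (d :: real^'k::{finite,wellorder})) \<partial>lborel)"
proof -
  define e where "e = a\<^sub>1 - a\<^sub>2 - (real m - 1) / 2"
  define q where "q = (real CARD('k) - 1) * l"
  obtain c where c: "0 < c"
    "\<And>d (i :: 'k). d \<in> {2 * num_above i + 1..2 * num_above i + 2} \<Longrightarrow> c \<le> (1 + d) powr e * d powr - a\<^sub>1"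
    using ex_fixed_factor_bound[where 'k='k and e=e and a="- a\<^sub>1"] by blast
  define b :: 'k where "b = Min UNIV"
  have b: "b \<le> i" for i by (simp add: b_def)
  have k1: "1 \<le> real CARD('k)" by (simp add: Suc_leI)
  have kd: "real (CARD('k) - 1) = real CARD('k) - 1" by (simp add: of_nat_diff Suc_leI)
  \<comment> \<open>Fixed eigenvalues are at most 2(k - 1) + 2 = 2k, so starting the free one at 4k
    makes each of its gaps at least t/2.\<close>
  define A where "A i = (if i = b then {4 * real CARD('k)..} else {2 * num_above i + 1..2 * num_above i +
      2})" for i
  let ?c = "(1/2) powr q * min 1 (2 powr e) * c ^ (CARD('k) - 1)"
  have "ennreal ?c * (\<integral>\<^sup>+ t. ennreal (t powr (e - a\<^sub>1 + q)) * indicator (A b) t \<partial>lborel) \<le>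
      (\<integral>\<^sup>+ d. ennreal (eigen_density m a\<^sub>1 a\<^sub>2 l (d :: real^'k::{finite,wellorder})) \<partial>lborel)"
  proof (rule nn_integral_eigen_density_ge)
    fix d :: "real^'k::{finite,wellorder}" assume d: "\<And>i. d $ i \<in> A i"
    define t where "t = d $ b"
    have t4: "4 * real CARD('k) \<le> t" using d[of b] by (simp add: A_def t_def)
    then have t: "4 * real CARD('k) \<le> t" "1 \<le> t" using k1 by linarith+
    have gapb: "t / 2 \<le> d $ b - d $ j" if "b < j" for j
    proof -
      have "j \<noteq> b" using that by auto
      then have "d $ j \<le> 2 * num_above j + 2" using d[of j] by (simp add: A_def)
      then show ?thesis using t num_above_le[of j] by (simp add: t_def)
    qed
    have gap: "1 \<le> d $ i - d $ j" if "i < j" for i j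
    proof (cases "i = b")
      case True
      then have "t / 2 \<le> d $ i - d $ j" using gapb[of j] that by simp
      then show ?thesis using t k1 by linarith
    next
      case False
      then have "j \<noteq> b" using that b[of i] by auto
      with False show ?thesis using d[of i] d[of j] num_above_less[OF that] by (simp add: A_def)
    qed
    have pos: "0 < d $ i" for i using d[of i] num_above_nonneg[of i] t(2)
      by (cases "i = b") (auto simp: A_def t_def)
    have o: "ordered_spectrum d" unfolding ordered_spectrum_def using gap pos by force
    have "{j. b < j} = UNIV - {b}" using b by (auto simp: less_le)
    then have card: "card {j. b < j} = CARD('k) - 1" by (simp add: card_Diff_singleton)
    have "(t / 2) ^ (CARD('k) - 1) = (\<Prod>j\<in>{j. b < j}. t / 2)" by (simp add: card)
    also have "\<dots> \<le> (\<Prod>j\<in>{j. b < j}. d $ b - d $ j)" using gapb t by (intro prod_mono) auto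
    also have "\<dots> = (\<Prod>j\<in>{j. b < j}. d $ b - d $ j) * 1" by simp
    also have "\<dots> \<le> (\<Prod>j\<in>{j. b < j}. d $ b - d $ j) * (\<Prod>i\<in>UNIV - {b}. \<Prod>j\<in>{j. i < j}. d $ i - d $ j)"
    proof (rule mult_left_mono)
      show "1 \<le> (\<Prod>i\<in>UNIV - {b}. \<Prod>j\<in>{j. i < j}. d $ i - d $ j)" using gap by (intro prod_ge_1) auto
      show "0 \<le> (\<Prod>j\<in>{j. b < j}. d $ b - d $ j)" using gap by (intro prod_nonneg) force
    qed
    also have "\<dots> = vandermonde d" unfolding vandermonde_eq by (simp add: prod.remove[of UNIV b])
    finally have "((t / 2) ^ (CARD('k) - 1)) powr l \<le> vandermonde d powr l" using l t
      by (intro powr_mono2) auto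
    moreover have "((t / 2) ^ (CARD('k) - 1)) powr l = (1/2) powr q * t powr q"
    proof -
      have "(t / 2) ^ (CARD('k) - 1) = (t / 2) powr real (CARD('k) - 1)"
        using t by (intro powr_realpow[symmetric]) simp
      moreover have "t / 2 = (1/2) * t" by simp
      ultimately show ?thesis by (simp only: kd powr_powr q_def powr_mult)
    qed
    ultimately have van: "(1/2) powr q * t powr q \<le> vandermonde d powr l" by simp
    have h: "min 1 (2 powr e) * t powr (e - a\<^sub>1) \<le> (1 + t) powr e * t powr - a\<^sub>1"
    proof -
      have "1 + t = (1 + 1 / t) * t" using t by (simp add: field_simps)
      then have eq: "(1 + t) powr e = (1 + 1 / t) powr e * t powr e" by (simp only: powr_mult)
      have "min 1 (2 powr e) * t powr (e - a\<^sub>1) \<le> (1 + 1 / t) powr e * t powr (e - a\<^sub>1)"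
        using t by (intro mult_right_mono powr_between) auto
      then show ?thesis unfolding eq diff_conv_add_uminus powr_add by (simp add: mult.assoc)
    qed
    have prodc: "(\<Prod>i\<in>UNIV - {b}. c) \<le> (\<Prod>i\<in>UNIV - {b}. (1 + d $ i) powr e * d $ i powr - a\<^sub>1)"
    proof (intro prod_mono conjI)
      fix i assume "i \<in> UNIV - {b}"
      then show "c \<le> (1 + d $ i) powr e * d $ i powr - a\<^sub>1" using d[of i]
        by (intro c(2)) (auto simp: A_def)
    qed (use c in simp)
    have "?c * t powr (e - a\<^sub>1 + q) =
      ((1/2) powr q * t powr q) * ((min 1 (2 powr e) * t powr (e - a\<^sub>1)) * (\<Prod>i\<in>UNIV - {b}. c))"
      by (simp add: card_Diff_singleton powr_add)
    also have "\<dots> \<le> vandermonde d powr l * (((1 + t) powr e * t powr - a\<^sub>1) * (\<Prod>i\<in>UNIV - {b}. (1 +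
        d $ i) powr e * d $ i powr - a\<^sub>1))"
      using t by (intro mult_mono[OF van mult_mono[OF h prodc]])
        (auto simp: t_def intro!: prod_nonneg mult_nonneg_nonneg zero_le_power less_imp_le[OF c(1)])
    also have "\<dots> = eigen_density m a\<^sub>1 a\<^sub>2 l d"
      unfolding eigen_density_eq[OF o] e_def[symmetric] t_def by (simp add: prod.remove[of UNIV b])
    finally show "?c * (d $ b) powr (e - a\<^sub>1 + q) \<le> eigen_density m a\<^sub>1 a\<^sub>2 l d" by (simp only: t_def)
  qed (use c in \<open>auto simp: A_def\<close>)
  then show thesis using that[of ?c] c by (simp add: A_def e_def q_def)
qed

text \<open>Existence of the posterior also demands a nonzero marginal. The box with free smallest
  eigenvalue provides it: on (1/2, 1) the number 1/t lies in [1, 2], so t^(-a_1) is bounded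
  below.\<close>

lemma nn_integral_eigen_density_pos:
  assumes l: "0 \<le> l"
  shows "0 < (\<integral>\<^sup>+ d. ennreal (eigen_density m a\<^sub>1 a\<^sub>2 l (d :: real^'k::{finite,wellorder})) \<partial>lborel)"
proof -
  obtain c where c: "0 < c"
    "ennreal c * (\<integral>\<^sup>+ t. ennreal (t powr - a\<^sub>1) * indicator {0<..<1} t \<partial>lborel) \<le>
      (\<integral>\<^sup>+ d. ennreal (eigen_density m a\<^sub>1 a\<^sub>2 l (d :: real^'k::{finite,wellorder})) \<partial>lborel)"
    by (rule nn_integral_eigen_density_ge_near_0[OF l])
  let ?b = "min 1 (2 powr a\<^sub>1) :: real"
  have "0 < ennreal c * ennreal (?b / 2)"
    using c(1) by (simp add: ennreal_zero_less_mult_iff)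
  also have "ennreal (?b / 2) = ennreal ?b * ennreal (1 - 1/2)"
    by (subst ennreal_mult[symmetric]) auto
  also have "\<dots> = ennreal ?b * emeasure lborel {1/2<..<1 :: real}"
    by (subst emeasure_lborel_Ioo) auto
  also have "\<dots> = (\<integral>\<^sup>+ t. ennreal ?b * indicator {1/2<..<1 :: real} t \<partial>lborel)"
    by (rule nn_integral_cmult_indicator[symmetric]) simp
  also have "\<dots> \<le> (\<integral>\<^sup>+ t. ennreal (t powr - a\<^sub>1) * indicator {0<..<1} t \<partial>lborel)"
  proof (rule nn_integral_mono)
    fix t :: real
    have "?b \<le> t powr - a\<^sub>1" if "1/2 < t" "t < 1"
    proof -
      have "?b \<le> (1 / t) powr a\<^sub>1" using that by (intro powr_between) (auto simp: field_simps)
      then show ?thesis using that by (simp add: powr_divide powr_minus_divide)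
    qed
    then show "ennreal ?b * indicator {1/2<..<1 :: real} t \<le> ennreal (t powr - a\<^sub>1) *
        indicator {0<..<1} t"
      by (auto simp: indicator_def intro!: ennreal_leI)
  qed
  finally show ?thesis using c(2) by (simp add: mult_left_mono less_le_trans)
qed

lemma nn_integral_eigen_density_finite_iff:
  assumes l: "0 \<le> l"
  shows "(\<integral>\<^sup>+ d. ennreal (eigen_density m a\<^sub>1 a\<^sub>2 l (d :: real^'k::{finite,wellorder})) \<partial>lborel) < \<infinity> \<longleftrightarrow>
    a\<^sub>1 < 1 \<and> a\<^sub>2 > (3 - real m) / 2 + (real CARD('k) - 1) * l"
    (is "?Z < \<infinity> \<longleftrightarrow> _")
proof
  assume fin: "?Z < \<infinity>"
  have "a\<^sub>1 < 1"
  proof (rule ccontr)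
    assume "\<not> a\<^sub>1 < 1"
    then have "(\<integral>\<^sup>+ t. ennreal (t powr - a\<^sub>1) * indicator {0<..<1} t \<partial>lborel) = \<infinity>"
      by (intro nn_integral_powr_at_0_infinite) simp
    moreover obtain c where "0 < c"
      "ennreal c * (\<integral>\<^sup>+ t. ennreal (t powr - a\<^sub>1) * indicator {0<..<1} t \<partial>lborel) \<le> ?Z"
      by (rule nn_integral_eigen_density_ge_near_0[OF l])
    ultimately show False using fin by (simp add: ennreal_mult_top top_unique)
  qed
  moreover have "a\<^sub>2 > (3 - real m) / 2 + (real CARD('k) - 1) * l"
  proof (rule ccontr)
    assume "\<not> ?thesis"
    then have "-1 \<le> a\<^sub>1 - a\<^sub>2 - (real m - 1) / 2 - a\<^sub>1 + (real CARD('k) - 1) * l"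
      by (simp add: field_simps)
    moreover have "1 \<le> CARD('k)" by (simp add: Suc_leI)
    then have "1 \<le> 4 * real CARD('k)" by linarith
    ultimately have "(\<integral>\<^sup>+ t. ennreal (t powr (a\<^sub>1 - a\<^sub>2 - (real m - 1) / 2 - a\<^sub>1 + (real CARD('k) - 1) *
        l)) *
       indicator {4 * real CARD('k)..} t \<partial>lborel) = \<infinity>"
      by (rule nn_integral_powr_at_top_infinite)
    moreover obtain c where "0 < c" "ennreal c *
        (\<integral>\<^sup>+ t. ennreal (t powr (a\<^sub>1 - a\<^sub>2 - (real m - 1) / 2 - a\<^sub>1 +
        (real CARD('k) - 1) * l)) * indicator {4 * real CARD('k)..} t \<partial>lborel) \<le> ?Z"
      by (rule nn_integral_eigen_density_ge_at_top[OF l])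
    ultimately show False using fin by (simp add: ennreal_mult_top top_unique)
  qed
  ultimately show "a\<^sub>1 < 1 \<and> a\<^sub>2 > (3 - real m) / 2 + (real CARD('k) - 1) * l" ..
next
  assume "a\<^sub>1 < 1 \<and> a\<^sub>2 > (3 - real m) / 2 + (real CARD('k) - 1) * l"
  then show "?Z < \<infinity>" using nn_integral_eigen_density_finite[OF l] by blast
qed

section \<open>Propriety of the posterior\<close>

text \<open>The ordering condition of the patch is already part of \<open>eigen_density\<close>, so
  only the box indicator remains and the integral factors.\<close>

lemma nn_integral_eigen_density_patch:
  assumes r: "0 \<le> r"
  shows "(\<integral>\<^sup>+ v. ennreal (eigen_density m a\<^sub>1 a\<^sub>2 l (diag_of v)) * indicator (spectral_patch r) v
      \<partial>(lborel :: ('k::{finite,wellorder}) upper_vec measure)) =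
    ennreal (2 * r) ^ card {p :: 'k upper. lo p \<noteq> hi p} * (\<integral>\<^sup>+ d. ennreal (eigen_density m a\<^sub>1 a\<^sub>2 l (d :: real^'k::{finite,wellorder})) \<partial>lborel)"
proof -
  have "ennreal (eigen_density m a\<^sub>1 a\<^sub>2 l (diag_of v)) * indicator (spectral_patch r) v =
    ennreal (eigen_density m a\<^sub>1 a\<^sub>2 l (diag_of v)) * (\<Prod>p\<in>{p. lo p \<noteq> hi p}. indicator {-r..r} (v $ p))"
    for v :: "('k::{finite,wellorder}) upper_vec"
  proof (cases "\<forall>p. lo p \<noteq> hi p \<longrightarrow> \<bar>v $ p\<bar> \<le> r")
    case True
    then have "(\<Prod>p\<in>{p. lo p \<noteq> hi p}. indicator {-r..r} (v $ p)) = (1 :: ennreal)"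
      by (intro prod.neutral) (auto simp: abs_le_iff minus_le_iff)
    then show ?thesis using True by (simp add: spectral_patch_def eigen_density_def indicator_def)
  next
    case False
    then obtain p where "lo p \<noteq> hi p" "\<not> \<bar>v $ p\<bar> \<le> r" by blast
    then have "(\<Prod>p\<in>{p. lo p \<noteq> hi p}. indicator {-r..r} (v $ p)) = (0 :: ennreal)"
      by (intro prod_zero) (auto intro!: bexI[of _ p] simp: abs_le_iff indicator_def)
    then show ?thesis using False by (auto simp: spectral_patch_def indicator_def)
  qed
  then show ?thesis using nn_integral_diag_of_box[OF _ r, of "\<lambda>d. ennreal (eigen_density m a\<^sub>1 a\<^sub>2 l d)"]
    by simp
qed

text \<open>Positivity of \<open>I\<close> and finiteness of \<open>Z\<close> follow from one patch,
  since its image carries only a part of \<open>I\<close>. Finiteness of \<open>I\<close> takes the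
  whole net; overlapping images are counted repeatedly, which an upper bound tolerates.\<close>

lemma nn_integral_reduced_density:
  fixes prior :: "('k::{finite,wellorder}) sq_matrix \<Rightarrow> real" and m :: nat
  assumes prior: "prior_density prior" and C: "0 < C\<^sub>1" "0 < C\<^sub>2" and l: "0 \<le> l"
    and bounds: "\<And>H d. orthogonal_matrix H \<Longrightarrow> ordered_spectrum d \<Longrightarrow>
           C\<^sub>1 * prior_bound a\<^sub>1 a\<^sub>2 l d \<le> prior_HD prior H d \<and>
           prior_HD prior H d \<le> C\<^sub>2 * prior_bound a\<^sub>1 a\<^sub>2 l d"
  defines "I \<equiv> (\<integral>\<^sup>+ w. ennreal (reduced_density m prior (sym_of w)) \<partial>lborel)"
    and "Z \<equiv> (\<integral>\<^sup>+ d. ennreal (eigen_density m a\<^sub>1 a\<^sub>2 l (d :: real^'k::{finite,wellorder})) \<partial>lborel)"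
  shows "0 < I" and "I < \<infinity> \<longleftrightarrow> Z < \<infinity>"
proof -
  \<comment> \<open>One radius serves twice: it makes the spectral map injective on the patches, and
    k r = 1/(4k) <= 1 makes it admissible for the net.\<close>
  define r where "r = 1 / (4 * (real CARD('k))\<^sup>2)"
  have k1: "1 \<le> real CARD('k)" by (simp add: Suc_leI)
  then have r: "0 < r" "r \<le> 1 / (4 * (real CARD('k))\<^sup>2)" "0 \<le> r" by (auto simp: r_def)
  have "real CARD('k) * r = 1 / (4 * real CARD('k))" by (simp add: r_def power2_eq_square)
  also have "\<dots> \<le> 1" using k1 by (subst divide_le_eq_1_pos; linarith)
  finally have rk: "real CARD('k) * r \<le> 1" .
  obtain F :: "('k::{finite,wellorder}) sq_matrix set" where
    F: "finite F" "\<And>Q. Q \<in> F \<Longrightarrow> orthogonal_matrix Q"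
    and net: "\<And>H. orthogonal_matrix H \<Longrightarrow> \<exists>Q\<in>F. \<exists>A. transpose A = - A \<and> (\<forall>i j. \<bar>A $ i $ j\<bar> \<le> r) \<and>
        cayley A ** Q = H"
    using finite_orthogonal_net[OF r(1) rk] by blast
  define f where "f w = ennreal (reduced_density m prior (sym_of w))" for w
  define S where "S = (spectral_patch r :: ('k::{finite,wellorder}) upper_vec set)"
  define IQ where "IQ Q = (\<integral>\<^sup>+ w. f w * indicator (spectral_map Q ` S) w \<partial>lebesgue)" for Q
  define K where "K = (fact CARD('k upper) * (2 * (real CARD('k))\<^sup>2) ^ CARD('k upper))\<^sup>2"
  define v where "v = ennreal (2 * r) ^ card {p :: 'k upper. lo p \<noteq> hi p}"
  have v: "0 < v" "v < \<infinity>"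
    using r unfolding v_def by (auto simp: power_less_top_ennreal zero_less_iff_neq_zero)
  have vZ_eq: "v * Z = (\<integral>\<^sup>+ u. ennreal (eigen_density m a\<^sub>1 a\<^sub>2 l (diag_of u)) * indicator S u \<partial>lborel)"
    unfolding v_def Z_def S_def by (rule nn_integral_eigen_density_patch[OF r(3), symmetric])
  have patch: "IQ Q \<le> ennreal (K * C\<^sub>2) * (v * Z)" "v * Z \<le> ennreal (K / C\<^sub>1) * IQ Q"
      if Q: "orthogonal_matrix Q" for Q
    unfolding vZ_eq IQ_def f_def S_def K_def
    by (rule nn_integral_spectral_patch_image[OF prior Q r(2,3) C], rule bounds; assumption)+
  have I: "I = (\<integral>\<^sup>+ w. f w \<partial>lebesgue)" unfolding I_def f_def nn_integral_completion ..
  have le_I: "IQ Q \<le> I" for Q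
    unfolding I IQ_def by (intro nn_integral_mono) (simp add: indicator_def)
  \<comment> \<open>Any orthogonal centre would do here; the identity is one at hand without appeal
    to the net.\<close>
  have vZ: "v * Z \<le> ennreal (K / C\<^sub>1) * I"
    by (rule order_trans[OF patch(2)[OF orthogonal_matrix_id]]) (intro mult_left_mono le_I, simp)
  have "0 < v * Z"
    using v(1) nn_integral_eigen_density_pos[OF l] unfolding Z_def
      by (simp add: ennreal_zero_less_mult_iff)
  then show "0 < I" using vZ by (metis mult_zero_right not_gr_zero leD)
  show "I < \<infinity> \<longleftrightarrow> Z < \<infinity>"
  proof
    assume "I < \<infinity>"
    then have "ennreal (K / C\<^sub>1) * I < \<infinity>" by (simp add: ennreal_mult_less_top)
    then have "v * Z < \<infinity>" by (rule le_less_trans[OF vZ])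
    then show "Z < \<infinity>" using v(1) by (auto simp: ennreal_mult_less_top)
  next
    assume Z: "Z < \<infinity>"
    have [measurable]: "f \<in> borel_measurable lebesgue"
      unfolding f_def
      by (intro measurable_completion measurable_compose[OF _ measurable_ennreal])
        (simp add: measurable_compose[OF measurable_sym_of measurable_reduced_density[OF prior]])
    have [measurable]: "spectral_map Q ` S \<in> sets lebesgue" for Q
      by (rule differentiable_image_in_sets_lebesgue[OF _ order_refl spectral_map_differentiable_on])
        (simp add: S_def borel_spectral_patch)
    let ?N = "\<Union>Q\<in>F. spectral_map Q ` {v. \<exists>i j. i < j \<and> diag_of v $ i = diag_of v $ j}"
    have "?N \<in> null_sets lebesgue"
      using negligible_spectral_map_repeated[OF F(1)] by (simp add: negligible_iff_null_sets)
    then have "AE w in lebesgue. w \<notin> ?N" by (rule AE_not_in)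
    \<comment> \<open>Only almost everywhere: a positive-definite matrix with a repeated eigenvalue
      lies in no image of a patch.\<close>
    then have "AE w in lebesgue. f w \<le> (\<Sum>Q\<in>F. f w * indicator (spectral_map Q ` S) w)"
    proof eventually_elim
      case (elim w)
      show ?case
      proof (cases "pos_def (sym_of w)")
        case True
        then obtain Q where Q: "Q \<in> F" "w \<in> spectral_map Q ` S"
          using ex_spectral_map[OF net True] elim unfolding S_def by blast
        have "f w = f w * indicator (spectral_map Q ` S) w" using Q by simp
        also have "\<dots> \<le> (\<Sum>Q\<in>F. f w * indicator (spectral_map Q ` S) w)"
          using F(1) Q(1) by (intro member_le_sum) auto
        finally show ?thesis .
      qed (simp add: f_def reduced_density_def)
    qed
    then have "I \<le> (\<integral>\<^sup>+ w. (\<Sum>Q\<in>F. f w * indicator (spectral_map Q ` S) w) \<partial>lebesgue)"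
      unfolding I by (rule nn_integral_mono_AE)
    also have "\<dots> = (\<Sum>Q\<in>F. IQ Q)"
      unfolding IQ_def by (rule nn_integral_sum) measurable
    also have "\<dots> \<le> (\<Sum>Q\<in>F. ennreal (K * C\<^sub>2) * (v * Z))"
      by (intro sum_mono patch(1) F(2))
    also have "\<dots> < \<infinity>"
      using v(2) Z by (simp add: ennreal_mult_less_top ennreal_of_nat_eq_real_of_nat)
    finally show "I < \<infinity>" .
  qed
qed

theorem theorem2p6:
  fixes prior\<^sub>V :: "real^'k::{finite,wellorder}^'k::{finite,wellorder} \<Rightarrow> real"
    and a\<^sub>1 a\<^sub>2 l C\<^sub>1 C\<^sub>2 :: real
    and x :: "real^'k::{finite,wellorder}^'m::finite"
  assumes "CARD('k) \<ge> 2" and "CARD('m) \<ge> 2"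
    and "0 \<le> l" and "l \<le> 1"
    and "prior_density prior\<^sub>V"
    and "0 < C\<^sub>1" and "0 < C\<^sub>2"
    and "\<And>H d. orthogonal_matrix H \<Longrightarrow> ordered_spectrum d \<Longrightarrow>
           C\<^sub>1 * prior_bound a\<^sub>1 a\<^sub>2 l d \<le> prior_HD prior\<^sub>V H d \<and>
           prior_HD prior\<^sub>V H d \<le> C\<^sub>2 * prior_bound a\<^sub>1 a\<^sub>2 l d"
  shows "posterior_exists (\<lambda>\<beta>. 1) prior\<^sub>V x \<longleftrightarrow>
           a\<^sub>1 < 1 \<and> a\<^sub>2 > (3 - real CARD('m)) / 2 + (real CARD('k) - 1) * l"
proof -
  define I where "I = (\<integral>\<^sup>+ w. ennreal (reduced_density CARD('m) prior\<^sub>V (sym_of w)) \<partial>lborel)"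
  define c where "c = ((exp (- (norm x)\<^sup>2 - 1) / sqrt (2 * pi)) ^ CARD('m)) ^ CARD('k)"
  let ?m = "marginal_density (\<lambda>\<beta>. 1) prior\<^sub>V x"
  have m: "?m \<le> I" "ennreal c * I \<le> ?m"
    unfolding I_def c_def by (rule marginal_density_bounds[OF assms(5)])+
  have "0 < c" by (simp add: c_def)
  have I: "0 < I" "I < \<infinity> \<longleftrightarrow> a\<^sub>1 < 1 \<and> a\<^sub>2 > (3 - real CARD('m)) / 2 + (real CARD('k) - 1) * l"
    unfolding I_def using nn_integral_reduced_density[OF assms(5,6,7,3,8)]
    by (simp_all only: nn_integral_eigen_density_finite_iff[OF assms(3)])
  \<comment> \<open>Positivity of the marginal holds whatever \<open>a\<^sub>1\<close> and
    \<open>a\<^sub>2\<close> are, so the equivalence rests on finiteness alone.\<close>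
  have "0 < ennreal c * I" using \<open>0 < c\<close> I(1) by (simp add: ennreal_zero_less_mult_iff)
  then have "0 < ?m" using m(2) by (rule less_le_trans)
  moreover have "?m < \<infinity> \<longleftrightarrow> I < \<infinity>"
  proof
    assume "?m < \<infinity>"
    then have "ennreal c * I < \<infinity>" using m(2) by (rule le_less_trans[rotated])
    then show "I < \<infinity>" using \<open>0 < c\<close> by (auto simp: ennreal_mult_less_top)
  qed (use m(1) in \<open>rule le_less_trans\<close>)
  ultimately show ?thesis by (simp only: posterior_exists_def I(2) simp_thms)
qed

end
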